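(* Let $\mathcal{C},\mathcal{A}_1,\dots,\mathcal{A}_k$ ($k\ge 2$) be pretriangulated dg categories and let $F_i:\mathcal{A}_i\to\mathcal{C}$ be spherical dg functors, i.e. the data of a perverse schober. Let $\mathcal{G}\ell(\mathcal{A}_i,F_i)$ be the iterated gluing, with its functor $c_{F_1,\dots,F_k}:\mathcal{G}\ell(\mathcal{A}_i,F_i)\to\mathrm{Tw}\,\mathcal{C}$, and let $\Gamma\mathcal{S}(\mathcal{A}_i,F_i)$ be the category of global sections of the perverse schober, with its functor $s_\infty:\Gamma\mathcal{S}(\mathcal{A}_i,F_i)\to\mathrm{Tw}\,\mathcal{C}$. Then there is a quasi-equivalence $$Q_{F_1,\dots,F_k}:\mathcal{G}\ell(\mathcal{A}_i,F_i)\longrightarrow\Gamma\mathcal{S}(\mathcal{A}_i,F_i)$$ such that $s_\infty\circ Q_{F_1,\dots,F_k}=c_{F_1,\dots,F_k}$.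
   Context: All dg categories are over a field of characteristic $0$, with differentials of degree $+1$; $H^0\mathcal{A}$ is the homotopy category, $\mathrm{Tw}\,\mathcal{A}$ the dg category of (one-sided) twisted complexes over $\mathcal{A}$. A functor to $\mathcal{C}$ is also regarded as a functor to $\mathrm{Tw}\,\mathcal{C}$, and a functor $\mathcal A\to\mathcal B$ is extended to $\mathrm{Tw}$ when needed. Spherical functor: a dg functor $F:\mathcal{A}\to\mathcal{B}$ with right and left adjoint quasifunctors $R$, $L$ such that $T=\mathrm{Cone}(FR\to\mathrm{id})$ induces an autoequivalence of $H^0\mathcal{B}$ and, with $C=\mathrm{Cone}(\mathrm{id}\to RF)[-1]$, the composition $R\to RFL\to CL[1]$ is a quasi-isomorphism of bimodules. Gluing: for dg functors $F_1:\mathcal{A}_1\to\mathcal{D}$, $F_2:\mathcal{A}_2\to\mathcal{D}$, $\mathcal{A}_1\times_{F_1,F_2}\mathcal{A}_2$ is the dg category with objects $(a,b,\mu)$, $a\in\mathcal{A}_1$, $b\in\mathcal{A}_2$, $\mu\in\hom_{\mathcal{D}}(F_1(a),F_2(b))$ closed of degree $0$; degree $i$ morphisms $(a,b,\mu)\to(c,d,\xi)$ are triples $(f,g,h)\in\hom^i(a,c)\oplus\hom^i(b,d)\oplus\hom^{i-1}_{\mathcal{D}}(F_1(a),F_2(d))$, with differential $(df,dg,-dh+F_2(g)\mu-\xi F_1(f))$ and composition $(f',g',h')(f,g,h)=(f'f,g'g,h'F_1(f)+(-1)^{\deg g'}F_2(g')h)$. The functor $c_{F_1,F_2}:\mathcal{A}_1\times_{F_1,F_2}\mathcal{A}_2\to\mathrm{Tw}\,\mathcal{D}$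 sends $(a,b,\mu)$ to $\mathrm{Cone}(\mu)$ and $(f,g,h)$ to the triangular matrix with diagonal entries $F_1(f)$, $F_2(g)$ and off-diagonal entry $h$ (with the standard signs). The homotopy fiber product $\mathcal{A}_1\times^h_{\mathcal{D}}\mathcal{A}_2$ is the full subcategory of $\mathcal{A}_1\times_{F_1,F_2}\mathcal{A}_2$ of objects with $[\mu]$ an isomorphism in $H^0\mathcal{D}$. Iterated gluing: $\mathcal{G}\ell$ of $(\mathcal{A}_1,F_1),(\mathcal{A}_2,F_2)$ is $\mathcal{A}_1\times_{F_1,F_2}\mathcal{A}_2$ with functor $c_{F_1,F_2}$; recursively, $\mathcal{G}\ell$ of $(\mathcal{A}_1,F_1),\dots,(\mathcal{A}_k,F_k)$ is the gluing, along $c_{F_1,\dots,F_{k-1}}$ and $F_k$, of $\mathcal{G}\ell$ of the first $k-1$ pairs with $\mathcal{A}_k$, and $c_{F_1,\dots,F_k}$ is its cone functor to $\mathrm{Tw}\,\mathcal{C}$. Categories $A_k(\mathcal{C})$: $A_2(\mathcal{C})=\mathrm{Tw}\,\mathcal{C}\times_{\mathrm{id},\mathrm{id}}\mathrm{Tw}\,\mathcal{C}$, with functors to $\mathrm{Tw}\,\mathcal{C}$ given by $f_1(a,b,\mu)=a$, $f_2(a,b,\mu)=b$, and $f_3=c_{\mathrm{id},\mathrm{id}}$, $f_3(a,b,\mu)=\mathrm{Cone}(\mu)$. Recursively, $A_k(\mathcal{C})$ is the homotopy fiber product of $A_{k-1}(\mathcal{C})\xrightarrow{f_k}\mathrm{Tw}\,\mathcal{C}\xleftarrow{f_1}A_2(\mathcal{C})$,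 with projections $g$, $h$ to $A_{k-1}(\mathcal{C})$, $A_2(\mathcal{C})$; its functors $f_1,\dots,f_{k+1}$ to $\mathrm{Tw}\,\mathcal{C}$ are $f_1g,\dots,f_{k-1}g,f_2h,f_3h$. Global sections: $\Gamma\mathcal{S}(\mathcal{A}_i,F_i)$ is the homotopy fiber product of $$\mathcal{A}_1\times\dots\times\mathcal{A}_k\xrightarrow{F_1\times\dots\times F_k}(\mathrm{Tw}\,\mathcal{C})^{k}\xleftarrow{f_1\times\dots\times f_k}A_k(\mathcal{C}),$$ and $s_\infty$ is the composition of the projection to $A_k(\mathcal{C})$ with $f_{k+1}$. *)

theory Defs
  imports Complex_Main "HOL-Library.Function_Algebras" "HOL-Library.Product_Plus" "HOL-Library.FuncSet"
begin

section \<open>Complexes and cohomology\<close>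

definition sg :: "int \<Rightarrow> 'v::ab_group_add \<Rightarrow> 'v" where
  "sg i v = (if even i then v else - v)"

text \<open>A complex is a graded family \<open>V i\<close> of subspaces of one ambient vector space together
  with the differentials \<open>d i\<close> from \<open>V i\<close> to \<open>V (i + 1)\<close>.\<close>

definition cocycles :: "(int \<Rightarrow> 'v::ab_group_add set) \<Rightarrow> (int \<Rightarrow> 'v \<Rightarrow> 'v) \<Rightarrow> int \<Rightarrow> 'v set" where
  "cocycles V d i = {z \<in> V i. d i z = 0}"

definition cclass :: "(int \<Rightarrow> 'v::ab_group_add set) \<Rightarrow> (int \<Rightarrow> 'v \<Rightarrow> 'v) \<Rightarrow> int \<Rightarrow> 'v \<Rightarrow> 'v set" where
  "cclass V d i z = {z'. z' - z \<in> d (i - 1) ` V (i - 1)}"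

definition cohomology :: "(int \<Rightarrow> 'v::ab_group_add set) \<Rightarrow> (int \<Rightarrow> 'v \<Rightarrow> 'v) \<Rightarrow> int \<Rightarrow> 'v set set" where
  "cohomology V d i = cclass V d i ` cocycles V d i"

definition quasi_iso ::
  "(int \<Rightarrow> 'v::ab_group_add set) \<Rightarrow> (int \<Rightarrow> 'v \<Rightarrow> 'v) \<Rightarrow>
   (int \<Rightarrow> 'w::ab_group_add set) \<Rightarrow> (int \<Rightarrow> 'w \<Rightarrow> 'w) \<Rightarrow> (int \<Rightarrow> 'v \<Rightarrow> 'w) \<Rightarrow> bool" where
  "quasi_iso V d W e \<phi> \<longleftrightarrow>
     (\<forall>i. bij_betw (\<lambda>X. \<Union>x\<in>X. cclass W e i (\<phi> i x)) (cohomology V d i) (cohomology W e i))"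

definition linear_on ::
  "'v::ab_group_add set \<Rightarrow> ('k \<Rightarrow> 'v \<Rightarrow> 'v) \<Rightarrow> ('k \<Rightarrow> 'w::ab_group_add \<Rightarrow> 'w) \<Rightarrow> ('v \<Rightarrow> 'w) \<Rightarrow> bool" where
  "linear_on V s s' f \<longleftrightarrow>
     (\<forall>x\<in>V. \<forall>y\<in>V. f (x + y) = f x + f y) \<and> (\<forall>c. \<forall>x\<in>V. f (s c x) = s' c (f x))"

section \<open>dg categories and dg functors\<close>

text \<open>\<open>hom A a b i\<close> is the space of morphisms of degree \<open>i\<close>. All morphism spaces are subspaces
  of one ambient vector space (for instance the direct sum of all of them). They need not be
  disjoint for different objects and degrees, hence objects and degrees are arguments of the
  operations: \<open>cmp A a b c j i g f\<close> is the composition \<open>g f\<close> of \<open>f : a \<rightarrow> b\<close> of degree \<open>i\<close> and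
  \<open>g : b \<rightarrow> c\<close> of degree \<open>j\<close>.\<close>

record ('o, 'm, 'k) dgcat =
  obj :: "'o set"
  hom :: "'o \<Rightarrow> 'o \<Rightarrow> int \<Rightarrow> 'm set"
  scl :: "'k \<Rightarrow> 'm \<Rightarrow> 'm"
  dif :: "'o \<Rightarrow> 'o \<Rightarrow> int \<Rightarrow> 'm \<Rightarrow> 'm"
  cmp :: "'o \<Rightarrow> 'o \<Rightarrow> 'o \<Rightarrow> int \<Rightarrow> int \<Rightarrow> 'm \<Rightarrow> 'm \<Rightarrow> 'm"
  idt :: "'o \<Rightarrow> 'm"

locale dg_category =
  fixes A :: "('o, 'm::ab_group_add, 'k::field_char_0) dgcat"
  assumes scl_vector_space: "vector_space (scl A)"
    and hom_subspace: "\<lbrakk>a \<in> obj A; b \<in> obj A\<rbrakk> \<Longrightarrow> module.subspace (scl A) (hom A a b i)"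
    and dif_hom: "\<lbrakk>a \<in> obj A; b \<in> obj A; f \<in> hom A a b i\<rbrakk> \<Longrightarrow> dif A a b i f \<in> hom A a b (i + 1)"
    and dif_linear: "\<lbrakk>a \<in> obj A; b \<in> obj A\<rbrakk> \<Longrightarrow>
      linear_on (hom A a b i) (scl A) (scl A) (dif A a b i)"
    and dif_dif: "\<lbrakk>a \<in> obj A; b \<in> obj A; f \<in> hom A a b i\<rbrakk> \<Longrightarrow>
      dif A a b (i + 1) (dif A a b i f) = 0"
    and cmp_hom: "\<lbrakk>a \<in> obj A; b \<in> obj A; c \<in> obj A; g \<in> hom A b c j; f \<in> hom A a b i\<rbrakk> \<Longrightarrow>
      cmp A a b c j i g f \<in> hom A a c (j + i)"
    and cmp_linear_left: "\<lbrakk>a \<in> obj A; b \<in> obj A; c \<in> obj A; f \<in> hom A a b i\<rbrakk> \<Longrightarrow>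
      linear_on (hom A b c j) (scl A) (scl A) (\<lambda>g. cmp A a b c j i g f)"
    and cmp_linear_right: "\<lbrakk>a \<in> obj A; b \<in> obj A; c \<in> obj A; g \<in> hom A b c j\<rbrakk> \<Longrightarrow>
      linear_on (hom A a b i) (scl A) (scl A) (\<lambda>f. cmp A a b c j i g f)"
    and cmp_assoc: "\<lbrakk>a \<in> obj A; b \<in> obj A; c \<in> obj A; d \<in> obj A;
        h \<in> hom A c d l; g \<in> hom A b c j; f \<in> hom A a b i\<rbrakk> \<Longrightarrow>
      cmp A a b d (l + j) i (cmp A b c d l j h g) f = cmp A a c d l (j + i) h (cmp A a b c j i g f)"
    and leibniz: "\<lbrakk>a \<in> obj A; b \<in> obj A; c \<in> obj A; g \<in> hom A b c j; f \<in> hom A a b i\<rbrakk> \<Longrightarrow>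
      dif A a c (j + i) (cmp A a b c j i g f) =
        cmp A a b c (j + 1) i (dif A b c j g) f + sg j (cmp A a b c j (i + 1) g (dif A a b i f))"
    and idt_hom: "a \<in> obj A \<Longrightarrow> idt A a \<in> hom A a a 0"
    and dif_idt: "a \<in> obj A \<Longrightarrow> dif A a a 0 (idt A a) = 0"
    and idt_left: "\<lbrakk>a \<in> obj A; b \<in> obj A; f \<in> hom A a b i\<rbrakk> \<Longrightarrow> cmp A a b b 0 i (idt A b) f = f"
    and idt_right: "\<lbrakk>a \<in> obj A; b \<in> obj A; f \<in> hom A a b i\<rbrakk> \<Longrightarrow> cmp A a a b i 0 f (idt A a) = f"

record ('o, 'm, 'p, 'n) dgfun =
  fob :: "'o \<Rightarrow> 'p"
  fmor :: "'o \<Rightarrow> 'o \<Rightarrow> int \<Rightarrow> 'm \<Rightarrow> 'n"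

locale dg_functor =
  dom: dg_category A + cod: dg_category B
  for A :: "('o, 'm::ab_group_add, 'k::field_char_0) dgcat"
    and B :: "('p, 'n::ab_group_add, 'k) dgcat" +
  fixes F :: "('o, 'm, 'p, 'n) dgfun"
  assumes fob_obj: "a \<in> obj A \<Longrightarrow> fob F a \<in> obj B"
    and fmor_hom: "\<lbrakk>a \<in> obj A; b \<in> obj A; f \<in> hom A a b i\<rbrakk> \<Longrightarrow>
      fmor F a b i f \<in> hom B (fob F a) (fob F b) i"
    and fmor_linear: "\<lbrakk>a \<in> obj A; b \<in> obj A\<rbrakk> \<Longrightarrow>
      linear_on (hom A a b i) (scl A) (scl B) (fmor F a b i)"
    and fmor_dif: "\<lbrakk>a \<in> obj A; b \<in> obj A; f \<in> hom A a b i\<rbrakk> \<Longrightarrow>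
      fmor F a b (i + 1) (dif A a b i f) = dif B (fob F a) (fob F b) i (fmor F a b i f)"
    and fmor_cmp: "\<lbrakk>a \<in> obj A; b \<in> obj A; c \<in> obj A; g \<in> hom A b c j; f \<in> hom A a b i\<rbrakk> \<Longrightarrow>
      fmor F a c (j + i) (cmp A a b c j i g f) =
        cmp B (fob F a) (fob F b) (fob F c) j i (fmor F b c j g) (fmor F a b i f)"
    and fmor_idt: "a \<in> obj A \<Longrightarrow> fmor F a a 0 (idt A a) = idt B (fob F a)"

definition id_fun :: "('o, 'm, 'o, 'm) dgfun" where
  "id_fun = \<lparr>fob = (\<lambda>a. a), fmor = (\<lambda>a b i f. f)\<rparr>"

definition comp_fun ::
  "('p, 'n, 'q, 'r) dgfun \<Rightarrow> ('o, 'm, 'p, 'n) dgfun \<Rightarrow> ('o, 'm, 'q, 'r) dgfun" (infixl "\<circ>\<circ>" 55) where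
  "G \<circ>\<circ> F = \<lparr>fob = (\<lambda>a. fob G (fob F a)),
     fmor = (\<lambda>a b i f. fmor G (fob F a) (fob F b) i (fmor F a b i f))\<rparr>"

text \<open>Equality of functors: the values outside the objects and morphism spaces of the source
  are irrelevant.\<close>

definition fun_eq_on ::
  "('o, 'm, 'k) dgcat \<Rightarrow> ('o, 'm, 'p, 'n) dgfun \<Rightarrow> ('o, 'm, 'p, 'n) dgfun \<Rightarrow> bool" where
  "fun_eq_on A F G \<longleftrightarrow>
     (\<forall>a\<in>obj A. fob F a = fob G a) \<and>
     (\<forall>a\<in>obj A. \<forall>b\<in>obj A. \<forall>i. \<forall>f\<in>hom A a b i. fmor F a b i f = fmor G a b i f)"

section \<open>Homotopy category and quasi-equivalences\<close>

record ('o, 'h) cat =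
  cobj :: "'o set"
  chom :: "'o \<Rightarrow> 'o \<Rightarrow> 'h set"
  ccmp :: "'o \<Rightarrow> 'o \<Rightarrow> 'o \<Rightarrow> 'h \<Rightarrow> 'h \<Rightarrow> 'h"
  cid :: "'o \<Rightarrow> 'h"

definition H0 :: "('o, 'm::ab_group_add, 'k) dgcat \<Rightarrow> ('o, 'm set) cat" where
  "H0 A = \<lparr>cobj = obj A,
     chom = (\<lambda>a b. cohomology (hom A a b) (dif A a b) 0),
     ccmp = (\<lambda>a b c Y X. \<Union>g\<in>Y. \<Union>f\<in>X. cclass (hom A a c) (dif A a c) 0 (cmp A a b c 0 0 g f)),
     cid = (\<lambda>a. cclass (hom A a a) (dif A a a) 0 (idt A a))\<rparr>"

definition iso_in :: "('o, 'h) cat \<Rightarrow> 'o \<Rightarrow> 'o \<Rightarrow> 'h \<Rightarrow> bool" where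
  "iso_in K a b f \<longleftrightarrow> f \<in> chom K a b \<and>
     (\<exists>g\<in>chom K b a. ccmp K a b a g f = cid K a \<and> ccmp K b a b f g = cid K b)"

definition quasi_equivalence ::
  "('o, 'm::ab_group_add, 'k::field_char_0) dgcat \<Rightarrow> ('p, 'n::ab_group_add, 'k) dgcat \<Rightarrow>
   ('o, 'm, 'p, 'n) dgfun \<Rightarrow> bool" where
  "quasi_equivalence A B F \<longleftrightarrow> dg_functor A B F \<and>
     (\<forall>a\<in>obj A. \<forall>b\<in>obj A. quasi_iso (hom A a b) (dif A a b)
        (hom B (fob F a) (fob F b)) (dif B (fob F a) (fob F b)) (fmor F a b)) \<and>
     (\<forall>y\<in>obj B. \<exists>x\<in>obj A. \<exists>u. iso_in (H0 B) (fob F x) y u)"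

definition equivalence_of_cats ::
  "('o, 'h) cat \<Rightarrow> ('p, 'l) cat \<Rightarrow> ('o \<Rightarrow> 'p) \<Rightarrow> ('o \<Rightarrow> 'o \<Rightarrow> 'h \<Rightarrow> 'l) \<Rightarrow> bool" where
  "equivalence_of_cats K L \<Phi>o \<Phi>m \<longleftrightarrow>
     (\<forall>a\<in>cobj K. \<Phi>o a \<in> cobj L \<and> \<Phi>m a a (cid K a) = cid L (\<Phi>o a)) \<and>
     (\<forall>a\<in>cobj K. \<forall>b\<in>cobj K. \<forall>c\<in>cobj K. \<forall>g\<in>chom K b c. \<forall>f\<in>chom K a b.
        \<Phi>m a c (ccmp K a b c g f) = ccmp L (\<Phi>o a) (\<Phi>o b) (\<Phi>o c) (\<Phi>m b c g) (\<Phi>m a b f)) \<and>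
     (\<forall>a\<in>cobj K. \<forall>b\<in>cobj K. bij_betw (\<Phi>m a b) (chom K a b) (chom L (\<Phi>o a) (\<Phi>o b))) \<and>
     (\<forall>y\<in>cobj L. \<exists>x\<in>cobj K. \<exists>u. iso_in L (\<Phi>o x) y u)"

section \<open>Twisted complexes\<close>

text \<open>A one-sided twisted complex is a finite formal sum of shifted objects \<open>E\<^sub>p[r\<^sub>p]\<close> (a list,
  possibly empty) with a strictly triangular matrix \<open>q\<close>, where the entry \<open>q p s\<close> goes from the
  \<open>p\<close>-th to the \<open>s\<close>-th summand. Morphisms of degree \<open>i\<close> from \<open>E[r]\<close> to \<open>E'[r']\<close> are the elements
  of \<open>hom E E' (i + r' - r)\<close>, with the differential of \<open>A\<close> multiplied by \<open>(-1)\<^sup>r\<^sup>'\<close> and with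
  unchanged composition. Matrices are padded by zero.\<close>

type_synonym 'm mat = "nat \<Rightarrow> nat \<Rightarrow> 'm"
type_synonym ('o, 'm) tw = "('o \<times> int) list \<times> 'm mat"

definition tlen :: "('o, 'm) tw \<Rightarrow> nat" where "tlen X = length (fst X)"
definition tob :: "('o, 'm) tw \<Rightarrow> nat \<Rightarrow> 'o" where "tob X p = fst (fst X ! p)"
definition tsh :: "('o, 'm) tw \<Rightarrow> nat \<Rightarrow> int" where "tsh X p = snd (fst X ! p)"

definition tw_hom ::
  "('o, 'm::ab_group_add, 'k) dgcat \<Rightarrow> ('o, 'm) tw \<Rightarrow> ('o, 'm) tw \<Rightarrow> int \<Rightarrow> 'm mat set" where
  "tw_hom A X Y i = {M. \<forall>p s.
     if p < tlen X \<and> s < tlen Y then M p s \<in> hom A (tob X p) (tob Y s) (i + tsh Y s - tsh X p)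
     else M p s = 0}"

definition tw_int ::
  "('o, 'm::ab_group_add, 'k) dgcat \<Rightarrow> ('o, 'm) tw \<Rightarrow> ('o, 'm) tw \<Rightarrow> int \<Rightarrow> 'm mat \<Rightarrow> 'm mat" where
  "tw_int A X Y i M = (\<lambda>p s.
     if p < tlen X \<and> s < tlen Y
     then sg (tsh Y s) (dif A (tob X p) (tob Y s) (i + tsh Y s - tsh X p) (M p s))
     else 0)"

definition tw_cmp ::
  "('o, 'm::ab_group_add, 'k) dgcat \<Rightarrow> ('o, 'm) tw \<Rightarrow> ('o, 'm) tw \<Rightarrow> ('o, 'm) tw \<Rightarrow> int \<Rightarrow> int \<Rightarrow>
   'm mat \<Rightarrow> 'm mat \<Rightarrow> 'm mat" where
  "tw_cmp A X Y Z j i N M = (\<lambda>p s.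
     if p < tlen X \<and> s < tlen Z
     then \<Sum>l<tlen Y. cmp A (tob X p) (tob Y l) (tob Z s)
            (j + tsh Z s - tsh Y l) (i + tsh Y l - tsh X p) (N l s) (M p l)
     else 0)"

definition tw_obj :: "('o, 'm::ab_group_add, 'k) dgcat \<Rightarrow> ('o, 'm) tw set" where
  "tw_obj A = {X. (\<forall>p<tlen X. tob X p \<in> obj A) \<and> snd X \<in> tw_hom A X X 1 \<and>
     (\<forall>p s. s \<le> p \<longrightarrow> snd X p s = 0) \<and>
     tw_int A X X 1 (snd X) + tw_cmp A X X X 1 1 (snd X) (snd X) = 0}"

definition Tw :: "('o, 'm::ab_group_add, 'k) dgcat \<Rightarrow> (('o, 'm) tw, 'm mat, 'k) dgcat" where
  "Tw A = \<lparr>obj = tw_obj A,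
     hom = tw_hom A,
     scl = (\<lambda>c M p s. scl A c (M p s)),
     dif = (\<lambda>X Y i M. tw_int A X Y i M + tw_cmp A X Y Y 1 i (snd Y) M
                       - sg i (tw_cmp A X X Y i 1 M (snd X))),
     cmp = tw_cmp A,
     idt = (\<lambda>X p s. if p = s \<and> p < tlen X then idt A (tob X p) else 0)\<rparr>"

definition tw_incl :: "('o, 'm::zero, ('o, 'm) tw, 'm mat) dgfun" where
  "tw_incl = \<lparr>fob = (\<lambda>a. ([(a, 0)], (\<lambda>p s. 0))),
     fmor = (\<lambda>a b i f p s. if p = 0 \<and> s = 0 then f else 0)\<rparr>"

definition pretriangulated :: "('o, 'm::ab_group_add, 'k::field_char_0) dgcat \<Rightarrow> bool" where
  "pretriangulated A \<longleftrightarrow> dg_category A \<and> quasi_equivalence A (Tw A) tw_incl"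

text \<open>\<open>block n n' P S H\<close> is the triangular block matrix with diagonal blocks \<open>P\<close> and \<open>S\<close>, where
  \<open>P\<close> has \<open>n\<close> sources and \<open>n'\<close> targets, and with \<open>H\<close> going from the first to the second block.\<close>

definition block :: "nat \<Rightarrow> nat \<Rightarrow> 'm::zero mat \<Rightarrow> 'm mat \<Rightarrow> 'm mat \<Rightarrow> 'm mat" where
  "block n n' P S H = (\<lambda>p s.
     if p < n then (if s < n' then P p s else H p (s - n'))
     else (if s < n' then 0 else S (p - n) (s - n')))"

text \<open>The cone of a closed morphism \<open>\<mu> : X \<rightarrow> Y\<close> of degree 0 of twisted complexes, already
  convolved to a twisted complex on the summands of \<open>X[1]\<close> and \<open>Y\<close>. With the above conventions
  the shift \<open>[1]\<close> negates the matrix of \<open>X\<close> and multiplies morphisms of degree \<open>i\<close> by \<open>(-1)\<^sup>i\<close>.\<close>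

definition Cone :: "('o, 'm::ab_group_add) tw \<Rightarrow> ('o, 'm) tw \<Rightarrow> 'm mat \<Rightarrow> ('o, 'm) tw" where
  "Cone X Y \<mu> = (map (\<lambda>(e, r). (e, r + 1)) (fst X) @ fst Y,
     block (tlen X) (tlen X) (- snd X) (snd Y) \<mu>)"

section \<open>Gluing and homotopy fiber products\<close>

definition glue ::
  "('q, 'r::ab_group_add, 'k) dgcat \<Rightarrow> ('o, 'm, 'k) dgcat \<Rightarrow> ('p, 'n, 'k) dgcat \<Rightarrow>
   ('o, 'm, 'q, 'r) dgfun \<Rightarrow> ('p, 'n, 'q, 'r) dgfun \<Rightarrow>
   ('o \<times> 'p \<times> 'r, 'm \<times> 'n \<times> 'r, 'k) dgcat" where
  "glue D A1 A2 F1 F2 = \<lparr>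
     obj = {(a, b, \<mu>). a \<in> obj A1 \<and> b \<in> obj A2 \<and>
              \<mu> \<in> hom D (fob F1 a) (fob F2 b) 0 \<and> dif D (fob F1 a) (fob F2 b) 0 \<mu> = 0},
     hom = (\<lambda>(a, b, \<mu>) (c, d, \<xi>) i.
              hom A1 a c i \<times> hom A2 b d i \<times> hom D (fob F1 a) (fob F2 d) (i - 1)),
     scl = (\<lambda>x (f, g, h). (scl A1 x f, scl A2 x g, scl D x h)),
     dif = (\<lambda>(a, b, \<mu>) (c, d, \<xi>) i (f, g, h).
              (dif A1 a c i f, dif A2 b d i g,
               - dif D (fob F1 a) (fob F2 d) (i - 1) h
               + cmp D (fob F1 a) (fob F2 b) (fob F2 d) i 0 (fmor F2 b d i g) \<mu>
               - cmp D (fob F1 a) (fob F1 c) (fob F2 d) 0 i \<xi> (fmor F1 a c i f))),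
     cmp = (\<lambda>(a, b, \<mu>) (c, d, \<xi>) (c', d', \<xi>') j i (f', g', h') (f, g, h).
              (cmp A1 a c c' j i f' f, cmp A2 b d d' j i g' g,
               cmp D (fob F1 a) (fob F1 c) (fob F2 d') (j - 1) i h' (fmor F1 a c i f)
               + sg j (cmp D (fob F1 a) (fob F2 d) (fob F2 d') j (i - 1) (fmor F2 d d' j g') h))),
     idt = (\<lambda>(a, b, \<mu>). (idt A1 a, idt A2 b, 0))\<rparr>"

definition cone_fun ::
  "('o, 'm, ('q, 'r::ab_group_add) tw, 'r mat) dgfun \<Rightarrow> ('p, 'n, ('q, 'r) tw, 'r mat) dgfun \<Rightarrow>
   ('o \<times> 'p \<times> 'r mat, 'm \<times> 'n \<times> 'r mat, ('q, 'r) tw, 'r mat) dgfun" where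
  "cone_fun F1 F2 = \<lparr>
     fob = (\<lambda>(a, b, \<mu>). Cone (fob F1 a) (fob F2 b) \<mu>),
     fmor = (\<lambda>(a, b, \<mu>) (c, d, \<xi>) i (f, g, h).
       block (tlen (fob F1 a)) (tlen (fob F1 c))
         (sg i (fmor F1 a c i f)) (fmor F2 b d i g) (sg i h))\<rparr>"

definition hfib ::
  "('q, 'r::ab_group_add, 'k) dgcat \<Rightarrow> ('o, 'm, 'k) dgcat \<Rightarrow> ('p, 'n, 'k) dgcat \<Rightarrow>
   ('o, 'm, 'q, 'r) dgfun \<Rightarrow> ('p, 'n, 'q, 'r) dgfun \<Rightarrow>
   ('o \<times> 'p \<times> 'r, 'm \<times> 'n \<times> 'r, 'k) dgcat" where
  "hfib D A1 A2 F1 F2 = (glue D A1 A2 F1 F2) \<lparr>obj :=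
     {(a, b, \<mu>) \<in> obj (glue D A1 A2 F1 F2).
        iso_in (H0 D) (fob F1 a) (fob F2 b)
          (cclass (hom D (fob F1 a) (fob F2 b)) (dif D (fob F1 a) (fob F2 b)) 0 \<mu>)}\<rparr>"

definition proj1 :: "('o \<times> 'p \<times> 'r, 'm \<times> 'n \<times> 's, 'o, 'm) dgfun" where
  "proj1 = \<lparr>fob = (\<lambda>(a, b, \<mu>). a), fmor = (\<lambda>_ _ _ (f, g, h). f)\<rparr>"

definition proj2 :: "('o \<times> 'p \<times> 'r, 'm \<times> 'n \<times> 's, 'p, 'n) dgfun" where
  "proj2 = \<lparr>fob = (\<lambda>(a, b, \<mu>). b), fmor = (\<lambda>_ _ _ (f, g, h). g)\<rparr>"

section \<open>Iterated gluing\<close>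

text \<open>The \<open>k\<close>-fold constructions below nest triples to a depth depending on \<open>k\<close>. To keep them
  in one type, \<open>First\<close> and \<open>Next\<close> encode nested triples of objects, and nested triples of
  morphisms are encoded as sequences, the outermost pair \<open>(g, h)\<close> coming first. The maps
  \<open>first_mor\<close> and \<open>next_mor\<close> are injective and linear, so that \<open>relabel\<close> only renames the
  objects and morphisms of a dg category.\<close>

datatype ('o, 'r) itob = First 'o | Next "('o, 'r) itob" 'o 'r
type_synonym ('m, 'r) itmor = "nat \<Rightarrow> 'm \<times> 'r"

definition next_ob :: "('o, 'r) itob \<times> 'o \<times> 'r \<Rightarrow> ('o, 'r) itob" where
  "next_ob = (\<lambda>(x, a, \<mu>). Next x a \<mu>)"

definition first_mor :: "'m::zero \<Rightarrow> ('m, 'r::zero) itmor" where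
  "first_mor f = case_nat (f, 0) (\<lambda>_. (0, 0))"

definition next_mor :: "('m, 'r) itmor \<times> 'm \<times> 'r \<Rightarrow> ('m, 'r) itmor" where
  "next_mor = (\<lambda>(u, g, h). case_nat (g, h) u)"

definition relabel ::
  "('o \<Rightarrow> 'p) \<Rightarrow> ('m \<Rightarrow> 'n) \<Rightarrow> ('k \<Rightarrow> 'n \<Rightarrow> 'n) \<Rightarrow> ('o, 'm, 'k) dgcat \<Rightarrow> ('p, 'n, 'k) dgcat" where
  "relabel eo em s A = \<lparr>
     obj = eo ` obj A,
     hom = (\<lambda>x y i. em ` hom A (inv eo x) (inv eo y) i),
     scl = s,
     dif = (\<lambda>x y i f. em (dif A (inv eo x) (inv eo y) i (inv em f))),
     cmp = (\<lambda>x y z j i g f. em (cmp A (inv eo x) (inv eo y) (inv eo z) j i (inv em g) (inv em f))),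
     idt = (\<lambda>x. em (idt A (inv eo x)))\<rparr>"

definition relabel_fun ::
  "('o \<Rightarrow> 'p) \<Rightarrow> ('m \<Rightarrow> 'n) \<Rightarrow> ('o, 'm, 'q, 'r) dgfun \<Rightarrow> ('p, 'n, 'q, 'r) dgfun" where
  "relabel_fun eo em F = \<lparr>fob = (\<lambda>x. fob F (inv eo x)),
     fmor = (\<lambda>x y i f. fmor F (inv eo x) (inv eo y) i (inv em f))\<rparr>"

text \<open>In \<open>first_cat D A\<close> the base \<open>D\<close> only serves to scale the components that are always zero.\<close>

definition first_cat ::
  "('q, 'r::ab_group_add, 'k) dgcat \<Rightarrow> ('o, 'm::ab_group_add, 'k) dgcat \<Rightarrow>
   (('o, 'r) itob, ('m, 'r) itmor, 'k) dgcat" where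
  "first_cat D A =
     relabel First first_mor (\<lambda>x u n. (scl A x (fst (u n)), scl D x (snd (u n)))) A"

definition next_cat ::
  "(('o, 'r) itob \<times> 'o \<times> 'r, ('m, 'r) itmor \<times> 'm \<times> 'r, 'k) dgcat \<Rightarrow>
   (('o, 'r) itob, ('m, 'r) itmor, 'k) dgcat" where
  "next_cat A = relabel next_ob next_mor (\<lambda>x u. next_mor (scl A x (inv next_mor u))) A"

abbreviation first_fun ::
  "('o, 'm::zero, 'p, 'n) dgfun \<Rightarrow> (('o, 'r) itob, ('m, 'r::zero) itmor, 'p, 'n) dgfun" where
  "first_fun \<equiv> relabel_fun First first_mor"

abbreviation next_fun ::
  "(('o, 'r) itob \<times> 'o \<times> 'r, ('m, 'r) itmor \<times> 'm \<times> 'r, 'p, 'n) dgfun \<Rightarrow>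
   (('o, 'r) itob, ('m, 'r) itmor, 'p, 'n) dgfun" where
  "next_fun \<equiv> relabel_fun next_ob next_mor"

text \<open>\<open>gl C A F n\<close> is the iterated gluing of the \<open>n + 1\<close> pairs with indices \<open>1, \<dots>, n + 1\<close> together
  with its functor to \<open>Tw C\<close>; a single pair is \<open>A 1\<close> itself with \<open>F 1\<close>, so that \<open>n = 1\<close> is
  the gluing of \<open>A 1\<close> and \<open>A 2\<close>.\<close>

primrec gl ::
  "('p, 'n::ab_group_add, 'k) dgcat \<Rightarrow> (nat \<Rightarrow> ('o, 'm::ab_group_add, 'k) dgcat) \<Rightarrow>
   (nat \<Rightarrow> ('o, 'm, 'p, 'n) dgfun) \<Rightarrow> nat \<Rightarrow>
   (('o, 'n mat) itob, ('m, 'n mat) itmor, 'k) dgcat \<times>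
   (('o, 'n mat) itob, ('m, 'n mat) itmor, ('p, 'n) tw, 'n mat) dgfun" where
  "gl C A F 0 = (first_cat (Tw C) (A 1), first_fun (tw_incl \<circ>\<circ> F 1))"
| "gl C A F (Suc n) =
     (let G = fst (gl C A F n); c = snd (gl C A F n); F' = tw_incl \<circ>\<circ> F (n + 2) in
      (next_cat (glue (Tw C) G (A (n + 2)) c F'), next_fun (cone_fun c F')))"

definition iterated_gluing ::
  "('p, 'n::ab_group_add, 'k) dgcat \<Rightarrow> (nat \<Rightarrow> ('o, 'm::ab_group_add, 'k) dgcat) \<Rightarrow>
   (nat \<Rightarrow> ('o, 'm, 'p, 'n) dgfun) \<Rightarrow> nat \<Rightarrow>
   (('o, 'n mat) itob, ('m, 'n mat) itmor, 'k) dgcat" where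
  "iterated_gluing C A F k = fst (gl C A F (k - 1))"

definition iterated_cone ::
  "('p, 'n::ab_group_add, 'k) dgcat \<Rightarrow> (nat \<Rightarrow> ('o, 'm::ab_group_add, 'k) dgcat) \<Rightarrow>
   (nat \<Rightarrow> ('o, 'm, 'p, 'n) dgfun) \<Rightarrow> nat \<Rightarrow>
   (('o, 'n mat) itob, ('m, 'n mat) itmor, ('p, 'n) tw, 'n mat) dgfun" where
  "iterated_cone C A F k = snd (gl C A F (k - 1))"

section \<open>The categories \<open>A\<^sub>k(C)\<close>\<close>

type_synonym ('p, 'n) a2ob = "('p, 'n) tw \<times> ('p, 'n) tw \<times> 'n mat"
type_synonym 'n a2mor = "'n mat \<times> 'n mat \<times> 'n mat"
type_synonym ('p, 'n) akob = "(('p, 'n) a2ob, 'n mat) itob"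
type_synonym 'n akmor = "('n a2mor, 'n mat) itmor"

definition A2 ::
  "('p, 'n::ab_group_add, 'k) dgcat \<Rightarrow> (('p, 'n) a2ob, 'n a2mor, 'k) dgcat" where
  "A2 C = glue (Tw C) (Tw C) (Tw C) id_fun id_fun"

definition A2_f3 :: "(('p, 'n::ab_group_add) a2ob, 'n a2mor, ('p, 'n) tw, 'n mat) dgfun" where
  "A2_f3 = cone_fun id_fun id_fun"

text \<open>\<open>ak C n\<close> is the category \<open>A\<^sub>n\<^sub>+\<^sub>2(C)\<close> together with its functors \<open>f i\<close> for
  \<open>1 \<le> i \<le> n + 3\<close>.\<close>

primrec ak ::
  "('p, 'n::ab_group_add, 'k) dgcat \<Rightarrow> nat \<Rightarrow>
   (('p, 'n) akob, 'n akmor, 'k) dgcat \<times>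
   (nat \<Rightarrow> (('p, 'n) akob, 'n akmor, ('p, 'n) tw, 'n mat) dgfun)" where
  "ak C 0 = (first_cat (Tw C) (A2 C),
     (\<lambda>i. first_fun (if i = 1 then proj1 else if i = 2 then proj2 else A2_f3)))"
| "ak C (Suc n) =
     (let B = fst (ak C n); f = snd (ak C n) in
      (next_cat (hfib (Tw C) B (A2 C) (f (n + 3)) proj1),
       (\<lambda>i. next_fun (if i \<le> n + 2 then f i \<circ>\<circ> proj1
                      else if i = n + 3 then proj2 \<circ>\<circ> proj2
                      else A2_f3 \<circ>\<circ> proj2))))"

definition Ak ::
  "('p, 'n::ab_group_add, 'k) dgcat \<Rightarrow> nat \<Rightarrow> (('p, 'n) akob, 'n akmor, 'k) dgcat" where
  "Ak C k = fst (ak C (k - 2))"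

definition Ak_f ::
  "('p, 'n::ab_group_add, 'k) dgcat \<Rightarrow> nat \<Rightarrow> nat \<Rightarrow>
   (('p, 'n) akob, 'n akmor, ('p, 'n) tw, 'n mat) dgfun" where
  "Ak_f C k i = snd (ak C (k - 2)) i"

section \<open>Global sections\<close>

text \<open>The components of morphisms outside of the index set are always zero; they are scaled as
  one of the factors.\<close>

definition prod_cat ::
  "nat set \<Rightarrow> (nat \<Rightarrow> ('o, 'm::ab_group_add, 'k) dgcat) \<Rightarrow> (nat \<Rightarrow> 'o, nat \<Rightarrow> 'm, 'k) dgcat" where
  "prod_cat I A = \<lparr>
     obj = Pi\<^sub>E I (\<lambda>i. obj (A i)),
     hom = (\<lambda>x y n. {f. (\<forall>i\<in>I. f i \<in> hom (A i) (x i) (y i) n) \<and> (\<forall>i. i \<notin> I \<longrightarrow> f i = 0)}),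
     scl = (\<lambda>c f i. scl (A (if i \<in> I then i else (SOME j. j \<in> I))) c (f i)),
     dif = (\<lambda>x y n f i. if i \<in> I then dif (A i) (x i) (y i) n (f i) else 0),
     cmp = (\<lambda>x y z n l g f i. if i \<in> I then cmp (A i) (x i) (y i) (z i) n l (g i) (f i) else 0),
     idt = (\<lambda>x i. if i \<in> I then idt (A i) (x i) else 0)\<rparr>"

definition prod_fun ::
  "nat set \<Rightarrow> (nat \<Rightarrow> ('o, 'm, 'p, 'n::zero) dgfun) \<Rightarrow>
   (nat \<Rightarrow> 'o, nat \<Rightarrow> 'm, nat \<Rightarrow> 'p, nat \<Rightarrow> 'n) dgfun" where
  "prod_fun I F = \<lparr>fob = (\<lambda>x. \<lambda>i\<in>I. fob (F i) (x i)),
     fmor = (\<lambda>x y n f i. if i \<in> I then fmor (F i) (x i) (y i) n (f i) else 0)\<rparr>"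

definition tuple_fun ::
  "nat set \<Rightarrow> (nat \<Rightarrow> ('o, 'm, 'p, 'n::zero) dgfun) \<Rightarrow> ('o, 'm, nat \<Rightarrow> 'p, nat \<Rightarrow> 'n) dgfun" where
  "tuple_fun I F = \<lparr>fob = (\<lambda>x. \<lambda>i\<in>I. fob (F i) x),
     fmor = (\<lambda>x y n f i. if i \<in> I then fmor (F i) x y n f else 0)\<rparr>"

definition global_sections ::
  "('p, 'n::ab_group_add, 'k) dgcat \<Rightarrow> (nat \<Rightarrow> ('o, 'm::ab_group_add, 'k) dgcat) \<Rightarrow>
   (nat \<Rightarrow> ('o, 'm, 'p, 'n) dgfun) \<Rightarrow> nat \<Rightarrow>
   ((nat \<Rightarrow> 'o) \<times> ('p, 'n) akob \<times> (nat \<Rightarrow> 'n mat),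
    (nat \<Rightarrow> 'm) \<times> 'n akmor \<times> (nat \<Rightarrow> 'n mat), 'k) dgcat" where
  "global_sections C A F k =
     hfib (prod_cat {1..k} (\<lambda>_. Tw C)) (prod_cat {1..k} A) (Ak C k)
       (prod_fun {1..k} (\<lambda>i. tw_incl \<circ>\<circ> F i)) (tuple_fun {1..k} (Ak_f C k))"

definition s_infinity ::
  "('p, 'n::ab_group_add, 'k) dgcat \<Rightarrow> nat \<Rightarrow>
   ((nat \<Rightarrow> 'o) \<times> ('p, 'n) akob \<times> (nat \<Rightarrow> 'n mat),
    (nat \<Rightarrow> 'm) \<times> 'n akmor \<times> (nat \<Rightarrow> 'n mat), ('p, 'n) tw, 'n mat) dgfun" where
  "s_infinity C k = Ak_f C k (k + 1) \<circ>\<circ> proj2"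

section \<open>dg modules, dg bimodules and quasifunctors\<close>

text \<open>A bimodule \<open>X\<close> of complexes \<open>X(a, b)\<close>, contravariant in \<open>a\<close> and covariant in \<open>b\<close>; a
  quasifunctor \<open>B \<rightarrow> A\<close> is such a bimodule whose modules \<open>X(-, b)\<close> are quasi-isomorphic to
  representable ones. \<open>bract X a' a b j i x f\<close> is \<open>x f\<close> for \<open>x \<in> X(a, b)\<close> of degree \<open>j\<close> and
  \<open>f : a' \<rightarrow> a\<close> of degree \<open>i\<close>; \<open>blact X a b b' j i g x\<close> is \<open>g x\<close> for \<open>g : b \<rightarrow> b'\<close> of degree
  \<open>j\<close> and \<open>x \<in> X(a, b)\<close> of degree \<open>i\<close>.\<close>

record ('o, 'm, 'p, 'n, 'x, 'k) bimod =
  bsp :: "'o \<Rightarrow> 'p \<Rightarrow> int \<Rightarrow> 'x set"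
  bscl :: "'k \<Rightarrow> 'x \<Rightarrow> 'x"
  bdif :: "'o \<Rightarrow> 'p \<Rightarrow> int \<Rightarrow> 'x \<Rightarrow> 'x"
  bract :: "'o \<Rightarrow> 'o \<Rightarrow> 'p \<Rightarrow> int \<Rightarrow> int \<Rightarrow> 'x \<Rightarrow> 'm \<Rightarrow> 'x"
  blact :: "'o \<Rightarrow> 'p \<Rightarrow> 'p \<Rightarrow> int \<Rightarrow> int \<Rightarrow> 'n \<Rightarrow> 'x \<Rightarrow> 'x"

record ('o, 'm, 'x, 'k) lmod =
  lsp :: "'o \<Rightarrow> int \<Rightarrow> 'x set"
  lscl :: "'k \<Rightarrow> 'x \<Rightarrow> 'x"
  ldif :: "'o \<Rightarrow> int \<Rightarrow> 'x \<Rightarrow> 'x"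
  lact :: "'o \<Rightarrow> 'o \<Rightarrow> int \<Rightarrow> int \<Rightarrow> 'm \<Rightarrow> 'x \<Rightarrow> 'x"

text \<open>The left (covariant) module \<open>X(a, -)\<close>.\<close>

definition row :: "('o, 'm, 'p, 'n, 'x, 'k) bimod \<Rightarrow> 'o \<Rightarrow> ('p, 'n, 'x, 'k) lmod" where
  "row X a = \<lparr>lsp = bsp X a, lscl = bscl X, ldif = bdif X a, lact = blact X a\<rparr>"

definition diag :: "('o, 'm, 'k) dgcat \<Rightarrow> ('o, 'm, 'o, 'm, 'm, 'k) bimod" where
  "diag A = \<lparr>bsp = hom A, bscl = scl A, bdif = dif A, bract = cmp A, blact = cmp A\<rparr>"

text \<open>\<open>restr G H X\<close> is the bimodule \<open>X(G a, H b)\<close>.\<close>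

definition restr ::
  "('o, 'm, 'o', 'm') dgfun \<Rightarrow> ('p, 'n, 'p', 'n') dgfun \<Rightarrow> ('o', 'm', 'p', 'n', 'x, 'k) bimod \<Rightarrow>
   ('o, 'm, 'p, 'n, 'x, 'k) bimod" where
  "restr G H X = \<lparr>
     bsp = (\<lambda>a b. bsp X (fob G a) (fob H b)),
     bscl = bscl X,
     bdif = (\<lambda>a b. bdif X (fob G a) (fob H b)),
     bract = (\<lambda>a' a b j i x f.
       bract X (fob G a') (fob G a) (fob H b) j i x (fmor G a' a i f)),
     blact = (\<lambda>a b b' j i g x.
       blact X (fob G a) (fob H b) (fob H b') j i (fmor H b b' j g) x)\<rparr>"

text \<open>The cone of a morphism of bimodules, \<open>Cone(X \<rightarrow> Y) = X[1] \<oplus> Y\<close>; the left action on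
  \<open>X[1]\<close> carries the sign of the shift.\<close>

definition bcone ::
  "('o, 'm, 'p, 'n, 'x::ab_group_add, 'k) bimod \<Rightarrow> ('o, 'm, 'p, 'n, 'y::ab_group_add, 'k) bimod \<Rightarrow>
   ('o \<Rightarrow> 'p \<Rightarrow> int \<Rightarrow> 'x \<Rightarrow> 'y) \<Rightarrow> ('o, 'm, 'p, 'n, 'x \<times> 'y, 'k) bimod" where
  "bcone X Y \<phi> = \<lparr>
     bsp = (\<lambda>a b i. bsp X a b (i + 1) \<times> bsp Y a b i),
     bscl = (\<lambda>c (x, y). (bscl X c x, bscl Y c y)),
     bdif = (\<lambda>a b i (x, y). (- bdif X a b (i + 1) x, \<phi> a b (i + 1) x + bdif Y a b i y)),
     bract = (\<lambda>a' a b j i (x, y) f. (bract X a' a b (j + 1) i x f, bract Y a' a b j i y f)),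
     blact = (\<lambda>a b b' j i g (x, y).
       (sg j (blact X a b b' j (i + 1) g x), blact Y a b b' j i g y))\<rparr>"

text \<open>By the Yoneda lemma a quasi-isomorphism from a representable module to \<open>X(-, b)\<close> is given
  by a cocycle \<open>\<xi>\<close> of degree 0.\<close>

definition quasifunctor ::
  "('p, 'n, 'k) dgcat \<Rightarrow> ('o, 'm::ab_group_add, 'k) dgcat \<Rightarrow>
   ('o, 'm, 'p, 'n, 'x::ab_group_add, 'k) bimod \<Rightarrow> bool" where
  "quasifunctor B A X \<longleftrightarrow>
     (\<forall>b\<in>obj B. \<exists>r\<in>obj A. \<exists>\<xi>\<in>cocycles (bsp X r b) (bdif X r b) 0. \<forall>a\<in>obj A.
        quasi_iso (hom A a r) (dif A a r) (bsp X a b) (bdif X a b)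
          (\<lambda>i f. bract X a r b 0 i \<xi> f))"

definition quasi_corepresentable ::
  "('p, 'n, 'k) dgcat \<Rightarrow> ('o, 'm::ab_group_add, 'k) dgcat \<Rightarrow>
   ('p, 'n, 'o, 'm, 'x::ab_group_add, 'k) bimod \<Rightarrow> bool" where
  "quasi_corepresentable B A X \<longleftrightarrow>
     (\<forall>b\<in>obj B. \<exists>l\<in>obj A. \<exists>\<xi>\<in>cocycles (bsp X b l) (bdif X b l) 0. \<forall>a\<in>obj A.
        quasi_iso (hom A l a) (dif A l a) (bsp X b a) (bdif X b a)
          (\<lambda>i f. blact X b l a i 0 f \<xi>))"

section \<open>Bar construction\<close>

text \<open>A chain of morphisms
    \<open>t \<leftarrow>\<^bsub>f\<^sub>1\<^esub> a\<^sub>1 \<leftarrow>\<^bsub>f\<^sub>2\<^esub> a\<^sub>2 \<dots> \<leftarrow>\<^bsub>f\<^sub>n\<^esub> a\<^sub>n\<close>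
  is the list of the \<open>(f\<^sub>s, deg f\<^sub>s, a\<^sub>s)\<close>. A word of the bar complex of a left module \<open>M\<close> is such a
  chain with an element of \<open>M(a\<^sub>n)\<close> paired with its degree; each \<open>f\<^sub>s\<close> counts with degree
  \<open>deg f\<^sub>s - 1\<close>. Differentials are returned as lists of words with signs \<open>(-1)\<^sup>p\<close>. With the
  suspension \<open>s\<close> of degree \<open>-1\<close>, they are \<open>s f \<mapsto> - s (d f)\<close>, \<open>s f \<otimes> s g \<mapsto> (-1)\<^bsup>deg f - 1\<^esup> s (f g)\<close>,
  \<open>s f \<otimes> x \<mapsto> - f x\<close>, \<open>y \<otimes> s f \<mapsto> (-1)\<^bsup>deg y\<^esup> y f\<close>, extended by the Koszul rule.\<close>

type_synonym ('o, 'm) chain = "('m \<times> int \<times> 'o) list"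

definition csrc :: "'o \<Rightarrow> ('o, 'm) chain \<Rightarrow> 'o" where
  "csrc t fs = (if fs = [] then t else snd (snd (last fs)))"

definition cdeg :: "('o, 'm) chain \<Rightarrow> int" where
  "cdeg fs = (\<Sum>(f, i, a)\<leftarrow>fs. i - 1)"

primrec is_chain :: "('o, 'm, 'k) dgcat \<Rightarrow> 'o \<Rightarrow> ('o, 'm) chain \<Rightarrow> bool" where
  "is_chain A t [] \<longleftrightarrow> t \<in> obj A"
| "is_chain A t (u # fs) \<longleftrightarrow> t \<in> obj A \<and>
     (case u of (f, i, a) \<Rightarrow> f \<in> hom A a t i \<and> is_chain A a fs)"

primrec chain_dif ::
  "('o, 'm, 'k) dgcat \<Rightarrow> 'o \<Rightarrow> int \<Rightarrow> ('o, 'm) chain \<Rightarrow> (int \<times> ('o, 'm) chain) list" where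
  "chain_dif A t e [] = []"
| "chain_dif A t e (u # fs) =
     (case u of (f, i, a) \<Rightarrow>
        [(e + 1, (dif A a t i f, i + 1, a) # fs)] @
        (case fs of [] \<Rightarrow> []
         | (g, j, b) # gs \<Rightarrow> [(e + (i - 1), (cmp A b a t i j f g, i + j, b) # gs)]) @
        map (\<lambda>(p, gs). (p, u # gs)) (chain_dif A a (e + (i - 1)) fs))"

definition lbar_dif ::
  "('o, 'm, 'k) dgcat \<Rightarrow> ('o, 'm, 'x, 'k) lmod \<Rightarrow> 'o \<Rightarrow> ('o, 'm) chain \<times> 'x \<times> int \<Rightarrow>
   (int \<times> ('o, 'm) chain \<times> 'x \<times> int) list" where
  "lbar_dif A M t = (\<lambda>(fs, x, j).
     map (\<lambda>(p, gs). (p, gs, x, j)) (chain_dif A t 0 fs) @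
     [(cdeg fs, fs, ldif M (csrc t fs) j x, j + 1)] @
     (if fs = [] then []
      else case last fs of (f, i, a) \<Rightarrow>
        [(cdeg (butlast fs) + 1, butlast fs,
          lact M a (csrc t (butlast fs)) i j f x, i + j)]))"

definition lbar_word ::
  "('o, 'm, 'k) dgcat \<Rightarrow> ('o, 'm, 'x, 'k) lmod \<Rightarrow> 'o \<Rightarrow> ('o, 'm) chain \<times> 'x \<times> int \<Rightarrow> bool" where
  "lbar_word A M t = (\<lambda>(fs, x, j). is_chain A t fs \<and> x \<in> lsp M (csrc t fs) j)"

text \<open>Linearity in every slot of the words ending at \<open>t\<close>.\<close>

definition multilinear ::
  "('o, 'm::ab_group_add, 'k) dgcat \<Rightarrow> ('o, 'm, 'x::ab_group_add, 'k) lmod \<Rightarrow> 'o \<Rightarrow>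
   ('k \<Rightarrow> 'v::ab_group_add \<Rightarrow> 'v) \<Rightarrow> (('o, 'm) chain \<times> 'x \<times> int \<Rightarrow> 'v) \<Rightarrow> bool" where
  "multilinear A M t s \<psi> \<longleftrightarrow>
     (\<forall>fs j. is_chain A t fs \<longrightarrow>
        linear_on (lsp M (csrc t fs) j) (lscl M) s (\<lambda>x. \<psi> (fs, x, j))) \<and>
     (\<forall>us i a vs x j. is_chain A t us \<longrightarrow> is_chain A a vs \<longrightarrow> x \<in> lsp M (csrc a vs) j \<longrightarrow>
        linear_on (hom A a (csrc t us) i) (scl A) s (\<lambda>f. \<psi> (us @ (f, i, a) # vs, x, j)))"

section \<open>Composition of quasifunctors as derived tensor product\<close>

text \<open>For \<open>X(a, b)\<close> and \<open>Y(c, a)\<close> the bimodule \<open>X(-, b) \<otimes>\<^sub>A Y(c, -)\<close>, derived, is computed by the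
  two-sided bar complex, spanned by the words \<open>y \<otimes> s f\<^sub>1 \<otimes> \<dots> \<otimes> s f\<^sub>n \<otimes> x\<close> with
  \<open>y \<in> X(a\<^sub>0, b)\<close> and \<open>x \<in> Y(c, a\<^sub>n)\<close>. A tensor product over a field embeds into the dual space
  of the space of multilinear forms: the word \<open>w\<close> is the evaluation \<open>tword w\<close> of forms at \<open>w\<close>,
  and linear maps of words act by transposition.\<close>

type_synonym ('o, 'm, 'x, 'y) bword = "('x \<times> int \<times> 'o) \<times> ('o, 'm) chain \<times> 'y \<times> int"
type_synonym ('o, 'm, 'x, 'y, 'k) tensor = "(('o, 'm, 'x, 'y) bword \<Rightarrow> 'k) \<Rightarrow> 'k"

definition is_bword ::
  "('o, 'm, 'k) dgcat \<Rightarrow> ('o, 'm, 'p, 'n, 'x, 'k) bimod \<Rightarrow> ('q, 'r, 'o, 'm, 'y, 'k) bimod \<Rightarrow>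
   'q \<Rightarrow> 'p \<Rightarrow> ('o, 'm, 'x, 'y) bword \<Rightarrow> bool" where
  "is_bword A X Y c b = (\<lambda>((y, j, t), w). y \<in> bsp X t b j \<and> lbar_word A (row Y c) t w)"

definition bdeg :: "('o, 'm, 'x, 'y) bword \<Rightarrow> int" where
  "bdeg = (\<lambda>((y, j, t), fs, x, i). j + cdeg fs + i)"

definition bword_dif ::
  "('o, 'm, 'k) dgcat \<Rightarrow> ('o, 'm, 'p, 'n, 'x, 'k) bimod \<Rightarrow> ('q, 'r, 'o, 'm, 'y, 'k) bimod \<Rightarrow>
   'q \<Rightarrow> 'p \<Rightarrow> ('o, 'm, 'x, 'y) bword \<Rightarrow> (int \<times> ('o, 'm, 'x, 'y) bword) list" where
  "bword_dif A X Y c b = (\<lambda>((y, j, t), fs, z).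
     [(0, (bdif X t b j y, j + 1, t), fs, z)] @
     map (\<lambda>(p, w). (j + p, (y, j, t), w)) (lbar_dif A (row Y c) t (fs, z)) @
     (case fs of [] \<Rightarrow> []
      | (f, i, a) # gs \<Rightarrow> [(j, (bract X a t b j i y f, j + i, a), gs, z)]))"

definition bform ::
  "('o, 'm::ab_group_add, 'k::field) dgcat \<Rightarrow> ('o, 'm, 'p, 'n, 'x::ab_group_add, 'k) bimod \<Rightarrow>
   ('q, 'r, 'o, 'm, 'y::ab_group_add, 'k) bimod \<Rightarrow> 'q \<Rightarrow> 'p \<Rightarrow>
   (('o, 'm, 'x, 'y) bword \<Rightarrow> 'k) \<Rightarrow> bool" where
  "bform A X Y c b \<phi> \<longleftrightarrow>
     (\<forall>t j y. y \<in> bsp X t b j \<longrightarrow> multilinear A (row Y c) t (*) (\<lambda>w. \<phi> ((y, j, t), w))) \<and>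
     (\<forall>t j w. lbar_word A (row Y c) t w \<longrightarrow>
        linear_on (bsp X t b j) (bscl X) (*) (\<lambda>y. \<phi> ((y, j, t), w)))"

text \<open>\<open>tmap Q P L\<close> is the linear map of tensors induced by a map \<open>L\<close> of words to signed sums of
  words: it is the transpose of \<open>\<phi> \<mapsto> (w \<mapsto> \<phi> (L w))\<close> on the forms \<open>Q\<close>.\<close>

definition tword :: "(('w \<Rightarrow> 'k) \<Rightarrow> bool) \<Rightarrow> 'w \<Rightarrow> ('w \<Rightarrow> 'k) \<Rightarrow> 'k::field" where
  "tword Q w = (\<lambda>\<phi>. if Q \<phi> then \<phi> w else 0)"

definition tmap ::
  "(('w \<Rightarrow> 'k) \<Rightarrow> bool) \<Rightarrow> ('w \<Rightarrow> (int \<times> 'w) list) \<Rightarrow> (('w \<Rightarrow> 'k) \<Rightarrow> 'k) \<Rightarrow> ('w \<Rightarrow> 'k) \<Rightarrow> 'k::field" where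
  "tmap Q L \<Phi> = (\<lambda>\<phi>. if Q \<phi> then \<Phi> (\<lambda>w. \<Sum>(p, w')\<leftarrow>L w. sg p (\<phi> w')) else 0)"

definition bcomp ::
  "('o, 'm::ab_group_add, 'k::field) dgcat \<Rightarrow> ('q, 'r, 'o, 'm, 'y::ab_group_add, 'k) bimod \<Rightarrow>
   ('o, 'm, 'p, 'n, 'x::ab_group_add, 'k) bimod \<Rightarrow>
   ('q, 'r, 'p, 'n, ('o, 'm, 'x, 'y, 'k) tensor, 'k) bimod" where
  "bcomp A Y X = \<lparr>
     bsp = (\<lambda>c b d. module.span (\<lambda>s \<Phi> \<phi>. s * \<Phi> \<phi>)
       (tword (bform A X Y c b) ` {w. is_bword A X Y c b w \<and> bdeg w = d})),
     bscl = (\<lambda>s \<Phi> \<phi>. s * \<Phi> \<phi>),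
     bdif = (\<lambda>c b d. tmap (bform A X Y c b) (bword_dif A X Y c b)),
     bract = (\<lambda>c' c b j l \<Phi> h. tmap (bform A X Y c' b)
       (\<lambda>((y, e, t), fs, x, i).
          [(0, (y, e, t), fs, bract Y c' c (csrc t fs) i l x h, i + l)]) \<Phi>),
     blact = (\<lambda>c b b' l j g \<Phi>. tmap (bform A X Y c b')
       (\<lambda>((y, e, t), w). [(0, (blact X t b b' l e g y, l + e, t), w)]) \<Phi>)\<rparr>"

section \<open>Derived Hom of left modules\<close>

text \<open>Elements of degree \<open>i\<close> are the multilinear maps of degree \<open>i\<close> from bar words of \<open>M\<close> to \<open>N\<close>,
  extended by zero to all other arguments.\<close>

type_synonym ('o, 'm, 'x, 'v) cochain = "'o \<Rightarrow> ('o, 'm) chain \<times> 'x \<times> int \<Rightarrow> 'v"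

definition rhom_sp ::
  "('o, 'm::ab_group_add, 'k) dgcat \<Rightarrow> ('o, 'm, 'x::ab_group_add, 'k) lmod \<Rightarrow>
   ('o, 'm, 'v::ab_group_add, 'k) lmod \<Rightarrow> int \<Rightarrow> ('o, 'm, 'x, 'v) cochain set" where
  "rhom_sp A M N i = {\<psi>.
     (\<forall>t. multilinear A M t (lscl N) (\<psi> t)) \<and>
     (\<forall>t fs x j. if lbar_word A M t (fs, x, j) then \<psi> t (fs, x, j) \<in> lsp N t (i + cdeg fs + j)
        else \<psi> t (fs, x, j) = 0)}"

definition rhom_dif ::
  "('o, 'm::ab_group_add, 'k) dgcat \<Rightarrow> ('o, 'm, 'x::ab_group_add, 'k) lmod \<Rightarrow>
   ('o, 'm, 'v::ab_group_add, 'k) lmod \<Rightarrow> int \<Rightarrow>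
   ('o, 'm, 'x, 'v) cochain \<Rightarrow> ('o, 'm, 'x, 'v) cochain" where
  "rhom_dif A M N i \<psi> = (\<lambda>t (fs, x, j).
     if lbar_word A M t (fs, x, j)
     then ldif N t (i + cdeg fs + j) (\<psi> t (fs, x, j))
       - (case fs of [] \<Rightarrow> 0
          | (f, l, a) # gs \<Rightarrow>
              sg (i * (l - 1)) (lact N a t l (i + cdeg gs + j) f (\<psi> a (gs, x, j))))
       - sg i (\<Sum>(p, w)\<leftarrow>lbar_dif A M t (fs, x, j). sg p (\<psi> t w))
     else 0)"

section \<open>Spherical functors\<close>

text \<open>For a dg functor \<open>F : A \<rightarrow> B\<close>, the right adjoint is the bimodule \<open>R(a, b) = hom(F a, b)\<close>
  provided that it is a quasifunctor, and \<open>F\<close> itself is the bimodule \<open>hom(b, F a)\<close>.\<close>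

definition right_adj ::
  "('p, 'n, 'k) dgcat \<Rightarrow> ('o, 'm, 'p, 'n) dgfun \<Rightarrow> ('o, 'm, 'p, 'n, 'n, 'k) bimod" where
  "right_adj B F = restr F id_fun (diag B)"

definition fun_bimod ::
  "('p, 'n, 'k) dgcat \<Rightarrow> ('o, 'm, 'p, 'n) dgfun \<Rightarrow> ('p, 'n, 'o, 'm, 'n, 'k) bimod" where
  "fun_bimod B F = restr id_fun F (diag B)"

text \<open>The counit \<open>FR \<rightarrow> id\<close> sends \<open>y \<otimes> x\<close> to \<open>y x\<close> and all longer words to zero. The value at a
  tensor is the vector on which every linear functional takes the prescribed value.\<close>

definition counit ::
  "('p, 'n::ab_group_add, 'k::field) dgcat \<Rightarrow> ('o, 'm, 'p, 'n) dgfun \<Rightarrow> 'p \<Rightarrow> 'p \<Rightarrow> int \<Rightarrow>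
   ('o, 'm, 'n, 'n, 'k) tensor \<Rightarrow> 'n" where
  "counit B F b' b i \<Phi> = (THE v. \<forall>\<alpha>. Vector_Spaces.linear (scl B) (*) \<alpha> \<longrightarrow>
     \<alpha> v = \<Phi> (\<lambda>((y, j, t), fs, x, l).
       \<alpha> (if fs = [] then cmp B b' (fob F t) b j l y x else 0)))"

definition twist ::
  "('o, 'm::ab_group_add, 'k::field) dgcat \<Rightarrow> ('p, 'n::ab_group_add, 'k) dgcat \<Rightarrow>
   ('o, 'm, 'p, 'n) dgfun \<Rightarrow> ('p, 'n, 'p, 'n, ('o, 'm, 'n, 'n, 'k) tensor \<times> 'n, 'k) bimod" where
  "twist A B F = bcone (bcomp A (fun_bimod B F) (right_adj B F)) (diag B) (counit B F)"

text \<open>A quasifunctor \<open>T : B \<rightarrow> B\<close> induces \<open>\<Phi>\<close> on \<open>H\<^sup>0\<close> if \<open>H\<^sup>0(T(b', b))\<close> is isomorphic to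
  \<open>H\<^sup>0(hom(b', \<Phi> b))\<close> naturally in \<open>b'\<close> and \<open>b\<close>.\<close>

definition induces_autoequivalence ::
  "('p, 'n::ab_group_add, 'k) dgcat \<Rightarrow> ('p, 'n, 'p, 'n, 'x::ab_group_add, 'k) bimod \<Rightarrow> bool" where
  "induces_autoequivalence B T \<longleftrightarrow> quasifunctor B B T \<and>
     (\<exists>\<Phi>o \<Phi>m. equivalence_of_cats (H0 B) (H0 B) \<Phi>o \<Phi>m \<and>
       (\<exists>\<theta>.
         (\<forall>b'\<in>obj B. \<forall>b\<in>obj B. bij_betw (\<theta> b' b)
            (cohomology (bsp T b' b) (bdif T b' b) 0) (chom (H0 B) b' (\<Phi>o b))) \<and>
         (\<forall>c'\<in>obj B. \<forall>b'\<in>obj B. \<forall>b\<in>obj B. \<forall>c\<in>obj B.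
            \<forall>G\<in>chom (H0 B) b c. \<forall>X\<in>cohomology (bsp T b' b) (bdif T b' b) 0. \<forall>K\<in>chom (H0 B) c' b'.
              \<theta> c' c (\<Union>g\<in>G. \<Union>x\<in>X. \<Union>k\<in>K. cclass (bsp T c' c) (bdif T c' c) 0
                 (blact T c' b c 0 0 g (bract T c' b' b 0 0 x k))) =
              ccmp (H0 B) c' (\<Phi>o b) (\<Phi>o c) (\<Phi>m b c G)
                (ccmp (H0 B) c' b' (\<Phi>o b) (\<theta> b' b X) K))))"

text \<open>\<open>C[1] = Cone(id \<rightarrow> RF)\<close>, where \<open>RF(a, a') = hom(F a, F a')\<close> and the unit is \<open>F\<close>.\<close>

definition RF ::
  "('p, 'n, 'k) dgcat \<Rightarrow> ('o, 'm, 'p, 'n) dgfun \<Rightarrow> ('o, 'm, 'o, 'm, 'n, 'k) bimod" where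
  "RF B F = restr F F (diag B)"

definition cotwist1 ::
  "('o, 'm::ab_group_add, 'k) dgcat \<Rightarrow> ('p, 'n::ab_group_add, 'k) dgcat \<Rightarrow>
   ('o, 'm, 'p, 'n) dgfun \<Rightarrow> ('o, 'm, 'o, 'm, 'm \<times> 'n, 'k) bimod" where
  "cotwist1 A B F = bcone (diag A) (RF B F) (fmor F)"

text \<open>The left adjoint \<open>L\<close> is given by \<open>hom(L b, a) = hom(b, F a)\<close> provided that the left modules
  \<open>hom(b, F -)\<close> are quasi-corepresentable. Composition of a bimodule \<open>X\<close> on \<open>A\<close> with \<open>L\<close> is
  \<open>(X L)(a, b) = RHom(hom(b, F -), X(a, -))\<close>, which is quasi-isomorphic to \<open>X(a, l)\<close> if \<open>l\<close>
  corepresents \<open>hom(b, F -)\<close>; \<open>L\<close> itself is the case \<open>X = id\<close>. The map \<open>R \<rightarrow> RFL\<close> sends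
  \<open>x : F a \<rightarrow> b\<close> to the (strict) module homomorphism \<open>hom(b, F -) \<rightarrow> hom(F a, F -)\<close> given by
  precomposition with \<open>x\<close>, and \<open>RFL \<rightarrow> (C[1])L = CL[1]\<close> is postcomposition with
  \<open>RF \<rightarrow> C[1]\<close>.\<close>

definition unit_R ::
  "('o, 'm::ab_group_add, 'k) dgcat \<Rightarrow> ('p, 'n::ab_group_add, 'k) dgcat \<Rightarrow>
   ('o, 'm, 'p, 'n) dgfun \<Rightarrow> 'o \<Rightarrow> 'p \<Rightarrow> int \<Rightarrow> 'n \<Rightarrow> ('o, 'm, 'n, 'n) cochain" where
  "unit_R A B F a b i x = (\<lambda>t (fs, z, j).
     if lbar_word A (row (fun_bimod B F) b) t (fs, z, j) \<and> fs = []
     then sg (i * j) (cmp B (fob F a) b (fob F t) j i z x) else 0)"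

definition to_cotwist1 :: "('o, 'm, 'x, 'n) cochain \<Rightarrow> ('o, 'm, 'x, 'm::zero \<times> 'n) cochain" where
  "to_cotwist1 \<psi> = (\<lambda>t w. (0, \<psi> t w))"

definition spherical ::
  "('o, 'm::ab_group_add, 'k::field_char_0) dgcat \<Rightarrow> ('p, 'n::ab_group_add, 'k) dgcat \<Rightarrow>
   ('o, 'm, 'p, 'n) dgfun \<Rightarrow> bool" where
  "spherical A B F \<longleftrightarrow> dg_functor A B F \<and>
     quasifunctor B A (right_adj B F) \<and>
     quasi_corepresentable B A (fun_bimod B F) \<and>
     induces_autoequivalence B (twist A B F) \<and>
     (\<forall>a\<in>obj A. \<forall>b\<in>obj B.
        quasi_iso (bsp (right_adj B F) a b) (bdif (right_adj B F) a b)
          (rhom_sp A (row (fun_bimod B F) b) (row (cotwist1 A B F) a))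
          (rhom_dif A (row (fun_bimod B F) b) (row (cotwist1 A B F) a))
          (\<lambda>i x. to_cotwist1 (unit_R A B F a b i x)))"

end

theory Submission
  imports Defs
begin

text \<open>An object of the iterated gluing, that is, a sequence of morphisms \<open>\<mu>\<^sub>j\<close> from the cone of
  \<open>\<mu>\<^sub>j\<^sub>-\<^sub>1\<close> to \<open>F\<^sub>j a\<^sub>j\<close>, is sent to the global section whose consecutive pieces are the \<open>\<mu>\<^sub>j\<close> and
  in which every homotopy equivalence required by a homotopy fiber product is an identity; this is
  compatible with the cone functors on the nose. Because the gluing morphisms are identities, the
  homotopy components of a morphism between two such sections can be prescribed arbitrarily by a
  boundary, and a cocycle without homotopy components comes from the gluing: so the cokernel on
  complexes of morphisms is acyclic. For a general global section, transporting its structure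
  morphisms step by step along the given homotopy equivalences produces the \<open>\<mu>\<^sub>j\<close> together with a
  closed morphism of degree 0 all of whose components are homotopy equivalences, and such a morphism
  in a gluing is itself a homotopy equivalence.\<close>

text \<open>Write Q_n for \<open>gl_to_ak C A F n\<close>. An identity can serve as gluing morphism
  only over a square that commutes on the nose, so strict equalities have to be carried through the
  recursion: f_(n+3) Q_n = c, which opens the next fiber product, and f_j Q_n = F_j pr_j, which
  opens the outermost one over the product of the \<open>A j\<close>.

  On morphisms, Q_n remembers only the images under F_j of the components in \<open>A j\<close>, and
  F_j may kill some of them. Injectivity holds only for Q_n paired with all projections pr_j, so the
  criterion "injective with acyclic cokernel" is applied once, to the functor into the global
  sections, and not at each stage to Q_n.

  On objects, the lifted homotopy equivalence \<Phi> must satisfy f_j \<Phi> = \<nu>_j exactly and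
  not just up to homotopy, since only then is (id, \<Phi>, 0) closed in the outermost fiber product.
  Exact components can be had because all homotopies that arise are absorbed by the third entries of
  morphisms of \<open>A2 C\<close>, which no f_j with j \<le> n + 2 sees at stage n.\<close>

lemma sg_0 [simp]: "sg i 0 = 0" by (simp add: sg_def)
lemma sg_zero [simp]: "sg 0 x = x" by (simp add: sg_def)
lemma sg_add: "sg i (x + y) = sg i x + sg i y" by (simp add: sg_def)
lemma sg_uminus: "sg i (- x) = - sg i x" by (simp add: sg_def)

lemma module_scl_of_vector_space: "vector_space s \<Longrightarrow> module s"
  by (simp add: vector_space_def module_def)

lemma linear_onI:
  assumes "\<And>x y. x \<in> V \<Longrightarrow> y \<in> V \<Longrightarrow> f (x + y) = f x + f y"
    and "\<And>c x. x \<in> V \<Longrightarrow> f (s c x) = s' c (f x)"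
  shows "linear_on V s s' f"
  using assms by (simp add: linear_on_def)

lemma linear_on_add: "linear_on V s s' f \<Longrightarrow> x \<in> V \<Longrightarrow> y \<in> V \<Longrightarrow> f (x + y) = f x + f y"
  and linear_on_scale: "linear_on V s s' f \<Longrightarrow> x \<in> V \<Longrightarrow> f (s c x) = s' c (f x)"
  by (auto simp: linear_on_def)

lemma linear_on_0:
  assumes "linear_on V s s' f" "0 \<in> V"
  shows "f 0 = 0"
  using linear_on_add[OF assms(1,2,2)] by simp

lemma linear_on_uminus:
  assumes "linear_on V s s' f" "0 \<in> V" "x \<in> V" "- x \<in> V"
  shows "f (- x) = - f x"
  using linear_on_add[OF assms(1,3,4)] linear_on_0[OF assms(1,2)] by (simp add: eq_neg_iff_add_eq_0 add.commute)

section \<open>Calculus in dg categories\<close>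

context dg_category
begin

lemmas module_scl = module_scl_of_vector_space[OF scl_vector_space]

lemma hom_0 [simp]: "a \<in> obj A \<Longrightarrow> b \<in> obj A \<Longrightarrow> 0 \<in> hom A a b i"
  using module.subspace_0[OF module_scl hom_subspace] .

lemma hom_add [simp]: "a \<in> obj A \<Longrightarrow> b \<in> obj A \<Longrightarrow> x \<in> hom A a b i \<Longrightarrow> y \<in> hom A a b i \<Longrightarrow> x + y \<in> hom A a b i"
  using module.subspace_add[OF module_scl hom_subspace] .

lemma hom_scl [simp]: "a \<in> obj A \<Longrightarrow> b \<in> obj A \<Longrightarrow> x \<in> hom A a b i \<Longrightarrow> scl A c x \<in> hom A a b i"
  using module.subspace_scale[OF module_scl hom_subspace] .

lemma hom_uminus [simp]: "a \<in> obj A \<Longrightarrow> b \<in> obj A \<Longrightarrow> x \<in> hom A a b i \<Longrightarrow> - x \<in> hom A a b i"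
  using module.subspace_neg[OF module_scl hom_subspace] .

lemma hom_diff [simp]: "a \<in> obj A \<Longrightarrow> b \<in> obj A \<Longrightarrow> x \<in> hom A a b i \<Longrightarrow> y \<in> hom A a b i \<Longrightarrow> x - y \<in> hom A a b i"
  using module.subspace_diff[OF module_scl hom_subspace] .

lemma hom_sg [simp]: "a \<in> obj A \<Longrightarrow> b \<in> obj A \<Longrightarrow> x \<in> hom A a b i \<Longrightarrow> sg j x \<in> hom A a b i"
  by (simp add: sg_def)

text \<open>In the primed rules the resulting degree is a variable with an equation as premise:
  degrees such as \<open>- 1 + 1\<close> get normalised during rewriting and would no longer match a
  sum.\<close>

lemma dif_hom' [simp]: "a \<in> obj A \<Longrightarrow> b \<in> obj A \<Longrightarrow> f \<in> hom A a b i \<Longrightarrow> j = i + 1 \<Longrightarrow> dif A a b i f \<in> hom A a b j"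
  by (simp add: dif_hom)

lemma cmp_hom' [simp]: "a \<in> obj A \<Longrightarrow> b \<in> obj A \<Longrightarrow> c \<in> obj A \<Longrightarrow> g \<in> hom A b c j \<Longrightarrow> f \<in> hom A a b i \<Longrightarrow>
   n = j + i \<Longrightarrow> cmp A a b c j i g f \<in> hom A a c n"
  by (simp add: cmp_hom)

lemma dif_0 [simp]: "a \<in> obj A \<Longrightarrow> b \<in> obj A \<Longrightarrow> dif A a b i 0 = 0"
  by (rule linear_on_0[OF dif_linear]) auto

lemma dif_add: "a \<in> obj A \<Longrightarrow> b \<in> obj A \<Longrightarrow> x \<in> hom A a b i \<Longrightarrow> y \<in> hom A a b i \<Longrightarrow>
   dif A a b i (x + y) = dif A a b i x + dif A a b i y"
  by (rule linear_on_add[OF dif_linear]) auto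

lemma dif_scl: "a \<in> obj A \<Longrightarrow> b \<in> obj A \<Longrightarrow> x \<in> hom A a b i \<Longrightarrow>
   dif A a b i (scl A c x) = scl A c (dif A a b i x)"
  by (rule linear_on_scale[OF dif_linear]) auto

lemma dif_uminus: "a \<in> obj A \<Longrightarrow> b \<in> obj A \<Longrightarrow> x \<in> hom A a b i \<Longrightarrow> dif A a b i (- x) = - dif A a b i x"
  by (rule linear_on_uminus[OF dif_linear]) auto

lemma dif_diff: "a \<in> obj A \<Longrightarrow> b \<in> obj A \<Longrightarrow> x \<in> hom A a b i \<Longrightarrow> y \<in> hom A a b i \<Longrightarrow>
   dif A a b i (x - y) = dif A a b i x - dif A a b i y"
  using dif_add[of a b x i "- y"] by (simp add: dif_uminus)

lemma dif_sg: "a \<in> obj A \<Longrightarrow> b \<in> obj A \<Longrightarrow> x \<in> hom A a b i \<Longrightarrow> dif A a b i (sg j x) = sg j (dif A a b i x)"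
  by (simp add: sg_def dif_uminus)

lemma dif_dif' [simp]: "a \<in> obj A \<Longrightarrow> b \<in> obj A \<Longrightarrow> f \<in> hom A a b i \<Longrightarrow> j = i + 1 \<Longrightarrow> dif A a b j (dif A a b i f) = 0"
  by (simp add: dif_dif)

lemma leibniz': "a \<in> obj A \<Longrightarrow> b \<in> obj A \<Longrightarrow> c \<in> obj A \<Longrightarrow> g \<in> hom A b c j \<Longrightarrow> f \<in> hom A a b i \<Longrightarrow> n = j + i \<Longrightarrow>
   dif A a c n (cmp A a b c j i g f) =
     cmp A a b c (j + 1) i (dif A b c j g) f + sg j (cmp A a b c j (i + 1) g (dif A a b i f))"
  by (simp add: leibniz)

lemma cmp_assoc': "a \<in> obj A \<Longrightarrow> b \<in> obj A \<Longrightarrow> c \<in> obj A \<Longrightarrow> d \<in> obj A \<Longrightarrow>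
   h \<in> hom A c d l \<Longrightarrow> g \<in> hom A b c j \<Longrightarrow> f \<in> hom A a b i \<Longrightarrow> n = l + j \<Longrightarrow>
   cmp A a b d n i (cmp A b c d l j h g) f = cmp A a c d l (j + i) h (cmp A a b c j i g f)"
  by (simp add: cmp_assoc)

context
  fixes a b c assumes ob: "a \<in> obj A" "b \<in> obj A" "c \<in> obj A"
begin

lemma cmp_0_left [simp]: "f \<in> hom A a b i \<Longrightarrow> cmp A a b c j i 0 f = 0"
  using linear_on_0[OF cmp_linear_left] ob by auto

lemma cmp_0_right [simp]: "g \<in> hom A b c j \<Longrightarrow> cmp A a b c j i g 0 = 0"
  using linear_on_0[OF cmp_linear_right] ob by auto

lemma cmp_add_left: "f \<in> hom A a b i \<Longrightarrow> g \<in> hom A b c j \<Longrightarrow> g' \<in> hom A b c j \<Longrightarrow>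
   cmp A a b c j i (g + g') f = cmp A a b c j i g f + cmp A a b c j i g' f"
  by (rule linear_on_add[OF cmp_linear_left]) (auto simp: ob)

lemma cmp_add_right: "g \<in> hom A b c j \<Longrightarrow> f \<in> hom A a b i \<Longrightarrow> f' \<in> hom A a b i \<Longrightarrow>
   cmp A a b c j i g (f + f') = cmp A a b c j i g f + cmp A a b c j i g f'"
  by (rule linear_on_add[OF cmp_linear_right]) (auto simp: ob)

lemma cmp_scl_left: "f \<in> hom A a b i \<Longrightarrow> g \<in> hom A b c j \<Longrightarrow>
   cmp A a b c j i (scl A x g) f = scl A x (cmp A a b c j i g f)"
  using linear_on_scale[OF cmp_linear_left] ob by auto

lemma cmp_scl_right: "f \<in> hom A a b i \<Longrightarrow> g \<in> hom A b c j \<Longrightarrow>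
   cmp A a b c j i g (scl A x f) = scl A x (cmp A a b c j i g f)"
  using linear_on_scale[OF cmp_linear_right] ob by auto

lemma cmp_uminus_left: "f \<in> hom A a b i \<Longrightarrow> g \<in> hom A b c j \<Longrightarrow>
   cmp A a b c j i (- g) f = - cmp A a b c j i g f"
  by (rule linear_on_uminus[OF cmp_linear_left]) (auto simp: ob)

lemma cmp_uminus_right: "f \<in> hom A a b i \<Longrightarrow> g \<in> hom A b c j \<Longrightarrow>
   cmp A a b c j i g (- f) = - cmp A a b c j i g f"
  by (rule linear_on_uminus[OF cmp_linear_right]) (auto simp: ob)

lemma cmp_diff_left: "f \<in> hom A a b i \<Longrightarrow> g \<in> hom A b c j \<Longrightarrow> g' \<in> hom A b c j \<Longrightarrow>
   cmp A a b c j i (g - g') f = cmp A a b c j i g f - cmp A a b c j i g' f"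
  using cmp_add_left[of f i g j "- g'"] by (simp add: cmp_uminus_left ob)

lemma cmp_diff_right: "g \<in> hom A b c j \<Longrightarrow> f \<in> hom A a b i \<Longrightarrow> f' \<in> hom A a b i \<Longrightarrow>
   cmp A a b c j i g (f - f') = cmp A a b c j i g f - cmp A a b c j i g f'"
  using cmp_add_right[of g j f i "- f'"] by (simp add: cmp_uminus_right ob)

lemma cmp_sg_left: "f \<in> hom A a b i \<Longrightarrow> g \<in> hom A b c j \<Longrightarrow>
   cmp A a b c j i (sg l g) f = sg l (cmp A a b c j i g f)"
  by (simp add: sg_def cmp_uminus_left)

lemma cmp_sg_right: "f \<in> hom A a b i \<Longrightarrow> g \<in> hom A b c j \<Longrightarrow>
   cmp A a b c j i g (sg l f) = sg l (cmp A a b c j i g f)"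
  by (simp add: sg_def cmp_uminus_right)

end

lemmas dif_linear_simps = dif_add dif_uminus dif_diff dif_sg dif_scl
lemmas cmp_linear_simps = cmp_add_left cmp_add_right cmp_uminus_left cmp_uminus_right
  cmp_diff_left cmp_diff_right cmp_sg_left cmp_sg_right cmp_scl_left cmp_scl_right

declare idt_hom [simp] dif_idt [simp] idt_left [simp] idt_right [simp]

lemma scl_add: "scl A x (u + v) = scl A x u + scl A x v"
  and scl_diff: "scl A x (u - v) = scl A x u - scl A x v"
  and scl_uminus: "scl A x (- u) = - scl A x u"
  and scl_0 [simp]: "scl A x 0 = 0"
  using module.scale_right_distrib[OF module_scl] module.scale_right_diff_distrib[OF module_scl]
    module.scale_minus_right[OF module_scl] module.scale_zero_right[OF module_scl] by blast+

lemma scl_sg: "scl A x (sg j u) = sg j (scl A x u)"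
  by (simp add: sg_def scl_uminus)

lemmas scl_simps = scl_add scl_diff scl_uminus scl_sg

end

context dg_functor
begin

lemma fmor_hom' [simp]: "a \<in> obj A \<Longrightarrow> b \<in> obj A \<Longrightarrow> f \<in> hom A a b i \<Longrightarrow> fmor F a b i f \<in> hom B (fob F a) (fob F b) i"
  by (rule fmor_hom)

declare fob_obj [simp] fmor_idt [simp]

lemma fmor_0 [simp]: "a \<in> obj A \<Longrightarrow> b \<in> obj A \<Longrightarrow> fmor F a b i 0 = 0"
  by (rule linear_on_0[OF fmor_linear]) auto

lemma fmor_add: "a \<in> obj A \<Longrightarrow> b \<in> obj A \<Longrightarrow> x \<in> hom A a b i \<Longrightarrow> y \<in> hom A a b i \<Longrightarrow>
   fmor F a b i (x + y) = fmor F a b i x + fmor F a b i y"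
  by (rule linear_on_add[OF fmor_linear]) auto

lemma fmor_scl: "a \<in> obj A \<Longrightarrow> b \<in> obj A \<Longrightarrow> x \<in> hom A a b i \<Longrightarrow>
   fmor F a b i (scl A c x) = scl B c (fmor F a b i x)"
  by (rule linear_on_scale[OF fmor_linear]) auto

lemma fmor_uminus: "a \<in> obj A \<Longrightarrow> b \<in> obj A \<Longrightarrow> x \<in> hom A a b i \<Longrightarrow> fmor F a b i (- x) = - fmor F a b i x"
  by (rule linear_on_uminus[OF fmor_linear]) auto

lemma fmor_diff: "a \<in> obj A \<Longrightarrow> b \<in> obj A \<Longrightarrow> x \<in> hom A a b i \<Longrightarrow> y \<in> hom A a b i \<Longrightarrow>
   fmor F a b i (x - y) = fmor F a b i x - fmor F a b i y"
  using fmor_add[of a b x i "- y"] by (simp add: fmor_uminus)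

lemma fmor_dif': "a \<in> obj A \<Longrightarrow> b \<in> obj A \<Longrightarrow> f \<in> hom A a b i \<Longrightarrow> j = i + 1 \<Longrightarrow>
   fmor F a b j (dif A a b i f) = dif B (fob F a) (fob F b) i (fmor F a b i f)"
  by (simp add: fmor_dif)

lemma fmor_cmp': "a \<in> obj A \<Longrightarrow> b \<in> obj A \<Longrightarrow> c \<in> obj A \<Longrightarrow> g \<in> hom A b c j \<Longrightarrow> f \<in> hom A a b i \<Longrightarrow> n = j + i \<Longrightarrow>
   fmor F a c n (cmp A a b c j i g f) =
        cmp B (fob F a) (fob F b) (fob F c) j i (fmor F b c j g) (fmor F a b i f)"
  by (simp add: fmor_cmp)

lemmas fmor_simps = fmor_add fmor_uminus fmor_diff fmor_scl fmor_dif' fmor_cmp'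

end

section \<open>Gluing\<close>

locale glue_data = F1: dg_functor A1 D F1 + F2: dg_functor A2 D F2
  for D :: "('q, 'r::ab_group_add, 'k::field_char_0) dgcat"
    and A1 :: "('o, 'm::ab_group_add, 'k) dgcat"
    and A2 :: "('p, 'n::ab_group_add, 'k) dgcat" and F1 F2
begin

abbreviation "G \<equiv> glue D A1 A2 F1 F2"

lemma glue_obj [simp]: "(a, b, \<mu>) \<in> obj G \<longleftrightarrow> a \<in> obj A1 \<and> b \<in> obj A2 \<and>
    \<mu> \<in> hom D (fob F1 a) (fob F2 b) 0 \<and> dif D (fob F1 a) (fob F2 b) 0 \<mu> = 0"
  by (simp add: glue_def)

lemma glue_hom [simp]: "hom G (a, b, \<mu>) (c, d, \<xi>) i =
    hom A1 a c i \<times> hom A2 b d i \<times> hom D (fob F1 a) (fob F2 d) (i - 1)"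
  by (simp add: glue_def)

lemma glue_scl [simp]: "scl G x (f, g, h) = (scl A1 x f, scl A2 x g, scl D x h)"
  by (simp add: glue_def)

lemma glue_dif [simp]: "dif G (a, b, \<mu>) (c, d, \<xi>) i (f, g, h) = 
     (dif A1 a c i f, dif A2 b d i g,
       - dif D (fob F1 a) (fob F2 d) (i - 1) h
       + cmp D (fob F1 a) (fob F2 b) (fob F2 d) i 0 (fmor F2 b d i g) \<mu>
       - cmp D (fob F1 a) (fob F1 c) (fob F2 d) 0 i \<xi> (fmor F1 a c i f))"
  by (simp add: glue_def)

lemma glue_cmp [simp]: "cmp G (a, b, \<mu>) (c, d, \<xi>) (c', d', \<xi>') j i (f', g', h') (f, g, h) =
      (cmp A1 a c c' j i f' f, cmp A2 b d d' j i g' g,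
       cmp D (fob F1 a) (fob F1 c) (fob F2 d') (j - 1) i h' (fmor F1 a c i f)
       + sg j (cmp D (fob F1 a) (fob F2 d) (fob F2 d') j (i - 1) (fmor F2 d d' j g') h))"
  by (simp add: glue_def)

lemma glue_idt [simp]: "idt G (a, b, \<mu>) = (idt A1 a, idt A2 b, 0)"
  by (simp add: glue_def)

lemma glue_vector_space: "vector_space (scl G)"
proof -
  interpret v1: vector_space "scl A1" by (rule F1.dom.scl_vector_space)
  interpret v2: vector_space "scl A2" by (rule F2.dom.scl_vector_space)
  interpret v3: vector_space "scl D" by (rule F1.cod.scl_vector_space)
  show ?thesis
    by standard (auto simp: v1.scale_right_distrib v2.scale_right_distrib v3.scale_right_distrib
      v1.scale_left_distrib v2.scale_left_distrib v3.scale_left_distrib)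
qed

lemmas glue_expand = F1.fmor_simps F2.fmor_simps F1.dom.dif_linear_simps F2.dom.dif_linear_simps
    F1.cod.dif_linear_simps F1.dom.cmp_linear_simps F2.dom.cmp_linear_simps F1.cod.cmp_linear_simps
    F1.cod.leibniz' F1.dom.leibniz' F2.dom.leibniz' F1.cod.cmp_assoc' F1.dom.cmp_assoc' F2.dom.cmp_assoc' F1.dom.scl_simps F2.dom.scl_simps F1.cod.scl_simps

text \<open>Only the third entries carry content. There d d = 0 comes from \<mu> and \<xi> being
  closed: the Leibniz rule applied to F2(g) \<mu> and \<xi> F1(f) reproduces the terms of dg and df
  with the opposite sign, because of the minus before the differential of h.\<close>

lemma glue_dg_category: "dg_category G"
proof (rule dg_category.intro)
  show "vector_space (scl G)" by (rule glue_vector_space)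
next
  fix a b i assume "a \<in> obj G" "b \<in> obj G"
  then show "module.subspace (scl G) (hom G a b i)"
    by (cases a; cases b) (auto simp: module.subspace_def[OF module_scl_of_vector_space[OF glue_vector_space]] zero_prod_def)
next
  fix a b f i assume "a \<in> obj G" "b \<in> obj G" "f \<in> hom G a b i"
  then show "dif G a b i f \<in> hom G a b (i + 1)"
    by (cases a; cases b; cases f) auto
next
  fix a b i assume "a \<in> obj G" "b \<in> obj G"
  then show "linear_on (hom G a b i) (scl G) (scl G) (dif G a b i)"
    by (cases a; cases b) (auto intro!: linear_onI simp: glue_expand)
next
  fix a b f i assume "a \<in> obj G" "b \<in> obj G" "f \<in> hom G a b i"
  then show "dif G a b (i + 1) (dif G a b i f) = 0"
    by (cases a; cases b; cases f) (auto simp: glue_expand zero_prod_def)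
next
  fix a b c g j f i assume "a \<in> obj G" "b \<in> obj G" "c \<in> obj G" "g \<in> hom G b c j" "f \<in> hom G a b i"
  then show "cmp G a b c j i g f \<in> hom G a c (j + i)"
    by (cases a; cases b; cases c; cases f; cases g) auto
next
  fix a b c j f i assume "a \<in> obj G" "b \<in> obj G" "c \<in> obj G" "f \<in> hom G a b i"
  then show "linear_on (hom G b c j) (scl G) (scl G) (\<lambda>g. cmp G a b c j i g f)"
    by (cases a; cases b; cases c; cases f) (auto intro!: linear_onI simp: glue_expand sg_add)
next
  fix a b c g j i assume "a \<in> obj G" "b \<in> obj G" "c \<in> obj G" "g \<in> hom G b c j"
  then show "linear_on (hom G a b i) (scl G) (scl G) (\<lambda>f. cmp G a b c j i g f)"
    by (cases a; cases b; cases c; cases g) (auto intro!: linear_onI simp: glue_expand sg_add)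
next
  fix a b c d h l g j f i 
  assume "a \<in> obj G" "b \<in> obj G" "c \<in> obj G" "d \<in> obj G" "h \<in> hom G c d l" "g \<in> hom G b c j" "f \<in> hom G a b i"
  then show "cmp G a b d (l + j) i (cmp G b c d l j h g) f = cmp G a c d l (j + i) h (cmp G a b c j i g f)"
    by (cases a; cases b; cases c; cases d; cases f; cases g; cases h)
      (auto simp: glue_expand sg_add sg_def algebra_simps)
next
  fix a b c g j f i assume "a \<in> obj G" "b \<in> obj G" "c \<in> obj G" "g \<in> hom G b c j" "f \<in> hom G a b i"
  then show "dif G a c (j + i) (cmp G a b c j i g f) =
        cmp G a b c (j + 1) i (dif G b c j g) f + sg j (cmp G a b c j (i + 1) g (dif G a b i f))"
    by (cases a; cases b; cases c; cases f; cases g)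
      (auto simp: glue_expand sg_def algebra_simps)
qed (auto simp: zero_prod_def)

end

section \<open>Functors\<close>

lemma dg_functorI:
  assumes "dg_category A" "dg_category B"
    and "\<And>a. a \<in> obj A \<Longrightarrow> fob F a \<in> obj B"
    and "\<And>a b f i. a \<in> obj A \<Longrightarrow> b \<in> obj A \<Longrightarrow> f \<in> hom A a b i \<Longrightarrow> fmor F a b i f \<in> hom B (fob F a) (fob F b) i"
    and "\<And>a b i. a \<in> obj A \<Longrightarrow> b \<in> obj A \<Longrightarrow> linear_on (hom A a b i) (scl A) (scl B) (fmor F a b i)"
    and "\<And>a b f i. a \<in> obj A \<Longrightarrow> b \<in> obj A \<Longrightarrow> f \<in> hom A a b i \<Longrightarrow>
      fmor F a b (i + 1) (dif A a b i f) = dif B (fob F a) (fob F b) i (fmor F a b i f)"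
    and "\<And>a b c g f j i. a \<in> obj A \<Longrightarrow> b \<in> obj A \<Longrightarrow> c \<in> obj A \<Longrightarrow> g \<in> hom A b c j \<Longrightarrow> f \<in> hom A a b i \<Longrightarrow>
      fmor F a c (j + i) (cmp A a b c j i g f) =
        cmp B (fob F a) (fob F b) (fob F c) j i (fmor F b c j g) (fmor F a b i f)"
    and "\<And>a. a \<in> obj A \<Longrightarrow> fmor F a a 0 (idt A a) = idt B (fob F a)"
  shows "dg_functor A B F"
  using assms by (intro dg_functor.intro dg_functor_axioms.intro)

lemma fob_id_fun [simp]: "fob id_fun a = a"
  and fmor_id_fun [simp]: "fmor id_fun a b i f = f"
  by (simp_all add: id_fun_def)

lemma fob_comp_fun [simp]: "fob (G \<circ>\<circ> F) a = fob G (fob F a)"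
  and fmor_comp_fun [simp]: "fmor (G \<circ>\<circ> F) a b i f = fmor G (fob F a) (fob F b) i (fmor F a b i f)"
  by (simp_all add: comp_fun_def)

lemma fob_proj1 [simp]: "fob proj1 (a, b, \<mu>) = a"
  and fmor_proj1 [simp]: "fmor proj1 x y i (f, g, h) = f"
  and fob_proj2 [simp]: "fob proj2 (a, b, \<mu>) = b"
  and fmor_proj2 [simp]: "fmor proj2 x y i (f, g, h) = g"
  by (simp_all add: proj1_def proj2_def)

lemma dg_functor_id: "dg_category A \<Longrightarrow> dg_functor A A id_fun"
  by (rule dg_functorI) (auto intro!: linear_onI)

lemma dg_functor_comp:
  assumes "dg_functor A B F" "dg_functor B C G"
  shows "dg_functor A C (G \<circ>\<circ> F)"
proof -
  interpret F: dg_functor A B F by fact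
  interpret G: dg_functor B C G by fact
  show ?thesis
    by (rule dg_functorI)
      (auto intro!: linear_onI F.dom.dg_category_axioms G.cod.dg_category_axioms simp: F.fmor_simps G.fmor_simps)
qed

lemma fun_eq_onI:
  assumes "\<And>a. a \<in> obj A \<Longrightarrow> fob F a = fob G a"
    and "\<And>a b i f. a \<in> obj A \<Longrightarrow> b \<in> obj A \<Longrightarrow> f \<in> hom A a b i \<Longrightarrow> fmor F a b i f = fmor G a b i f"
  shows "fun_eq_on A F G"
  using assms by (simp add: fun_eq_on_def)

section \<open>Full subcategories and homotopy fiber products\<close>

lemma full_sub_dg_category:
  assumes "dg_category A" "S \<subseteq> obj A"
  shows "dg_category (A\<lparr>obj := S\<rparr>)"
proof -
  interpret dg_category A by fact
  have S: "\<And>a. a \<in> S \<Longrightarrow> a \<in> obj A" using assms(2) by auto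
  show ?thesis
    by (rule dg_category.intro)
      (simp_all add: S scl_vector_space hom_subspace dif_linear cmp_linear_left cmp_linear_right cmp_assoc' leibniz')
qed

lemma full_sub_dg_functor:
  assumes "dg_functor A B F" "S \<subseteq> obj A"
  shows "dg_functor (A\<lparr>obj := S\<rparr>) B F"
proof -
  interpret dg_functor A B F by fact
  have S: "\<And>a. a \<in> S \<Longrightarrow> a \<in> obj A" using assms(2) by auto
  show ?thesis
    by (rule dg_functorI)
      (simp_all add: S full_sub_dg_category assms dom.dg_category_axioms cod.dg_category_axioms fmor_simps fmor_linear)
qed

context glue_data
begin

lemma glue_proj1: "dg_functor G A1 proj1"
  by (rule dg_functorI) (auto intro!: linear_onI glue_dg_category F1.dom.dg_category_axioms)

lemma glue_proj2: "dg_functor G A2 proj2"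
  by (rule dg_functorI) (auto intro!: linear_onI glue_dg_category F2.dom.dg_category_axioms)

abbreviation "H \<equiv> hfib D A1 A2 F1 F2"

lemma hfib_obj: "obj H \<subseteq> obj G"
  by (auto simp: hfib_def)

lemma hfib_dg_category: "dg_category H"
  unfolding hfib_def by (rule full_sub_dg_category[OF glue_dg_category]) auto

lemma hfib_dg_functor: "dg_functor G B F \<Longrightarrow> dg_functor H B F"
  unfolding hfib_def by (rule full_sub_dg_functor) auto

lemma hfib_simps [simp]: "hom H = hom G" "scl H = scl G" "dif H = dif G" "cmp H = cmp G" "idt H = idt G"
  by (simp_all add: hfib_def)

lemma hfib_objI:
  assumes "(a, b, \<mu>) \<in> obj G" "iso_in (H0 D) (fob F1 a) (fob F2 b)
      (cclass (hom D (fob F1 a) (fob F2 b)) (dif D (fob F1 a) (fob F2 b)) 0 \<mu>)"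
  shows "(a, b, \<mu>) \<in> obj H"
  using assms by (simp add: hfib_def)

lemma hfib_iso:
  assumes "(a, b, \<mu>) \<in> obj H" shows "iso_in (H0 D) (fob F1 a) (fob F2 b)
      (cclass (hom D (fob F1 a) (fob F2 b)) (dif D (fob F1 a) (fob F2 b)) 0 \<mu>)"
  using assms by (simp add: hfib_def)

end

section \<open>Homotopy equivalences\<close>

text \<open>Invertibility in \<open>H0\<close> spelled out with representatives and explicit
  homotopies, so that arguments calculate with elements; \<open>iso_in_H0_iff\<close> is the bridge
  to classes.\<close>

definition hiso :: "('o, 'm::ab_group_add, 'k) dgcat \<Rightarrow> 'o \<Rightarrow> 'o \<Rightarrow> 'm \<Rightarrow> bool" where
  "hiso A a b f \<longleftrightarrow> f \<in> hom A a b 0 \<and> dif A a b 0 f = 0 \<and>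
     (\<exists>g\<in>hom A b a 0. dif A b a 0 g = 0 \<and>
       (\<exists>\<alpha>\<in>hom A a a (- 1). cmp A a b a 0 0 g f = idt A a + dif A a a (- 1) \<alpha>) \<and>
       (\<exists>\<beta>\<in>hom A b b (- 1). cmp A b a b 0 0 f g = idt A b + dif A b b (- 1) \<beta>))"

lemma hiso_hom: "hiso A a b f \<Longrightarrow> f \<in> hom A a b 0"
  and hiso_closed: "hiso A a b f \<Longrightarrow> dif A a b 0 f = 0"
  by (auto simp: hiso_def)

lemma hisoI:
  assumes "f \<in> hom A a b 0" "dif A a b 0 f = 0" "g \<in> hom A b a 0" "dif A b a 0 g = 0"
    "\<alpha> \<in> hom A a a (- 1)" "cmp A a b a 0 0 g f = idt A a + dif A a a (- 1) \<alpha>"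
    "\<beta> \<in> hom A b b (- 1)" "cmp A b a b 0 0 f g = idt A b + dif A b b (- 1) \<beta>"
  shows "hiso A a b f"
  using assms by (auto simp: hiso_def)

lemma hisoE:
  assumes "hiso A a b f"
  obtains g \<alpha> \<beta> where "g \<in> hom A b a 0" "dif A b a 0 g = 0"
    "\<alpha> \<in> hom A a a (- 1)" "cmp A a b a 0 0 g f = idt A a + dif A a a (- 1) \<alpha>"
    "\<beta> \<in> hom A b b (- 1)" "cmp A b a b 0 0 f g = idt A b + dif A b b (- 1) \<beta>"
  using assms by (auto simp: hiso_def)

context dg_category
begin

lemma hiso_idt: "a \<in> obj A \<Longrightarrow> hiso A a a (idt A a)"
  by (rule hisoI[where g = "idt A a" and \<alpha> = 0 and \<beta> = 0]) simp_all

text \<open>Evaluating k f g in two ways shows that the right inverse g and the left inverse k are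
  homotopic, so g also inverts f from the left.\<close>

lemma hiso_from_one_sided:
  assumes ob: "a \<in> obj A" "b \<in> obj A" and f: "f \<in> hom A a b 0" "dif A a b 0 f = 0"
    and g: "g \<in> hom A b a 0" "dif A b a 0 g = 0" "\<beta> \<in> hom A b b (- 1)"
      "cmp A b a b 0 0 f g = idt A b + dif A b b (- 1) \<beta>"
    and k: "k \<in> hom A b a 0" "dif A b a 0 k = 0" "\<alpha> \<in> hom A a a (- 1)"
      "cmp A a b a 0 0 k f = idt A a + dif A a a (- 1) \<alpha>"
  shows "hiso A a b f"
proof -
  \<comment> \<open>From (k f) g = g + d\<alpha> g and k (f g) = k + k d\<beta> the difference g - k
    equals k d\<beta> - d\<alpha> g, which is the boundary of this element.\<close>
  define \<gamma> where "\<gamma> = cmp A b b a 0 (- 1) k \<beta> - cmp A b a a (- 1) 0 \<alpha> g"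
  have \<gamma>: "\<gamma> \<in> hom A b a (- 1)" unfolding \<gamma>_def by (simp add: assms)
  have "cmp A b a a 0 0 (cmp A a b a 0 0 k f) g = cmp A b b a 0 0 k (cmp A b a b 0 0 f g)"
    by (simp add: cmp_assoc' ob f g(1) k(1))
  then have "g + cmp A b a a 0 0 (dif A a a (- 1) \<alpha>) g = k + cmp A b b a 0 0 k (dif A b b (- 1) \<beta>)"
    by (simp add: g k ob cmp_linear_simps)
  moreover have "dif A b a (- 1) \<gamma> = cmp A b b a 0 0 k (dif A b b (- 1) \<beta>) - cmp A b a a 0 0 (dif A a a (- 1) \<alpha>) g"
    unfolding \<gamma>_def using assms by (simp add: leibniz' dif_linear_simps)
  ultimately have "g + cmp A b a a 0 0 (dif A a a (- 1) \<alpha>) g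
      = (k + dif A b a (- 1) \<gamma>) + cmp A b a a 0 0 (dif A a a (- 1) \<alpha>) g"
    by (simp add: add.assoc)
  then have g_eq: "g = k + dif A b a (- 1) \<gamma>" by simp
  have 1: "cmp A a b a 0 0 g f = idt A a + dif A a a (- 1) (\<alpha> + cmp A a b a (- 1) 0 \<gamma> f)"
    by (subst g_eq) (use \<gamma> in \<open>simp add: ob f k leibniz' dif_linear_simps cmp_linear_simps\<close>)
  show ?thesis
    by (rule hisoI[OF f g(1,2) _ 1 g(3,4)]) (simp add: ob k f \<gamma>)
qed

lemma hiso_comp:
  assumes ob: "a \<in> obj A" "b \<in> obj A" "c \<in> obj A" and "hiso A a b f" "hiso A b c g"
  shows "hiso A a c (cmp A a b c 0 0 g f)"
proof -
  from \<open>hiso A a b f\<close> obtain f' \<alpha> \<beta> where f': "f' \<in> hom A b a 0" "dif A b a 0 f' = 0"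
    "\<alpha> \<in> hom A a a (- 1)" "cmp A a b a 0 0 f' f = idt A a + dif A a a (- 1) \<alpha>"
    "\<beta> \<in> hom A b b (- 1)" "cmp A b a b 0 0 f f' = idt A b + dif A b b (- 1) \<beta>" by (rule hisoE)
  from \<open>hiso A b c g\<close> obtain g' \<gamma> \<delta> where g': "g' \<in> hom A c b 0" "dif A c b 0 g' = 0"
    "\<gamma> \<in> hom A b b (- 1)" "cmp A b c b 0 0 g' g = idt A b + dif A b b (- 1) \<gamma>"
    "\<delta> \<in> hom A c c (- 1)" "cmp A c b c 0 0 g g' = idt A c + dif A c c (- 1) \<delta>" by (rule hisoE)
  note fg = hiso_hom[OF assms(4)] hiso_hom[OF assms(5)] hiso_closed[OF assms(4)] hiso_closed[OF assms(5)]
  have "cmp A a c a 0 0 (cmp A c b a 0 0 f' g') (cmp A a b c 0 0 g f)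
      = cmp A a b a 0 0 f' (cmp A a b b 0 0 (cmp A b c b 0 0 g' g) f)"
    by (simp add: cmp_assoc' ob fg f'(1-3) g'(1-3))
  also have "\<dots> = idt A a + dif A a a (- 1) (\<alpha> + cmp A a b a 0 (- 1) f' (cmp A a b b (- 1) 0 \<gamma> f))"
    unfolding g'(4) by (simp add: ob fg f' g' cmp_linear_simps dif_linear_simps leibniz')
  finally have 1: "cmp A a c a 0 0 (cmp A c b a 0 0 f' g') (cmp A a b c 0 0 g f) = \<dots>" .
  have "cmp A c a c 0 0 (cmp A a b c 0 0 g f) (cmp A c b a 0 0 f' g')
      = cmp A c b c 0 0 g (cmp A c b b 0 0 (cmp A b a b 0 0 f f') g')"
    by (simp add: cmp_assoc' ob fg f'(1-3) g'(1-3))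
  also have "\<dots> = idt A c + dif A c c (- 1) (\<delta> + cmp A c b c 0 (- 1) g (cmp A c b b (- 1) 0 \<beta> g'))"
    unfolding f'(6) by (simp add: ob fg f' g' cmp_linear_simps dif_linear_simps leibniz')
  finally have 2: "cmp A c a c 0 0 (cmp A a b c 0 0 g f) (cmp A c b a 0 0 f' g') = \<dots>" .
  show ?thesis
    by (rule hiso_from_one_sided[OF _ _ _ _ _ _ _ 2 _ _ _ 1]) (simp_all add: ob fg f' g' leibniz')
qed

text \<open>If v inverts f g from the right and w inverts g f from the left, then g v and w g are
  one-sided inverses of f; g itself is not claimed to be an inverse. This allows a candidate inverse
  whose composites with f are merely invertible.\<close>

lemma hiso_two_of_six:
  assumes ob: "a \<in> obj A" "b \<in> obj A" and f: "f \<in> hom A a b 0" "dif A a b 0 f = 0"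
    and g: "g \<in> hom A b a 0" "dif A b a 0 g = 0"
    and fg: "hiso A b b (cmp A b a b 0 0 f g)" and gf: "hiso A a a (cmp A a b a 0 0 g f)"
  shows "hiso A a b f"
proof -
  obtain v \<beta> where v: "v \<in> hom A b b 0" "dif A b b 0 v = 0" "\<beta> \<in> hom A b b (- 1)"
    "cmp A b b b 0 0 (cmp A b a b 0 0 f g) v = idt A b + dif A b b (- 1) \<beta>"
    using fg by (rule hisoE)
  obtain w \<alpha> where w: "w \<in> hom A a a 0" "dif A a a 0 w = 0" "\<alpha> \<in> hom A a a (- 1)"
    "cmp A a a a 0 0 w (cmp A a b a 0 0 g f) = idt A a + dif A a a (- 1) \<alpha>"
    using gf by (rule hisoE)
  show ?thesis
    by (rule hiso_from_one_sided[where g = "cmp A b b a 0 0 g v" and \<beta> = \<beta> and k = "cmp A b a a 0 0 w g" and \<alpha> = \<alpha>])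
      (simp_all add: ob f g v(1-3) w(1-3) v(4)[symmetric] w(4)[symmetric] cmp_assoc' leibniz')
qed

section \<open>Cohomology classes and composition in \<open>H0\<close>\<close>

definition cls :: "'o \<Rightarrow> 'o \<Rightarrow> int \<Rightarrow> 'm \<Rightarrow> 'm set" where
  "cls a b i z = cclass (hom A a b) (dif A a b) i z"

lemma cls_eq_iff:
  assumes ob: "a \<in> obj A" "b \<in> obj A"
  shows "cls a b i z = cls a b i z' \<longleftrightarrow> (\<exists>v\<in>hom A a b (i - 1). z = z' + dif A a b (i - 1) v)"
proof
  assume "cls a b i z = cls a b i z'"
  moreover have "z \<in> cls a b i z"
    unfolding cls_def cclass_def by (auto simp: ob intro!: image_eqI[of _ _ 0])
  ultimately have "z - z' \<in> dif A a b (i - 1) ` hom A a b (i - 1)"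
    by (auto simp: cls_def cclass_def)
  then obtain v where "v \<in> hom A a b (i - 1)" "z - z' = dif A a b (i - 1) v" by auto
  then show "\<exists>v\<in>hom A a b (i - 1). z = z' + dif A a b (i - 1) v"
    by (auto intro!: bexI[of _ v] simp: algebra_simps)
next
  assume "\<exists>v\<in>hom A a b (i - 1). z = z' + dif A a b (i - 1) v"
  then obtain v where v: "v \<in> hom A a b (i - 1)" "z = z' + dif A a b (i - 1) v" by auto
  have "(x - z \<in> dif A a b (i - 1) ` hom A a b (i - 1)) \<longleftrightarrow> (x - z' \<in> dif A a b (i - 1) ` hom A a b (i - 1))" for x
  proof
    assume "x - z \<in> dif A a b (i - 1) ` hom A a b (i - 1)"
    then obtain w where "w \<in> hom A a b (i - 1)" "x - z = dif A a b (i - 1) w" by auto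
    then show "x - z' \<in> dif A a b (i - 1) ` hom A a b (i - 1)"
      using v ob by (intro image_eqI[of _ _ "w + v"]) (auto simp: dif_linear_simps algebra_simps)
  next
    assume "x - z' \<in> dif A a b (i - 1) ` hom A a b (i - 1)"
    then obtain w where "w \<in> hom A a b (i - 1)" "x - z' = dif A a b (i - 1) w" by auto
    then show "x - z \<in> dif A a b (i - 1) ` hom A a b (i - 1)"
      using v ob by (intro image_eqI[of _ _ "w - v"]) (auto simp: dif_linear_simps algebra_simps)
  qed
  then show "cls a b i z = cls a b i z'"
    by (simp add: cls_def cclass_def)
qed

lemma mem_clsD:
  assumes "z' \<in> cls a b i z"
  shows "\<exists>v\<in>hom A a b (i - 1). z' = z + dif A a b (i - 1) v"
proof -
  from assms obtain v where "v \<in> hom A a b (i - 1)" "z' - z = dif A a b (i - 1) v"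
    by (auto simp: cls_def cclass_def)
  then show ?thesis by (auto intro!: bexI[of _ v] simp: algebra_simps)
qed

lemma cls_self: "a \<in> obj A \<Longrightarrow> b \<in> obj A \<Longrightarrow> z \<in> cls a b i z"
  unfolding cls_def cclass_def by (auto intro!: image_eqI[of _ _ 0])

text \<open>Composition in \<open>H0\<close> is a union over all representatives of both classes.
  Every member of that union is the same class, since changing f or g by a boundary changes the
  composite by a boundary, and the classes are nonempty.\<close>

lemma ccmp_cls:
  assumes ob: "a \<in> obj A" "b \<in> obj A" "c \<in> obj A" and f: "f \<in> hom A a b 0" "dif A a b 0 f = 0"
    and g: "g \<in> hom A b c 0" "dif A b c 0 g = 0"
  shows "ccmp (H0 A) a b c (cls b c 0 g) (cls a b 0 f) = cls a c 0 (cmp A a b c 0 0 g f)"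
proof -
  have "cls a c 0 (cmp A a b c 0 0 g' f') = cls a c 0 (cmp A a b c 0 0 g f)"
    if g': "g' \<in> cls b c 0 g" and f': "f' \<in> cls a b 0 f" for g' f'
  proof -
    obtain v w where v: "v \<in> hom A b c (- 1)" "g' = g + dif A b c (- 1) v"
      and w: "w \<in> hom A a b (- 1)" "f' = f + dif A a b (- 1) w"
      using mem_clsD[OF g'] mem_clsD[OF f'] by auto
    have f'_hom: "f' \<in> hom A a b 0" using ob f w by simp
    have "cmp A a b c 0 0 g' f' = cmp A a b c 0 0 g f' + cmp A a b c 0 0 (dif A b c (- 1) v) f'"
      unfolding v(2) using ob f'_hom g v(1) by (simp add: cmp_linear_simps)
    also have "cmp A a b c 0 0 g f' = cmp A a b c 0 0 g f + cmp A a b c 0 0 g (dif A a b (- 1) w)"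
      unfolding w(2) using ob f g w(1) by (simp add: cmp_linear_simps)
    also have "cmp A a b c 0 0 (dif A b c (- 1) v) f' = dif A a c (- 1) (cmp A a b c (- 1) 0 v f')"
    proof -
      have "dif A a b 0 f' = 0" unfolding w(2) using ob f w(1) by (simp add: dif_linear_simps)
      then show ?thesis using ob f'_hom v(1) by (simp add: leibniz')
    qed
    also have "cmp A a b c 0 0 g (dif A a b (- 1) w) = dif A a c (- 1) (cmp A a b c 0 (- 1) g w)"
      using ob g w(1) by (simp add: leibniz')
    finally have "cmp A a b c 0 0 g' f' = cmp A a b c 0 0 g f
       + dif A a c (- 1) (cmp A a b c 0 (- 1) g w + cmp A a b c (- 1) 0 v f')"
      using ob g w(1) v(1) f'_hom by (simp add: dif_add add.assoc)
    moreover have "cmp A a b c 0 (- 1) g w + cmp A a b c (- 1) 0 v f' \<in> hom A a c (0 - 1)"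
      using ob g w(1) v(1) f'_hom by simp
    ultimately show ?thesis
      unfolding cls_eq_iff[OF ob(1,3)] by auto
  qed
  then have "(\<Union>g'\<in>cls b c 0 g. \<Union>f'\<in>cls a b 0 f. cls a c 0 (cmp A a b c 0 0 g' f'))
     = (\<Union>g'\<in>cls b c 0 g. \<Union>f'\<in>cls a b 0 f. cls a c 0 (cmp A a b c 0 0 g f))"
    by (intro SUP_cong refl)
  also have "\<dots> = cls a c 0 (cmp A a b c 0 0 g f)"
    using cls_self[OF ob(2,3), of g 0] cls_self[OF ob(1,2), of f 0] by blast
  finally show ?thesis by (simp add: H0_def cls_def)
qed

text \<open>Used in both directions: to read homotopies off an object of a homotopy fiber product,
  and to return to \<open>iso_in\<close> for membership in one and for essential
  surjectivity.\<close>

lemma iso_in_H0_iff: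
  assumes ob: "a \<in> obj A" "b \<in> obj A" and f: "f \<in> hom A a b 0" "dif A a b 0 f = 0"
  shows "iso_in (H0 A) a b (cls a b 0 f) \<longleftrightarrow> hiso A a b f"
proof
  assume "iso_in (H0 A) a b (cls a b 0 f)"
  then obtain Y where Y: "Y \<in> cohomology (hom A b a) (dif A b a) 0"
    "ccmp (H0 A) a b a Y (cls a b 0 f) = cls a a 0 (idt A a)"
    "ccmp (H0 A) b a b (cls a b 0 f) Y = cls b b 0 (idt A b)"
    unfolding iso_in_def by (auto simp: H0_def cls_def)
  then obtain g where g: "g \<in> hom A b a 0" "dif A b a 0 g = 0" "Y = cls b a 0 g"
    by (auto simp: cohomology_def cocycles_def cls_def)
  show "hiso A a b f"
    using Y(2,3) unfolding g(3)
    by (auto simp: f g ccmp_cls ob cls_eq_iff intro: hisoI[OF f g(1,2)])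
next
  assume "hiso A a b f"
  then obtain g \<alpha> \<beta> where g: "g \<in> hom A b a 0" "dif A b a 0 g = 0"
    and h: "\<alpha> \<in> hom A a a (- 1)" "cmp A a b a 0 0 g f = idt A a + dif A a a (- 1) \<alpha>"
    "\<beta> \<in> hom A b b (- 1)" "cmp A b a b 0 0 f g = idt A b + dif A b b (- 1) \<beta>"
    by (rule hisoE)
  have e: "cls a a 0 (cmp A a b a 0 0 g f) = cls a a 0 (idt A a)"
      "cls b b 0 (cmp A b a b 0 0 f g) = cls b b 0 (idt A b)"
    using h by (auto simp: cls_eq_iff ob)
  have chom: "chom (H0 A) x y = cls x y 0 ` cocycles (hom A x y) (dif A x y) 0" for x y
    by (simp add: H0_def cohomology_def cls_def)
  have mem: "cls a b 0 f \<in> chom (H0 A) a b" "cls b a 0 g \<in> chom (H0 A) b a"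
    unfolding chom using f g by (auto simp: cocycles_def)
  have cid: "cid (H0 A) x = cls x x 0 (idt A x)" for x
    by (simp add: H0_def cls_def)
  show "iso_in (H0 A) a b (cls a b 0 f)"
    unfolding iso_in_def cid
    by (intro conjI mem(1) bexI[OF _ mem(2)]) (simp_all add: ccmp_cls ob f g e)
qed

end

lemma (in dg_functor) hiso_fmor:
  assumes "a \<in> obj A" "b \<in> obj A" "hiso A a b f"
  shows "hiso B (fob F a) (fob F b) (fmor F a b 0 f)"
proof -
  from assms(3) obtain g \<alpha> \<beta> where g: "g \<in> hom A b a 0" "dif A b a 0 g = 0"
    "\<alpha> \<in> hom A a a (- 1)" "cmp A a b a 0 0 g f = idt A a + dif A a a (- 1) \<alpha>"
    "\<beta> \<in> hom A b b (- 1)" "cmp A b a b 0 0 f g = idt A b + dif A b b (- 1) \<beta>" by (rule hisoE)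
  note f = hiso_hom[OF assms(3)] hiso_closed[OF assms(3)]
  have "dif B (fob F a) (fob F b) 0 (fmor F a b 0 f) = 0" "dif B (fob F b) (fob F a) 0 (fmor F b a 0 g) = 0"
    using fmor_dif[of a b f 0] fmor_dif[of b a g 0] assms(1,2) f g(1,2) by simp_all
  moreover have "cmp B (fob F a) (fob F b) (fob F a) 0 0 (fmor F b a 0 g) (fmor F a b 0 f)
      = idt B (fob F a) + dif B (fob F a) (fob F a) (- 1) (fmor F a a (- 1) \<alpha>)"
    "cmp B (fob F b) (fob F a) (fob F b) 0 0 (fmor F a b 0 f) (fmor F b a 0 g)
      = idt B (fob F b) + dif B (fob F b) (fob F b) (- 1) (fmor F b b (- 1) \<beta>)"
    using fmor_cmp[of a b a g 0 f 0] fmor_cmp[of b a b f 0 g 0] assms(1,2) f g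
    by (simp_all add: fmor_simps)
  ultimately show ?thesis
    using assms(1,2) f g(1,3,5)
    by (intro hisoI[where g = "fmor F b a 0 g" and \<alpha> = "fmor F a a (- 1) \<alpha>" and \<beta> = "fmor F b b (- 1) \<beta>"]) auto
qed

section \<open>Homotopy equivalences in a gluing\<close>

context glue_data
begin

sublocale GC: dg_category G by (rule glue_dg_category)

text \<open>Subtracting the boundary of \<open>(\<alpha>, \<beta>, 0)\<close> leaves a unipotent \<open>(1, 1, m)\<close>, with inverse
  \<open>(1, 1, - m)\<close>.\<close>

lemma hiso_near_idt:
  assumes x: "x \<in> obj G" and e: "e \<in> hom G x x 0" "dif G x x 0 e = 0"
    and x_eq: "x = (a, b, \<mu>)"
    and \<alpha>: "\<alpha> \<in> hom A1 a a (- 1)" and \<beta>: "\<beta> \<in> hom A2 b b (- 1)"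
    and e_eq: "e = (idt A1 a + dif A1 a a (- 1) \<alpha>, idt A2 b + dif A2 b b (- 1) \<beta>, l)"
  shows "hiso G x x e"
proof -
  have ob: "a \<in> obj A1" "b \<in> obj A2" "\<mu> \<in> hom D (fob F1 a) (fob F2 b) 0" using x by (auto simp: x_eq)
  define c where "c = (\<alpha>, \<beta>, 0 :: 'r)"
  have c: "c \<in> hom G x x (- 1)" using \<alpha> \<beta> ob by (simp add: c_def x_eq)
  define u where "u = e - dif G x x (- 1) c"
  have u: "u \<in> hom G x x 0" "dif G x x 0 u = 0"
    using e c x by (simp_all add: u_def GC.dif_linear_simps)
  obtain m where u_eq: "u = (idt A1 a, idt A2 b, m)"
    by (simp add: u_def e_eq c_def x_eq)
  \<comment> \<open>With identities on the diagonal the two copies of \<mu> in the third entry of d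
    u cancel, so closedness of u becomes closedness of m.\<close>
  have m: "m \<in> hom D (fob F1 a) (fob F2 b) (- 1)" "dif D (fob F1 a) (fob F2 b) (- 1) m = 0"
    using u ob by (auto simp: u_eq x_eq zero_prod_def)
  define v where "v = (idt A1 a, idt A2 b, - m)"
  have v: "v \<in> hom G x x 0" "dif G x x 0 v = 0"
    using m ob by (auto simp: v_def x_eq zero_prod_def F1.cod.dif_linear_simps)
  have uv: "cmp G x x x 0 0 u v = idt G x" "cmp G x x x 0 0 v u = idt G x"
    using m ob by (auto simp: u_eq v_def x_eq)
  have e_u: "e = u + dif G x x (- 1) c" by (simp add: u_def)
  have "cmp G x x x 0 0 e v = idt G x + dif G x x (- 1) (cmp G x x x (- 1) 0 c v)"
    "cmp G x x x 0 0 v e = idt G x + dif G x x (- 1) (cmp G x x x 0 (- 1) v c)"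
    unfolding e_u using u v c x uv by (simp_all add: GC.cmp_linear_simps GC.leibniz')
  then show ?thesis
    using e v c x
    by (intro hisoI[where g = v and \<beta> = "cmp G x x x (- 1) 0 c v" and \<alpha> = "cmp G x x x 0 (- 1) v c"]) auto
qed

end

lemma (in dg_category) cmp_closed:
  assumes "a \<in> obj A" "b \<in> obj A" "c \<in> obj A" "g \<in> hom A b c j" "f \<in> hom A a b i" "n = j + i"
    and "dif A b c j g = 0" "dif A a b i f = 0"
  shows "dif A a c n (cmp A a b c j i g f) = 0"
  using assms by (simp add: leibniz')

context glue_data
begin

text \<open>A pair (f', g') extends to a closed morphism exactly when g' \<xi> - \<mu> f' is a
  boundary. The entry h says that g \<mu> and \<xi> f are homotopic; multiplying by g' on the left
  and f' on the right and cancelling g' g and f f' up to homotopy gives the required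
  statement.\<close>

lemma glue_quasi_inverse:
  assumes xy: "(a, b, \<mu>) \<in> obj G" "(c, d, \<xi>) \<in> obj G"
    and fgh: "(f, g, h) \<in> hom G (a, b, \<mu>) (c, d, \<xi>) 0" "dif G (a, b, \<mu>) (c, d, \<xi>) 0 (f, g, h) = 0"
    and f': "f' \<in> hom A1 c a 0" "dif A1 c a 0 f' = 0"
    and \<alpha>: "\<alpha> \<in> hom A1 c c (- 1)" "cmp A1 c a c 0 0 f f' = idt A1 c + dif A1 c c (- 1) \<alpha>"
    and g': "g' \<in> hom A2 d b 0" "dif A2 d b 0 g' = 0"
    and \<beta>: "\<beta> \<in> hom A2 b b (- 1)" "cmp A2 b d b 0 0 g' g = idt A2 b + dif A2 b b (- 1) \<beta>"
  shows "\<exists>h'. (f', g', h') \<in> hom G (c, d, \<xi>) (a, b, \<mu>) 0 \<and> dif G (c, d, \<xi>) (a, b, \<mu>) 0 (f', g', h') = 0"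
proof -
  let ?a = "fob F1 a" and ?b = "fob F2 b" and ?c = "fob F1 c" and ?d = "fob F2 d"
  let ?f' = "fmor F1 c a 0 f'" and ?g' = "fmor F2 d b 0 g'" and ?f = "fmor F1 a c 0 f" and ?g = "fmor F2 b d 0 g"
  let ?\<alpha> = "fmor F1 c c (- 1) \<alpha>" and ?\<beta> = "fmor F2 b b (- 1) \<beta>"
  have ob: "a \<in> obj A1" "b \<in> obj A2" "c \<in> obj A1" "d \<in> obj A2"
    and \<mu>: "\<mu> \<in> hom D ?a ?b 0" "dif D ?a ?b 0 \<mu> = 0" and \<xi>: "\<xi> \<in> hom D ?c ?d 0" "dif D ?c ?d 0 \<xi> = 0"
    using xy by auto
  have f: "f \<in> hom A1 a c 0" "dif A1 a c 0 f = 0" and g: "g \<in> hom A2 b d 0" "dif A2 b d 0 g = 0"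
    and h: "h \<in> hom D ?a ?d (- 1)"
    and dh: "dif D ?a ?d (- 1) h = cmp D ?a ?b ?d 0 0 ?g \<mu> - cmp D ?a ?c ?d 0 0 \<xi> ?f"
    using fgh by (auto simp: zero_prod_def algebra_simps)
  have dF: "dif D ?a ?c 0 ?f = 0" "dif D ?c ?a 0 ?f' = 0" "dif D ?b ?d 0 ?g = 0" "dif D ?d ?b 0 ?g' = 0"
    using F1.fmor_dif[of a c f 0] F1.fmor_dif[of c a f' 0] F2.fmor_dif[of b d g 0] F2.fmor_dif[of d b g' 0]
      ob f f' g g' by simp_all
  have F\<alpha>: "cmp D ?c ?a ?c 0 0 ?f ?f' = idt D ?c + dif D ?c ?c (- 1) ?\<alpha>"
    using F1.fmor_cmp[of c a c f 0 f' 0] ob f f' \<alpha> by (simp add: F1.fmor_simps)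
  have F\<beta>: "cmp D ?b ?d ?b 0 0 ?g' ?g = idt D ?b + dif D ?b ?b (- 1) ?\<beta>"
    using F2.fmor_cmp[of b d b g' 0 g 0] ob g g' \<beta> by (simp add: F2.fmor_simps)
  \<comment> \<open>The boundaries are d u = g' \<xi> (f f' - 1), d v = (g' g - 1) \<mu> f' and d w
    = g' (g \<mu> - \<xi> f) f', with F1 and F2 suppressed. In v - u - w the long composites cancel
    and g' \<xi> - \<mu> f' remains.\<close>
  define u where "u = cmp D ?c ?d ?b 0 (- 1) ?g' (cmp D ?c ?c ?d 0 (- 1) \<xi> ?\<alpha>)"
  define v where "v = cmp D ?c ?b ?b (- 1) 0 ?\<beta> (cmp D ?c ?a ?b 0 0 \<mu> ?f')"
  define w where "w = cmp D ?c ?d ?b 0 (- 1) ?g' (cmp D ?c ?a ?d (- 1) 0 h ?f')"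
  note mem = ob f(1) g(1) f'(1) g'(1) \<alpha>(1) \<beta>(1) \<mu>(1) \<xi>(1) h
  have uvw: "u \<in> hom D ?c ?b (- 1)" "v \<in> hom D ?c ?b (- 1)" "w \<in> hom D ?c ?b (- 1)"
    unfolding u_def v_def w_def by (simp_all add: mem)
  have du: "dif D ?c ?b (- 1) u = cmp D ?c ?d ?b 0 0 ?g' (cmp D ?c ?c ?d 0 0 \<xi> (dif D ?c ?c (- 1) ?\<alpha>))"
    unfolding u_def by (simp add: mem F1.cod.leibniz' dF \<xi>)
  have dv: "dif D ?c ?b (- 1) v = cmp D ?c ?b ?b 0 0 (dif D ?b ?b (- 1) ?\<beta>) (cmp D ?c ?a ?b 0 0 \<mu> ?f')"
    unfolding v_def by (simp add: mem F1.cod.leibniz' dF \<mu>)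
  have dw: "dif D ?c ?b (- 1) w = cmp D ?c ?d ?b 0 0 ?g' (cmp D ?c ?a ?d 0 0 (dif D ?a ?d (- 1) h) ?f')"
    unfolding w_def by (simp add: mem F1.cod.leibniz' dF)
  have "cmp D ?c ?d ?b 0 0 ?g' (cmp D ?c ?c ?d 0 0 \<xi> (cmp D ?c ?a ?c 0 0 ?f ?f'))
      = cmp D ?c ?d ?b 0 0 ?g' \<xi> + dif D ?c ?b (- 1) u"
    unfolding F\<alpha> du by (simp add: mem F1.cod.cmp_linear_simps)
  moreover have "cmp D ?c ?b ?b 0 0 (cmp D ?b ?d ?b 0 0 ?g' ?g) (cmp D ?c ?a ?b 0 0 \<mu> ?f')
      = cmp D ?c ?a ?b 0 0 \<mu> ?f' + dif D ?c ?b (- 1) v"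
    unfolding F\<beta> dv by (simp add: mem F1.cod.cmp_linear_simps)
  moreover have "dif D ?c ?b (- 1) w = cmp D ?c ?b ?b 0 0 (cmp D ?b ?d ?b 0 0 ?g' ?g) (cmp D ?c ?a ?b 0 0 \<mu> ?f')
      - cmp D ?c ?d ?b 0 0 ?g' (cmp D ?c ?c ?d 0 0 \<xi> (cmp D ?c ?a ?c 0 0 ?f ?f'))"
    unfolding dw dh by (simp add: mem F1.cod.cmp_linear_simps F1.cod.cmp_assoc')
  ultimately have "dif D ?c ?b (- 1) (v - u - w) = cmp D ?c ?d ?b 0 0 ?g' \<xi> - cmp D ?c ?a ?b 0 0 \<mu> ?f'"
    using uvw by (simp add: F1.cod.dif_linear_simps mem algebra_simps)
  then show ?thesis
    using uvw f' g' by (intro exI[of _ "v - u - w"]) (simp add: zero_prod_def mem)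
qed

text \<open>The closed morphism from \<open>glue_quasi_inverse\<close> composes with (f, g, h) to
  endomorphisms whose diagonal entries are homotopic to identities but whose third entries are
  uncontrolled. They are still invertible by \<open>hiso_near_idt\<close>, and
  \<open>hiso_two_of_six\<close> concludes.\<close>

lemma hiso_glue:
  assumes xy: "(a, b, \<mu>) \<in> obj G" "(c, d, \<xi>) \<in> obj G"
    and fgh: "(f, g, h) \<in> hom G (a, b, \<mu>) (c, d, \<xi>) 0" "dif G (a, b, \<mu>) (c, d, \<xi>) 0 (f, g, h) = 0"
    and "hiso A1 a c f" "hiso A2 b d g"
  shows "hiso G (a, b, \<mu>) (c, d, \<xi>) (f, g, h)"
proof -
  obtain f' \<alpha>' \<alpha> where f': "f' \<in> hom A1 c a 0" "dif A1 c a 0 f' = 0"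
    and \<alpha>': "\<alpha>' \<in> hom A1 a a (- 1)" "cmp A1 a c a 0 0 f' f = idt A1 a + dif A1 a a (- 1) \<alpha>'"
    and \<alpha>: "\<alpha> \<in> hom A1 c c (- 1)" "cmp A1 c a c 0 0 f f' = idt A1 c + dif A1 c c (- 1) \<alpha>"
    using \<open>hiso A1 a c f\<close> by (rule hisoE)
  obtain g' \<beta> \<beta>' where g': "g' \<in> hom A2 d b 0" "dif A2 d b 0 g' = 0"
    and \<beta>: "\<beta> \<in> hom A2 b b (- 1)" "cmp A2 b d b 0 0 g' g = idt A2 b + dif A2 b b (- 1) \<beta>"
    and \<beta>': "\<beta>' \<in> hom A2 d d (- 1)" "cmp A2 d b d 0 0 g g' = idt A2 d + dif A2 d d (- 1) \<beta>'"
    using \<open>hiso A2 b d g\<close> by (rule hisoE)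
  obtain h' where h': "(f', g', h') \<in> hom G (c, d, \<xi>) (a, b, \<mu>) 0"
    "dif G (c, d, \<xi>) (a, b, \<mu>) 0 (f', g', h') = 0"
    using glue_quasi_inverse[OF xy fgh f' \<alpha> g' \<beta>] by blast
  obtain l where l: "cmp G (c, d, \<xi>) (a, b, \<mu>) (c, d, \<xi>) 0 0 (f, g, h) (f', g', h')
      = (idt A1 c + dif A1 c c (- 1) \<alpha>, idt A2 d + dif A2 d d (- 1) \<beta>', l)"
    by (simp add: \<alpha> \<beta>')
  obtain l' where l': "cmp G (a, b, \<mu>) (c, d, \<xi>) (a, b, \<mu>) 0 0 (f', g', h') (f, g, h)
      = (idt A1 a + dif A1 a a (- 1) \<alpha>', idt A2 b + dif A2 b b (- 1) \<beta>, l')"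
    by (simp add: \<alpha>' \<beta>)
  have "hiso G (c, d, \<xi>) (c, d, \<xi>) (cmp G (c, d, \<xi>) (a, b, \<mu>) (c, d, \<xi>) 0 0 (f, g, h) (f', g', h'))"
  proof (rule hiso_near_idt[OF xy(2) _ _ refl \<alpha>(1) \<beta>'(1) l])
    show "cmp G (c, d, \<xi>) (a, b, \<mu>) (c, d, \<xi>) 0 0 (f, g, h) (f', g', h') \<in> hom G (c, d, \<xi>) (c, d, \<xi>) 0"
      by (rule GC.cmp_hom'[OF xy(2,1,2) fgh(1) h'(1)]) simp
    show "dif G (c, d, \<xi>) (c, d, \<xi>) 0 (cmp G (c, d, \<xi>) (a, b, \<mu>) (c, d, \<xi>) 0 0 (f, g, h) (f', g', h')) = 0"
      by (rule GC.cmp_closed[OF xy(2,1,2) fgh(1) h'(1) _ fgh(2) h'(2)]) simp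
  qed
  moreover have "hiso G (a, b, \<mu>) (a, b, \<mu>) (cmp G (a, b, \<mu>) (c, d, \<xi>) (a, b, \<mu>) 0 0 (f', g', h') (f, g, h))"
  proof (rule hiso_near_idt[OF xy(1) _ _ refl \<alpha>'(1) \<beta>(1) l'])
    show "cmp G (a, b, \<mu>) (c, d, \<xi>) (a, b, \<mu>) 0 0 (f', g', h') (f, g, h) \<in> hom G (a, b, \<mu>) (a, b, \<mu>) 0"
      by (rule GC.cmp_hom'[OF xy(1,2,1) h'(1) fgh(1)]) simp
    show "dif G (a, b, \<mu>) (a, b, \<mu>) 0 (cmp G (a, b, \<mu>) (c, d, \<xi>) (a, b, \<mu>) 0 0 (f', g', h') (f, g, h)) = 0"
      by (rule GC.cmp_closed[OF xy(1,2,1) h'(1) fgh(1) _ h'(2) fgh(2)]) simp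
  qed
  ultimately show ?thesis
    by (rule GC.hiso_two_of_six[OF xy fgh h'])
qed

end

section \<open>Functors into a homotopy fiber product with strictly commuting components\<close>

definition strict_pair ::
  "('q, 'r::zero, 'k) dgcat \<Rightarrow> ('p, 'n, 'q, 'r) dgfun \<Rightarrow> ('o, 'm, 'p, 'n) dgfun \<Rightarrow> ('o, 'm, 's, 't) dgfun \<Rightarrow>
   ('o, 'm, 'p \<times> 's \<times> 'r, 'n \<times> 't \<times> 'r) dgfun" where
  "strict_pair D G1 P R = \<lparr>fob = (\<lambda>x. (fob P x, fob R x, idt D (fob G1 (fob P x)))),
     fmor = (\<lambda>x y i f. (fmor P x y i f, fmor R x y i f, 0))\<rparr>"

lemma strict_pair_simps [simp]:
  "fob (strict_pair D G1 P R) x = (fob P x, fob R x, idt D (fob G1 (fob P x)))"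
  "fmor (strict_pair D G1 P R) x y i f = (fmor P x y i f, fmor R x y i f, 0)"
  by (simp_all add: strict_pair_def)

text \<open>Between objects glued by identities, the third entry of the differential of (P u, R u,
  0) is F2 R u - F1 P u, which vanishes as the two composites agree on the nose.\<close>

lemma (in glue_data) strict_pair_dg_functor:
  assumes P: "dg_functor X A1 P" and R: "dg_functor X A2 R" and eq: "fun_eq_on X (F1 \<circ>\<circ> P) (F2 \<circ>\<circ> R)"
  shows "dg_functor X H (strict_pair D F1 P R)"
proof -
  interpret P: dg_functor X A1 P by fact
  interpret R: dg_functor X A2 R by fact
  have eo: "fob F2 (fob R x) = fob F1 (fob P x)" if "x \<in> obj X" for x
    using eq that by (simp add: fun_eq_on_def)
  have em: "fmor F2 (fob R x) (fob R y) i (fmor R x y i f) = fmor F1 (fob P x) (fob P y) i (fmor P x y i f)"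
    if "x \<in> obj X" "y \<in> obj X" "f \<in> hom X x y i" for x y i f
    using eq that by (simp add: fun_eq_on_def)
  show ?thesis
  proof (rule dg_functorI)
    fix x assume x: "x \<in> obj X"
    then have "hiso D (fob F1 (fob P x)) (fob F1 (fob P x)) (idt D (fob F1 (fob P x)))"
      by (intro F1.cod.hiso_idt) simp
    then show "fob (strict_pair D F1 P R) x \<in> obj H"
      using x F1.cod.iso_in_H0_iff[of "fob F1 (fob P x)" "fob F1 (fob P x)" "idt D (fob F1 (fob P x))"]
      by (auto intro!: hfib_objI simp: eo F1.cod.cls_def)
  next
    fix x y g z j f i assume "x \<in> obj X" "y \<in> obj X" "z \<in> obj X" "g \<in> hom X y z j" "f \<in> hom X x y i"
    then show "fmor (strict_pair D F1 P R) x z (j + i) (cmp X x y z j i g f) =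
       cmp H (fob (strict_pair D F1 P R) x) (fob (strict_pair D F1 P R) y) (fob (strict_pair D F1 P R) z) j i
         (fmor (strict_pair D F1 P R) y z j g) (fmor (strict_pair D F1 P R) x y i f)"
      by (simp add: P.fmor_cmp R.fmor_cmp eo F1.cod.cmp_0_left em[symmetric] del: F1.cod.cmp_0_right)
        (simp add: em eo)
  next
    fix x y f i assume "x \<in> obj X" "y \<in> obj X" "f \<in> hom X x y i"
    then show "fmor (strict_pair D F1 P R) x y (i + 1) (dif X x y i f) =
       dif H (fob (strict_pair D F1 P R) x) (fob (strict_pair D F1 P R) y) i (fmor (strict_pair D F1 P R) x y i f)"
      by (simp add: P.fmor_dif R.fmor_dif eo em)
  qed (auto simp: eo hfib_dg_category P.dom.dg_category_axioms P.fmor_simps R.fmor_simps intro!: linear_onI)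
qed

section \<open>Relabelling\<close>

text \<open>The encoding \<open>em\<close> need not be onto, so the scaling \<open>s\<close> is a
  structure on the whole space of codes, tied to that of \<open>A\<close> only on the image.\<close>

locale relabel_data = A: dg_category A
  for A :: "('o, 'm::ab_group_add, 'k::field_char_0) dgcat" +
  fixes eo :: "'o \<Rightarrow> 'p" and em :: "'m \<Rightarrow> 'n::ab_group_add" and s :: "'k \<Rightarrow> 'n \<Rightarrow> 'n"
  assumes inj_eo: "inj eo" and inj_em: "inj em" and em_add: "em (x + y) = em x + em y"
    and s_vector_space: "vector_space s" and s_em: "s c (em x) = em (scl A c x)"
begin

abbreviation "L \<equiv> relabel eo em s A"

lemma inv_eo [simp]: "inv eo (eo x) = x" and inv_em [simp]: "inv em (em f) = f"
  using inj_eo inj_em by auto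

lemma em_0 [simp]: "em 0 = 0"
  using em_add[of 0 0] by simp

lemma em_uminus: "em (- x) = - em x"
  using em_add[of x "- x"] by (simp add: eq_neg_iff_add_eq_0 add.commute)

lemma em_sg: "em (sg i x) = sg i (em x)"
  by (simp add: sg_def em_uminus)

lemma relabel_simps [simp]:
  "obj L = eo ` obj A" "scl L = s"
  "hom L (eo a) (eo b) i = em ` hom A a b i"
  "dif L (eo a) (eo b) i (em f) = em (dif A a b i f)"
  "cmp L (eo a) (eo b) (eo c) j i (em g) (em f) = em (cmp A a b c j i g f)"
  "idt L (eo a) = em (idt A a)"
  by (simp_all add: relabel_def)

lemmas expand = A.dif_linear_simps A.cmp_linear_simps em_add[symmetric] s_em em_sg[symmetric]
  A.cmp_assoc' A.leibniz'

lemma relabel_dg_category: "dg_category L"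
proof (rule dg_category.intro)
  show "vector_space (scl L)" by (simp add: s_vector_space)
next
  fix a b i assume "a \<in> obj L" "b \<in> obj L"
  moreover have "0 \<in> em ` hom A a b i" if "a \<in> obj A" "b \<in> obj A" for a b
    using that by (intro image_eqI[of _ _ 0]) auto
  ultimately show "module.subspace (scl L) (hom L a b i)"
    by (auto simp: module.subspace_def[OF module_scl_of_vector_space[OF s_vector_space]] expand)
next
  fix a b c d h l g j f i 
  assume "a \<in> obj L" "b \<in> obj L" "c \<in> obj L" "d \<in> obj L" "h \<in> hom L c d l" "g \<in> hom L b c j" "f \<in> hom L a b i"
  then show "cmp L a b d (l + j) i (cmp L b c d l j h g) f = cmp L a c d l (j + i) h (cmp L a b c j i g f)"
    by (auto simp: expand)
qed (auto simp: expand intro!: linear_onI)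

lemma embed_dg_functor: "dg_functor A L \<lparr>fob = eo, fmor = (\<lambda>a b i. em)\<rparr>"
  by (rule dg_functorI) (auto simp: A.dg_category_axioms relabel_dg_category expand intro!: linear_onI)

lemma relabel_fun_simps [simp]:
  "fob (relabel_fun eo em F) (eo a) = fob F a"
  "fmor (relabel_fun eo em F) (eo a) (eo b) i (em f) = fmor F a b i f"
  by (simp_all add: relabel_fun_def)

lemma relabel_fun_dg_functor:
  assumes "dg_functor A B F" shows "dg_functor L B (relabel_fun eo em F)"
proof -
  interpret F: dg_functor A B F by fact
  show ?thesis
    by (rule dg_functorI)
      (auto simp: F.cod.dg_category_axioms relabel_dg_category expand F.fmor_simps intro!: linear_onI)
qed

end

lemma inj_next_ob: "inj next_ob"
  by (auto simp: inj_def next_ob_def)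

lemma inj_First: "inj First"
  by (auto simp: inj_def)

lemma inj_first_mor: "inj first_mor"
  by (auto simp: inj_def first_mor_def fun_eq_iff split: nat.splits dest: spec[of _ 0])

lemma inj_next_mor: "inj next_mor"
proof (rule injI)
  fix x y :: "('a, 'b) itmor \<times> 'a \<times> 'b" assume "next_mor x = next_mor y"
  then have *: "next_mor x n = next_mor y n" for n by simp
  obtain u g h u' g' h' where "x = (u, g, h)" "y = (u', g', h')" by (cases x; cases y) auto
  then show "x = y" using *[of 0] *[of "Suc _"] by (auto simp: next_mor_def fun_eq_iff)
qed

text \<open>Surjectivity makes \<open>inv next_mor\<close> a two-sided inverse and hence additive;
  the scaling of \<open>next_cat\<close>, transported along it, is then a vector space structure on
  all codes.\<close>

lemma surj_next_mor: "surj next_mor"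
proof (rule surjI)
  fix u :: "('a, 'b) itmor"
  show "next_mor (\<lambda>n. u (Suc n), fst (u 0), snd (u 0)) = u"
    by (auto simp: next_mor_def fun_eq_iff split: nat.splits)
qed

lemma first_mor_add: "first_mor (f + g) = (first_mor f + first_mor g :: ('m::ab_group_add, 'r::ab_group_add) itmor)"
  by (auto simp: first_mor_def fun_eq_iff zero_prod_def split: nat.splits)

lemma next_mor_add: "next_mor (x + y) = (next_mor x + next_mor y :: ('m::ab_group_add, 'r::ab_group_add) itmor)"
  by (cases x; cases y) (auto simp: next_mor_def fun_eq_iff split: nat.splits)

lemma first_cat_relabel_data:
  assumes "dg_category A" "dg_category D"
  shows "relabel_data A First first_mor (\<lambda>x u n. (scl A x (fst (u n)), scl D x (snd (u n))))"
proof -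
  interpret A: dg_category A by fact
  interpret D: dg_category D by fact
  interpret v1: vector_space "scl A" by (rule A.scl_vector_space)
  interpret v2: vector_space "scl D" by (rule D.scl_vector_space)
  have "vector_space (\<lambda>x u n. (scl A x (fst (u n)), scl D x (snd (u n))))"
    by standard (auto simp: fun_eq_iff v1.scale_right_distrib v2.scale_right_distrib
      v1.scale_left_distrib v2.scale_left_distrib)
  then show ?thesis
    by (intro relabel_data.intro relabel_data_axioms.intro assms)
      (auto simp: inj_First inj_first_mor first_mor_add first_mor_def fun_eq_iff split: nat.splits)
qed

lemma next_cat_relabel_data:
  fixes A :: "(('o, 'r) itob \<times> 'o \<times> 'r, ('m::ab_group_add, 'r::ab_group_add) itmor \<times> 'm \<times> 'r, 'k::field_char_0) dgcat"
  assumes "dg_category A"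
  shows "relabel_data A next_ob next_mor (\<lambda>x u. next_mor (scl A x (inv next_mor u)))"
proof -
  interpret A: dg_category A by fact
  interpret v: vector_space "scl A" by (rule A.scl_vector_space)
  have inv: "inv next_mor (u + v) = inv next_mor u + inv next_mor v" for u v :: "('m, 'r) itmor"
    using surj_f_inv_f[OF surj_next_mor] inv_f_f[OF inj_next_mor] by (metis next_mor_add)
  have "vector_space (\<lambda>x u. next_mor (scl A x (inv next_mor u)))"
    by standard (simp_all add: inv next_mor_add[symmetric] v.scale_right_distrib v.scale_left_distrib
      inv_f_f[OF inj_next_mor] surj_f_inv_f[OF surj_next_mor])
  then show ?thesis
    by (intro relabel_data.intro relabel_data_axioms.intro assms)
      (auto simp: inj_next_ob inj_next_mor next_mor_add inv_f_f[OF inj_next_mor])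
qed

section \<open>Products\<close>

locale prod_data =
  fixes I :: "nat set" and B :: "nat \<Rightarrow> ('o, 'm::ab_group_add, 'k::field_char_0) dgcat"
  assumes I_ne: "I \<noteq> {}" and B_cat: "\<And>i. i \<in> I \<Longrightarrow> dg_category (B i)"
begin

abbreviation "P \<equiv> prod_cat I B"

lemma prod_simps [simp]:
  "obj P = Pi\<^sub>E I (\<lambda>i. obj (B i))"
  "hom P x y n = {f. (\<forall>i\<in>I. f i \<in> hom (B i) (x i) (y i) n) \<and> (\<forall>i. i \<notin> I \<longrightarrow> f i = 0)}"
  "dif P x y n f i = (if i \<in> I then dif (B i) (x i) (y i) n (f i) else 0)"
  "cmp P x y z n l g f i = (if i \<in> I then cmp (B i) (x i) (y i) (z i) n l (g i) (f i) else 0)"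
  "idt P x i = (if i \<in> I then idt (B i) (x i) else 0)"
  by (simp_all add: prod_cat_def)

lemma prod_scl [simp]: "i \<in> I \<Longrightarrow> scl P c f i = scl (B i) c (f i)"
  by (simp add: prod_cat_def)

text \<open>Components outside \<open>I\<close> are scaled as in an arbitrarily chosen factor. With
  \<open>I\<close> nonempty that factor is a dg category, so the vector space axioms hold for all
  functions and not only for those supported on \<open>I\<close>.\<close>

lemma index_mem: "(if i \<in> I then i else (SOME j. j \<in> I)) \<in> I"
  using I_ne by (auto simp: some_in_eq)

lemma prod_vector_space: "vector_space (scl P)"
proof -
  have v: "vector_space (scl (B (if i \<in> I then i else (SOME j. j \<in> I))))" for i
    using B_cat[OF index_mem] by (rule dg_category.scl_vector_space)
  show ?thesis
    unfolding vector_space_def prod_cat_def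
    using v by (simp add: vector_space_def fun_eq_iff)
qed

lemma prod_scl_0 [simp]: "i \<notin> I \<Longrightarrow> f i = 0 \<Longrightarrow> scl P c f i = 0"
  using dg_category.scl_0[OF B_cat[OF index_mem, of i]] by (simp add: prod_cat_def)

lemma prod_dg_category: "dg_category P"
proof -
  have ob: "x i \<in> obj (B i)" if "i \<in> I" "x \<in> Pi\<^sub>E I (\<lambda>i. obj (B i))" for x i
    using that by auto
  note c = B_cat
  note mems = ob c[THEN dg_category.hom_0] c[THEN dg_category.hom_add] c[THEN dg_category.hom_scl]
    c[THEN dg_category.dif_hom'] c[THEN dg_category.cmp_hom'] c[THEN dg_category.dif_add]
    c[THEN dg_category.dif_scl] c[THEN dg_category.cmp_add_left] c[THEN dg_category.cmp_add_right]
    c[THEN dg_category.cmp_scl_left] c[THEN dg_category.cmp_scl_right]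
  show ?thesis
  proof (rule dg_category.intro)
    show "vector_space (scl P)" by (rule prod_vector_space)
  next
    fix a b i assume "a \<in> obj P" "b \<in> obj P"
    then show "module.subspace (scl P) (hom P a b i)"
      by (auto simp: module.subspace_def[OF module_scl_of_vector_space[OF prod_vector_space]] mems)
  next
    fix a b c g j f i assume "a \<in> obj P" "b \<in> obj P" "c \<in> obj P" "g \<in> hom P b c j" "f \<in> hom P a b i"
    then show "dif P a c (j + i) (cmp P a b c j i g f) =
          cmp P a b c (j + 1) i (dif P b c j g) f + sg j (cmp P a b c j (i + 1) g (dif P a b i f))"
      by (auto simp: fun_eq_iff mems c[THEN dg_category.leibniz] sg_def)
  qed (auto simp: fun_eq_iff mems c[THEN dg_category.cmp_assoc] c[THEN dg_category.dif_dif]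
    c[THEN dg_category.idt_hom] c[THEN dg_category.dif_idt] c[THEN dg_category.idt_left]
    c[THEN dg_category.idt_right] intro!: linear_onI)
qed

lemma tuple_simps [simp]:
  "i \<in> I \<Longrightarrow> fob (tuple_fun I F) x i = fob (F i) x"
  "fob (tuple_fun I F) x = (\<lambda>i\<in>I. fob (F i) x)"
  "fmor (tuple_fun I F) x y n f i = (if i \<in> I then fmor (F i) x y n f else 0)"
  by (simp_all add: tuple_fun_def)

lemma tuple_dg_functor:
  assumes X: "dg_category X" and F: "\<And>i. i \<in> I \<Longrightarrow> dg_functor X (B i) (F i)"
  shows "dg_functor X P (tuple_fun I F)"
  by (rule dg_functorI[OF X prod_dg_category])
    (auto simp: fun_eq_iff F[THEN dg_functor.fob_obj] F[THEN dg_functor.fmor_hom]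
      F[THEN dg_functor.fmor_dif] F[THEN dg_functor.fmor_cmp] F[THEN dg_functor.fmor_idt]
      F[THEN dg_functor.fmor_add] F[THEN dg_functor.fmor_scl] intro!: linear_onI)

definition coord :: "nat \<Rightarrow> (nat \<Rightarrow> 'o, nat \<Rightarrow> 'm, 'o, 'm) dgfun" where
  "coord i = \<lparr>fob = (\<lambda>x. x i), fmor = (\<lambda>x y n f. f i)\<rparr>"

lemma coord_simps [simp]: "fob (coord i) x = x i" "fmor (coord i) x y n f = f i"
  by (simp_all add: coord_def)

lemma coord_dg_functor: "i \<in> I \<Longrightarrow> dg_functor P (B i) (coord i)"
  by (rule dg_functorI) (auto simp: prod_dg_category B_cat PiE_mem intro!: linear_onI)

lemma prod_fun_eq_tuple: "prod_fun I F = tuple_fun I (\<lambda>i. F i \<circ>\<circ> coord i)"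
  by (simp add: prod_fun_def tuple_fun_def fun_eq_iff)

lemma prod_fun_dg_functor:
  assumes "prod_data I B'" and "\<And>i. i \<in> I \<Longrightarrow> dg_functor (B i) (B' i) (F i)"
  shows "dg_functor P (prod_cat I B') (prod_fun I F)"
  unfolding prod_fun_eq_tuple
  by (rule prod_data.tuple_dg_functor[OF assms(1) prod_dg_category])
    (rule dg_functor_comp[OF coord_dg_functor assms(2)])

end

section \<open>A criterion for quasi-isomorphisms\<close>

text \<open>The premise \<open>acyclic\<close> says that the cokernel of the map of complexes has no
  cohomology: an element whose differential lies in the image is a boundary modulo the image. With
  injectivity this is the long exact sequence argument, carried out on elements.\<close>

lemma (in dg_functor) quasi_iso_fmor:
  assumes ob: "a \<in> obj A" "b \<in> obj A"
    and inj: "\<And>i f. f \<in> hom A a b i \<Longrightarrow> fmor F a b i f = 0 \<Longrightarrow> f = 0"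
    and acyclic: "\<And>i z. z \<in> hom B (fob F a) (fob F b) i \<Longrightarrow>
      dif B (fob F a) (fob F b) i z \<in> fmor F a b (i + 1) ` hom A a b (i + 1) \<Longrightarrow>
      \<exists>w\<in>hom A a b i. \<exists>u\<in>hom B (fob F a) (fob F b) (i - 1). z = fmor F a b i w + dif B (fob F a) (fob F b) (i - 1) u"
  shows "quasi_iso (hom A a b) (dif A a b) (hom B (fob F a) (fob F b)) (dif B (fob F a) (fob F b)) (fmor F a b)"
  unfolding quasi_iso_def
proof
  fix i
  let ?c = "dom.cls a b i" and ?c' = "cod.cls (fob F a) (fob F b) i"
  let ?\<phi> = "\<lambda>X. \<Union>x\<in>X. cclass (hom B (fob F a) (fob F b)) (dif B (fob F a) (fob F b)) i (fmor F a b i x)"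
  note cod_eq = cod.cls_eq_iff[OF fob_obj[OF ob(1)] fob_obj[OF ob(2)]]
  have \<phi>: "?\<phi> (?c z) = ?c' (fmor F a b i z)" if z: "z \<in> hom A a b i" for z
  proof -
    have "?c' (fmor F a b i z') = ?c' (fmor F a b i z)" if z': "z' \<in> ?c z" for z'
    proof -
      obtain v where v: "v \<in> hom A a b (i - 1)" "z' = z + dif A a b (i - 1) v"
        using dom.mem_clsD[OF z'] by auto
      have "fmor F a b i z' = fmor F a b i z + dif B (fob F a) (fob F b) (i - 1) (fmor F a b (i - 1) v)"
        unfolding v(2) using v(1) z ob by (simp add: fmor_simps)
      then show ?thesis unfolding cod_eq using v(1) ob by (auto intro: fmor_hom)
    qed
    then have "?\<phi> (?c z) = (\<Union>x\<in>?c z. ?c' (fmor F a b i z))"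
      unfolding cod.cls_def by (intro SUP_cong refl)
    then show ?thesis using dom.cls_self[OF ob, of z i] by auto
  qed
  show "bij_betw ?\<phi> (cohomology (hom A a b) (dif A a b) i)
      (cohomology (hom B (fob F a) (fob F b)) (dif B (fob F a) (fob F b)) i)"
    unfolding bij_betw_def
  proof
    show "inj_on ?\<phi> (cohomology (hom A a b) (dif A a b) i)"
    proof (rule inj_onI)
      fix X Y assume "X \<in> cohomology (hom A a b) (dif A a b) i" "Y \<in> cohomology (hom A a b) (dif A a b) i"
        and eq: "?\<phi> X = ?\<phi> Y"
      then obtain x y where x: "x \<in> hom A a b i" "dif A a b i x = 0" "X = ?c x"
        and y: "y \<in> hom A a b i" "dif A a b i y = 0" "Y = ?c y"
        by (auto simp: cohomology_def cocycles_def dom.cls_def)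
      have "?c' (fmor F a b i x) = ?c' (fmor F a b i y)"
        using eq \<phi>[OF x(1)] \<phi>[OF y(1)] by (simp add: x(3) y(3))
      then obtain z where z: "z \<in> hom B (fob F a) (fob F b) (i - 1)"
        "fmor F a b i x = fmor F a b i y + dif B (fob F a) (fob F b) (i - 1) z"
        by (auto simp: cod_eq)
      \<comment> \<open>The element z that identifies the two images is a cocycle of the cokernel in
        degree \<open>i - 1\<close>. Writing it as F w plus a boundary gives F(x - y) = F(d w), and
        injectivity yields x - y = d w.\<close>
      then have "dif B (fob F a) (fob F b) (i - 1) z = fmor F a b i (x - y)"
        using x y ob by (simp add: fmor_simps)
      then obtain w u where w: "w \<in> hom A a b (i - 1)" "u \<in> hom B (fob F a) (fob F b) (i - 1 - 1)"
        "z = fmor F a b (i - 1) w + dif B (fob F a) (fob F b) (i - 1 - 1) u"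
        using acyclic[OF z(1)] x y ob by auto
      have "fmor F a b i (x - y - dif A a b (i - 1) w) = 0"
        using x(1) y(1) w(1,2) ob z(2)
        by (simp add: fmor_simps w(3) cod.dif_linear_simps)
      then have "x - y - dif A a b (i - 1) w = 0"
        by (intro inj[of _ i]) (use x(1) y(1) w(1) ob in auto)
      then show "X = Y"
        unfolding x(3) y(3) dom.cls_eq_iff[OF ob] using w(1) by (auto simp: algebra_simps)
    qed
    show "?\<phi> ` cohomology (hom A a b) (dif A a b) i =
      cohomology (hom B (fob F a) (fob F b)) (dif B (fob F a) (fob F b)) i"
    proof (intro equalityI subsetI)
      fix Y assume "Y \<in> ?\<phi> ` cohomology (hom A a b) (dif A a b) i"
      then obtain x where x: "x \<in> hom A a b i" "dif A a b i x = 0" "Y = ?\<phi> (?c x)"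
        by (auto simp: cohomology_def cocycles_def dom.cls_def)
      have "dif B (fob F a) (fob F b) i (fmor F a b i x) = 0"
        using fmor_dif[of a b x i] x ob by simp
      then show "Y \<in> cohomology (hom B (fob F a) (fob F b)) (dif B (fob F a) (fob F b)) i"
        unfolding x(3) \<phi>[OF x(1)] using x(1) ob by (auto simp: cohomology_def cocycles_def cod.cls_def)
    next
      fix Y assume "Y \<in> cohomology (hom B (fob F a) (fob F b)) (dif B (fob F a) (fob F b)) i"
      then obtain z where z: "z \<in> hom B (fob F a) (fob F b) i" "dif B (fob F a) (fob F b) i z = 0" "Y = ?c' z"
        by (auto simp: cohomology_def cocycles_def cod.cls_def)
      \<comment> \<open>A cocycle z is in particular a cocycle of the cokernel, its differential
        being the image of 0.\<close>
      have "dif B (fob F a) (fob F b) i z \<in> fmor F a b (i + 1) ` hom A a b (i + 1)"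
        unfolding z(2) using ob by (intro image_eqI[of _ _ 0]) auto
      then obtain w u where w: "w \<in> hom A a b i" "u \<in> hom B (fob F a) (fob F b) (i - 1)"
        "z = fmor F a b i w + dif B (fob F a) (fob F b) (i - 1) u"
        using acyclic[OF z(1)] by auto
      have "fmor F a b (i + 1) (dif A a b i w) = 0"
        using z(2) w(1,2) ob unfolding w(3) by (simp add: cod.dif_linear_simps fmor_simps)
      then have "dif A a b i w = 0"
        by (intro inj[of _ "i + 1"]) (use w(1) ob in auto)
      moreover have "Y = ?c' (fmor F a b i w)"
        unfolding z(3) cod_eq using w by auto
      ultimately show "Y \<in> ?\<phi> ` cohomology (hom A a b) (dif A a b) i"
        using w(1) \<phi>[OF w(1)]
        by (intro image_eqI[of _ _ "?c w"]) (auto simp: cohomology_def cocycles_def dom.cls_def)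
    qed
  qed
qed

section \<open>The cone functor\<close>

lemma sum_lessThan_add: "(\<Sum>l<m + n. f l) = (\<Sum>l<m. f l) + (\<Sum>l<n. f (m + l :: nat) :: 'a::comm_monoid_add)"
  by (induction n) (auto simp: add.assoc)

lemma tlen_Cone [simp]: "tlen (Cone X Y \<mu>) = tlen X + tlen Y"
  by (simp add: tlen_def Cone_def)

lemma tob_Cone: "tob (Cone X Y \<mu>) p = (if p < tlen X then tob X p else tob Y (p - tlen X))"
  by (simp add: tlen_def tob_def Cone_def nth_append case_prod_beta)

lemma tsh_Cone: "tsh (Cone X Y \<mu>) p = (if p < tlen X then tsh X p + 1 else tsh Y (p - tlen X))"
  by (simp add: tlen_def tsh_def Cone_def nth_append case_prod_beta)

lemma snd_Cone: "snd (Cone X Y \<mu>) = block (tlen X) (tlen X) (- snd X) (snd Y) \<mu>"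
  by (simp add: Cone_def)

lemma block_add: "block n n' P S H + block n n' P' S' H' = block n n' (P + P') (S + S') (H + H' :: 'm::ab_group_add mat)"
  by (auto simp: block_def fun_eq_iff)

lemma block_diff: "block n n' P S H - block n n' P' S' H' = block n n' (P - P') (S - S') (H - H' :: 'm::ab_group_add mat)"
  by (auto simp: block_def fun_eq_iff)

lemma block_sg: "sg i (block n n' P S H) = block n n' (sg i P) (sg i S) (sg i H :: 'm::ab_group_add mat)"
  by (auto simp: block_def fun_eq_iff sg_def)

lemma block_0: "block n n' 0 0 0 = (0 :: 'm::ab_group_add mat)"
  by (auto simp: block_def fun_eq_iff)

lemma sg_succ: "sg (i + 1) x = - sg i x" "sg (1 + i) x = - sg i x"
  by (simp_all add: sg_def)

lemma Tw_simps [simp]: "obj (Tw C) = tw_obj C" "hom (Tw C) = tw_hom C" "cmp (Tw C) = tw_cmp C"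
  "scl (Tw C) = (\<lambda>c M p s. scl C c (M p s))"
  "idt (Tw C) = (\<lambda>X p s. if p = s \<and> p < tlen X then idt C (tob X p) else 0)"
  by (simp_all add: Tw_def)

lemma Tw_dif: "dif (Tw C) X Y i M = tw_int C X Y i M + tw_cmp C X Y Y 1 i (snd Y) M - sg i (tw_cmp C X X Y i 1 M (snd X))"
  by (simp add: Tw_def)

text \<open>The block calculus only needs the summands to be objects of the base category. It
  therefore applies to a cone before the cone is known to satisfy the Maurer-Cartan
  equation.\<close>

definition wf_sum :: "('o, 'm, 'k) dgcat \<Rightarrow> ('o, 'm) tw \<Rightarrow> bool" where
  "wf_sum C X \<longleftrightarrow> (\<forall>p<tlen X. tob X p \<in> obj C)"

lemma tw_obj_wf_sum: "X \<in> tw_obj C \<Longrightarrow> wf_sum C X"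
  by (simp add: wf_sum_def tw_obj_def)

lemma tw_homD: "M \<in> tw_hom A X Y i \<Longrightarrow> p < tlen X \<Longrightarrow> s < tlen Y \<Longrightarrow> j = i + tsh Y s - tsh X p \<Longrightarrow>
    M p s \<in> hom A (tob X p) (tob Y s) j"
  by (simp add: tw_hom_def)

lemma tw_hom_out: "M \<in> tw_hom A X Y i \<Longrightarrow> \<not> (p < tlen X \<and> s < tlen Y) \<Longrightarrow> M p s = 0"
  by (simp add: tw_hom_def)

context dg_category
begin

lemma block_tw_hom:
  assumes "wf_sum A X" "wf_sum A Y" "wf_sum A X'" "wf_sum A Y'"
    and "P \<in> tw_hom A X X' i" "S \<in> tw_hom A Y Y' i" "H \<in> tw_hom A X Y' (i - 1)"
  shows "block (tlen X) (tlen X') P S H \<in> tw_hom A (Cone X Y \<mu>) (Cone X' Y' \<mu>') i"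
  unfolding tw_hom_def
proof (intro CollectI allI)
  fix p s
  show "if p < tlen (Cone X Y \<mu>) \<and> s < tlen (Cone X' Y' \<mu>')
     then block (tlen X) (tlen X') P S H p s \<in> hom A (tob (Cone X Y \<mu>) p) (tob (Cone X' Y' \<mu>') s)
        (i + tsh (Cone X' Y' \<mu>') s - tsh (Cone X Y \<mu>) p)
     else block (tlen X) (tlen X') P S H p s = 0"
    using assms
    by (auto simp: block_def tob_Cone tsh_Cone wf_sum_def intro!: tw_homD tw_hom_out)
qed

text \<open>The sign in \<open>tw_int\<close> is governed by the shift of the target. The targets of
  P lie in the shifted first block, hence the minus sign; H and S end in the unshifted block, and
  the shifted source of H only lowers its degree to \<open>i - 1\<close>.\<close>

lemma tw_int_block:
  assumes "wf_sum A X" "wf_sum A Y" "wf_sum A X'" "wf_sum A Y'"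
    and "P \<in> tw_hom A X X' i" "S \<in> tw_hom A Y Y' i" "H \<in> tw_hom A X Y' (i - 1)"
  shows "tw_int A (Cone X Y \<mu>) (Cone X' Y' \<mu>') i (block (tlen X) (tlen X') P S H)
    = block (tlen X) (tlen X') (- tw_int A X X' i P) (tw_int A Y Y' i S) (tw_int A X Y' (i - 1) H)"
  (is "?l = ?r")
proof (intro ext)
  fix p s
  show "?l p s = ?r p s"
    using assms(1-4) by (auto simp: block_def tw_int_def tob_Cone tsh_Cone wf_sum_def sg_succ algebra_simps)
qed

text \<open>The sum over the middle object splits at \<open>tlen X'\<close> into the summands of
  X'[1] and of Y'. Shifts do not alter composition, so no signs appear.\<close>

lemma tw_cmp_block:
  assumes ws: "wf_sum A X" "wf_sum A Y" "wf_sum A X'" "wf_sum A Y'" "wf_sum A X''" "wf_sum A Y''"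
    and P: "P \<in> tw_hom A X X' i" and S: "S \<in> tw_hom A Y Y' i" and H: "H \<in> tw_hom A X Y' (i - 1)"
    and P': "P' \<in> tw_hom A X' X'' j" and S': "S' \<in> tw_hom A Y' Y'' j" and H': "H' \<in> tw_hom A X' Y'' (j - 1)"
  shows "tw_cmp A (Cone X Y \<mu>) (Cone X' Y' \<mu>') (Cone X'' Y'' \<mu>'') j i
      (block (tlen X') (tlen X'') P' S' H') (block (tlen X) (tlen X') P S H)
    = block (tlen X) (tlen X'') (tw_cmp A X X' X'' j i P' P) (tw_cmp A Y Y' Y'' j i S' S)
       (tw_cmp A X X' Y'' (j - 1) i H' P + tw_cmp A X Y' Y'' j (i - 1) S' H)"
  (is "?l = ?r")
proof (intro ext)
  fix p s
  note mem = tw_homD[OF P] tw_homD[OF S] tw_homD[OF H] tw_homD[OF P'] tw_homD[OF S'] tw_homD[OF H']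
  show "?l p s = ?r p s"
    using ws by (auto simp: block_def tw_cmp_def tob_Cone tsh_Cone wf_sum_def sum_lessThan_add mem algebra_simps
      intro!: sum.neutral sum.cong)
qed

lemma tw_int_uminus: "wf_sum A X \<Longrightarrow> wf_sum A Y \<Longrightarrow> M \<in> tw_hom A X Y i \<Longrightarrow> tw_int A X Y i (- M) = - tw_int A X Y i M"
  by (auto simp: tw_int_def fun_eq_iff wf_sum_def tw_homD dif_uminus sg_uminus)

lemma tw_int_sg: "wf_sum A X \<Longrightarrow> wf_sum A Y \<Longrightarrow> M \<in> tw_hom A X Y i \<Longrightarrow> tw_int A X Y i (sg j M) = sg j (tw_int A X Y i M)"
  by (simp add: sg_def tw_int_uminus)

end

text \<open>That \<open>Tw C\<close> is a dg category is taken as a locale assumption. In the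
  theorem it comes with \<open>C\<close> being pretriangulated, which includes that
  \<open>tw_incl\<close> is a dg functor to \<open>Tw C\<close>.\<close>

locale tw_category = C: dg_category C + T: dg_category "Tw C"
  for C :: "('p, 'n::ab_group_add, 'k::field_char_0) dgcat"
begin

lemmas tw_lin = T.hom_uminus[simplified] T.hom_sg[simplified] T.cmp_uminus_left[simplified] T.cmp_uminus_right[simplified] T.cmp_sg_left[simplified] T.cmp_sg_right[simplified]

text \<open>In block form the Maurer-Cartan equation of the cone has those of X and Y on the
  diagonal, the two signs on the matrix of X compensating each other, and the closedness of \<mu>
  off the diagonal.\<close>

lemma Cone_obj:
  assumes X: "X \<in> tw_obj C" and Y: "Y \<in> tw_obj C" and \<mu>: "\<mu> \<in> tw_hom C X Y 0" "dif (Tw C) X Y 0 \<mu> = 0"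
  shows "Cone X Y \<mu> \<in> tw_obj C"
proof -
  have w: "wf_sum C X" "wf_sum C Y" using X Y by (auto intro: tw_obj_wf_sum)
  have q: "snd X \<in> tw_hom C X X 1" "snd Y \<in> tw_hom C Y Y 1"
    and mc: "tw_int C X X 1 (snd X) + tw_cmp C X X X 1 1 (snd X) (snd X) = 0"
      "tw_int C Y Y 1 (snd Y) + tw_cmp C Y Y Y 1 1 (snd Y) (snd Y) = 0"
    and tri: "\<And>p s. s \<le> p \<Longrightarrow> snd X p s = 0" "\<And>p s. s \<le> p \<Longrightarrow> snd Y p s = 0"
    using X Y by (auto simp: tw_obj_def)
  have mq: "- snd X \<in> tw_hom C X X 1" using T.hom_uminus X q(1) by simp
  \<comment> \<open>The off-diagonal block of a matrix of degree 1 has degree \<open>1 - 1\<close>;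
    the form is kept to match the block rules.\<close>
  have \<mu>1: "\<mu> \<in> tw_hom C X Y (1 - 1)" using \<mu> by simp
  show ?thesis
    unfolding tw_obj_def
  proof (intro CollectI conjI)
    show "\<forall>p<tlen (Cone X Y \<mu>). tob (Cone X Y \<mu>) p \<in> obj C"
      using w by (auto simp: wf_sum_def tob_Cone)
    show "snd (Cone X Y \<mu>) \<in> tw_hom C (Cone X Y \<mu>) (Cone X Y \<mu>) 1"
      unfolding snd_Cone by (rule C.block_tw_hom[OF w w mq q(2) \<mu>1])
    show "\<forall>p s. s \<le> p \<longrightarrow> snd (Cone X Y \<mu>) p s = 0"
      by (auto simp: snd_Cone block_def tri)
    show "tw_int C (Cone X Y \<mu>) (Cone X Y \<mu>) 1 (snd (Cone X Y \<mu>)) +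
      tw_cmp C (Cone X Y \<mu>) (Cone X Y \<mu>) (Cone X Y \<mu>) 1 1 (snd (Cone X Y \<mu>)) (snd (Cone X Y \<mu>)) = 0"
      unfolding snd_Cone C.tw_int_block[OF w w mq q(2) \<mu>1]
        C.tw_cmp_block[OF w w w mq q(2) \<mu>1 mq q(2) \<mu>1] block_add
      using \<mu>(2) mc X Y q \<mu>(1)
      by (simp add: Tw_dif C.tw_int_uminus w tw_lin algebra_simps block_0)
  qed
qed

text \<open>The blocks on the right are the entries of the differential in the gluing, with the sign
  for degree \<open>i + 1\<close> that \<open>cone_fun\<close> attaches to the first and the third
  entry. This is compatibility of the cone functor with differentials.\<close>

lemma Cone_dif:
  assumes ob: "X \<in> tw_obj C" "Y \<in> tw_obj C" "X' \<in> tw_obj C" "Y' \<in> tw_obj C"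
    and \<mu>: "\<mu> \<in> tw_hom C X Y 0" and \<mu>': "\<mu>' \<in> tw_hom C X' Y' 0"
    and P: "P \<in> tw_hom C X X' i" and S: "S \<in> tw_hom C Y Y' i" and H: "H \<in> tw_hom C X Y' (i - 1)"
  shows "dif (Tw C) (Cone X Y \<mu>) (Cone X' Y' \<mu>') i (block (tlen X) (tlen X') (sg i P) S (sg i H))
    = block (tlen X) (tlen X') (sg (i + 1) (dif (Tw C) X X' i P)) (dif (Tw C) Y Y' i S)
       (sg (i + 1) (- dif (Tw C) X Y' (i - 1) H + tw_cmp C X Y Y' i 0 S \<mu> - tw_cmp C X X' Y' 0 i \<mu>' P))"
proof -
  have w: "wf_sum C X" "wf_sum C Y" "wf_sum C X'" "wf_sum C Y'" using ob by (auto intro: tw_obj_wf_sum)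
  have q: "snd X \<in> tw_hom C X X 1" "snd Y \<in> tw_hom C Y Y 1" "snd X' \<in> tw_hom C X' X' 1" "snd Y' \<in> tw_hom C Y' Y' 1"
    using ob by (auto simp: tw_obj_def)
  have m: "- snd X \<in> tw_hom C X X 1" "- snd X' \<in> tw_hom C X' X' 1" "\<mu> \<in> tw_hom C X Y (1 - 1)"
    "\<mu>' \<in> tw_hom C X' Y' (1 - 1)" "sg i P \<in> tw_hom C X X' i" "sg i H \<in> tw_hom C X Y' (i - 1)"
    using T.hom_uminus T.hom_sg ob q \<mu> \<mu>' P H by simp_all
  show ?thesis
    unfolding Tw_dif snd_Cone C.tw_int_block[OF w m(5) S m(6)]
      C.tw_cmp_block[OF w w(3,4) m(5) S m(6) m(2) q(4) m(4)]
      C.tw_cmp_block[OF w(1,2) w m(1) q(2) m(3) m(5) S m(6)]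
      block_add block_sg block_diff
    by (rule arg_cong3[where f = "block (tlen X) (tlen X')"])
      (use ob q \<mu> \<mu>' P S H in \<open>simp_all add: C.tw_int_sg C.tw_int_uminus w tw_lin sg_def algebra_simps\<close>)
qed

lemma Cone_cmp:
  assumes ob: "X \<in> tw_obj C" "Y \<in> tw_obj C" "X' \<in> tw_obj C" "Y' \<in> tw_obj C" "X'' \<in> tw_obj C" "Y'' \<in> tw_obj C"
    and P: "P \<in> tw_hom C X X' i" and S: "S \<in> tw_hom C Y Y' i" and H: "H \<in> tw_hom C X Y' (i - 1)"
    and P': "P' \<in> tw_hom C X' X'' j" and S': "S' \<in> tw_hom C Y' Y'' j" and H': "H' \<in> tw_hom C X' Y'' (j - 1)"
  shows "tw_cmp C (Cone X Y \<mu>) (Cone X' Y' \<mu>') (Cone X'' Y'' \<mu>'') j i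
      (block (tlen X') (tlen X'') (sg j P') S' (sg j H')) (block (tlen X) (tlen X') (sg i P) S (sg i H))
    = block (tlen X) (tlen X'') (sg (j + i) (tw_cmp C X X' X'' j i P' P)) (tw_cmp C Y Y' Y'' j i S' S)
       (sg (j + i) (tw_cmp C X X' Y'' (j - 1) i H' P + sg j (tw_cmp C X Y' Y'' j (i - 1) S' H)))"
proof -
  have w: "wf_sum C X" "wf_sum C Y" "wf_sum C X'" "wf_sum C Y'" "wf_sum C X''" "wf_sum C Y''"
    using ob by (auto intro: tw_obj_wf_sum)
  have m: "sg i P \<in> tw_hom C X X' i" "sg i H \<in> tw_hom C X Y' (i - 1)"
    "sg j P' \<in> tw_hom C X' X'' j" "sg j H' \<in> tw_hom C X' Y'' (j - 1)"
    using T.hom_sg ob P H P' H' by simp_all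
  show ?thesis
    unfolding C.tw_cmp_block[OF w m(1) S m(2) m(3) S' m(4)]
    by (rule arg_cong3[where f = "block (tlen X) (tlen X'')"])
      (use ob P S H P' S' H' in \<open>simp_all add: tw_lin, simp_all add: sg_def\<close>)
qed

lemma Cone_hom:
  assumes ob: "X \<in> tw_obj C" "Y \<in> tw_obj C" "X' \<in> tw_obj C" "Y' \<in> tw_obj C"
    and P: "P \<in> tw_hom C X X' i" and S: "S \<in> tw_hom C Y Y' i" and H: "H \<in> tw_hom C X Y' (i - 1)"
  shows "block (tlen X) (tlen X') (sg i P) S (sg i H) \<in> tw_hom C (Cone X Y \<mu>) (Cone X' Y' \<mu>') i"
  using T.hom_sg ob P H by (intro C.block_tw_hom S) (auto intro: tw_obj_wf_sum)

lemma Cone_idt: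
  "block (tlen X) (tlen X) (idt (Tw C) X) (idt (Tw C) Y) 0 = idt (Tw C) (Cone X Y \<mu>)"
  by (auto simp: block_def fun_eq_iff tob_Cone)

end

locale cone_data = tw_category C + glue_data "Tw C" A B F1 F2
  for C :: "('q, 'r::ab_group_add, 'k::field_char_0) dgcat"
    and A :: "('o, 'm::ab_group_add, 'k) dgcat"
    and B :: "('p, 'n::ab_group_add, 'k) dgcat" and F1 F2
begin

lemma cone_fun_simps [simp]:
  "fob (cone_fun F1 F2) (a, b, \<mu>) = Cone (fob F1 a) (fob F2 b) \<mu>"
  "fmor (cone_fun F1 F2) (a, b, \<mu>) (c, d, \<xi>) i (f, g, h) =
     block (tlen (fob F1 a)) (tlen (fob F1 c)) (sg i (fmor F1 a c i f)) (fmor F2 b d i g) (sg i h)"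
  by (simp_all add: cone_fun_def)

lemma cone_fun_dg_functor: "dg_functor G (Tw C) (cone_fun F1 F2)"
proof (rule dg_functorI)
  show "dg_category G" by (rule glue_dg_category)
  show "dg_category (Tw C)" by (rule T.dg_category_axioms)
next
  fix x assume "x \<in> obj G"
  then show "fob (cone_fun F1 F2) x \<in> obj (Tw C)"
    using F1.fob_obj F2.fob_obj by (cases x) (auto intro!: Cone_obj)
next
  fix x y f i assume "x \<in> obj G" "y \<in> obj G" "f \<in> hom G x y i"
  then show "fmor (cone_fun F1 F2) x y i f \<in> hom (Tw C) (fob (cone_fun F1 F2) x) (fob (cone_fun F1 F2) y) i"
    using F1.fob_obj F2.fob_obj F1.fmor_hom F2.fmor_hom
    by (cases x; cases y; cases f) (auto intro!: Cone_hom)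
next
  fix x y i assume "x \<in> obj G" "y \<in> obj G"
  then show "linear_on (hom G x y i) (scl G) (scl (Tw C)) (fmor (cone_fun F1 F2) x y i)"
    by (cases x; cases y)
      (auto intro!: linear_onI ext simp: F1.fmor_simps F2.fmor_simps block_def sg_def C.scl_simps)
next
  fix x y f i assume "x \<in> obj G" "y \<in> obj G" "f \<in> hom G x y i"
  then show "fmor (cone_fun F1 F2) x y (i + 1) (dif G x y i f) =
      dif (Tw C) (fob (cone_fun F1 F2) x) (fob (cone_fun F1 F2) y) i (fmor (cone_fun F1 F2) x y i f)"
    using F1.fob_obj F2.fob_obj F1.fmor_hom F2.fmor_hom
    by (cases x; cases y; cases f) (auto simp: Cone_dif F1.fmor_dif F2.fmor_dif)
next
  fix x y z g j f i assume "x \<in> obj G" "y \<in> obj G" "z \<in> obj G" "g \<in> hom G y z j" "f \<in> hom G x y i"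
  then show "fmor (cone_fun F1 F2) x z (j + i) (cmp G x y z j i g f) =
      cmp (Tw C) (fob (cone_fun F1 F2) x) (fob (cone_fun F1 F2) y) (fob (cone_fun F1 F2) z) j i
       (fmor (cone_fun F1 F2) y z j g) (fmor (cone_fun F1 F2) x y i f)"
    using F1.fob_obj F2.fob_obj F1.fmor_hom F2.fmor_hom
    by (cases x; cases y; cases z; cases f; cases g) (auto simp: Cone_cmp F1.fmor_cmp F2.fmor_cmp)
next
  fix x assume "x \<in> obj G"
  then show "fmor (cone_fun F1 F2) x x 0 (idt G x) = idt (Tw C) (fob (cone_fun F1 F2) x)"
    by (cases x) (auto simp: Cone_idt simp del: Tw_simps)
qed

end

section \<open>The iterated constructions\<close>

lemma mem_first_mor [simp]: "first_mor f \<in> first_mor ` S \<longleftrightarrow> f \<in> S"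
  and mem_next_mor [simp]: "next_mor x \<in> next_mor ` S' \<longleftrightarrow> x \<in> S'"
  and mem_First [simp]: "First a \<in> First ` T \<longleftrightarrow> a \<in> T"
  and mem_next_ob [simp]: "next_ob y \<in> next_ob ` T' \<longleftrightarrow> y \<in> T'"
  by (simp_all add: inj_image_mem_iff inj_first_mor inj_next_mor inj_First inj_next_ob)

lemma first_next_eq [simp]:
  "first_mor f = first_mor f' \<longleftrightarrow> f = f'" "next_mor x = next_mor x' \<longleftrightarrow> x = x'"
  by (simp_all add: inj_eq inj_first_mor inj_next_mor)

lemmas inv_label [simp] = inv_f_f[OF inj_first_mor] inv_f_f[OF inj_next_mor] inv_f_f[OF inj_First] inv_f_f[OF inj_next_ob]

lemma first_cat_simps [simp]:
  "obj (first_cat D A) = First ` obj A"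
  "hom (first_cat D A) (First a) (First b) i = first_mor ` hom A a b i"
  "dif (first_cat D A) (First a) (First b) i (first_mor f) = first_mor (dif A a b i f)"
  "cmp (first_cat D A) (First a) (First b) (First c) j i (first_mor g) (first_mor f) = first_mor (cmp A a b c j i g f)"
  "idt (first_cat D A) (First a) = first_mor (idt A a)"
  by (simp_all add: first_cat_def relabel_def)

lemma next_cat_simps [simp]:
  "obj (next_cat A) = next_ob ` obj A"
  "hom (next_cat A) (next_ob a) (next_ob b) i = next_mor ` hom A a b i"
  "dif (next_cat A) (next_ob a) (next_ob b) i (next_mor f) = next_mor (dif A a b i f)"
  "cmp (next_cat A) (next_ob a) (next_ob b) (next_ob c) j i (next_mor g) (next_mor f) = next_mor (cmp A a b c j i g f)"
  "idt (next_cat A) (next_ob a) = next_mor (idt A a)"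
  by (simp_all add: next_cat_def relabel_def)

lemma first_next_fun_simps [simp]:
  "fob (first_fun F) (First a) = fob F a"
  "fmor (first_fun F) (First a) (First b) i (first_mor f) = fmor F a b i f"
  "fob (next_fun F') (next_ob x) = fob F' x"
  "fmor (next_fun F') (next_ob x) (next_ob y) i (next_mor g) = fmor F' x y i g"
  by (simp_all add: relabel_fun_def)

lemma first_mor_0 [simp]: "first_mor 0 = (0 :: ('m::ab_group_add, 'r::ab_group_add) itmor)"
  using first_mor_add[of 0 0] by simp

lemma next_mor_0 [simp]: "next_mor 0 = (0 :: ('m::ab_group_add, 'r::ab_group_add) itmor)"
  using next_mor_add[of 0 0] by simp

lemma first_next_eq_0 [simp]:
  "first_mor f = (0 :: ('m::ab_group_add, 'r::ab_group_add) itmor) \<longleftrightarrow> f = 0"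
  "next_mor x = (0 :: ('m::ab_group_add, 'r::ab_group_add) itmor) \<longleftrightarrow> x = 0"
  by (metis first_next_eq(1) first_mor_0, metis first_next_eq(2) next_mor_0)

lemma first_mor_diff: "first_mor f - first_mor g = (first_mor (f - g) :: ('m::ab_group_add, 'r::ab_group_add) itmor)"
  using first_mor_add[of "f - g" g] by (simp add: algebra_simps)

lemma next_mor_diff: "next_mor f - next_mor g = (next_mor (f - g) :: ('m::ab_group_add, 'r::ab_group_add) itmor)"
  using next_mor_add[of "f - g" g] by (simp add: algebra_simps)

definition first_emb :: "('o, 'm::zero, ('o, 'r) itob, ('m, 'r::zero) itmor) dgfun" where
  "first_emb = \<lparr>fob = First, fmor = (\<lambda>a b i. first_mor)\<rparr>"

definition next_emb ::
  "(('o, 'r) itob \<times> 'o \<times> 'r, ('m, 'r) itmor \<times> 'm \<times> 'r, ('o, 'r) itob, ('m, 'r) itmor) dgfun" where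
  "next_emb = \<lparr>fob = next_ob, fmor = (\<lambda>a b i. next_mor)\<rparr>"

lemma emb_simps [simp]: "fob first_emb = First" "fmor first_emb a b i = first_mor"
  "fob next_emb = next_ob" "fmor next_emb a' b' i = next_mor"
  by (simp_all add: first_emb_def next_emb_def)

lemma first_fun_dg_functor: "dg_functor A B F \<Longrightarrow> dg_category D \<Longrightarrow> dg_functor (first_cat D A) B (first_fun F)"
  unfolding first_cat_def
  by (rule relabel_data.relabel_fun_dg_functor[OF first_cat_relabel_data[OF dg_functor.axioms(1)]])

lemma first_emb_dg_functor: "dg_category A \<Longrightarrow> dg_category D \<Longrightarrow> dg_functor A (first_cat D A) first_emb"
  unfolding first_cat_def first_emb_def by (rule relabel_data.embed_dg_functor[OF first_cat_relabel_data])

lemma next_fun_dg_functor: "dg_functor A B F \<Longrightarrow> dg_functor (next_cat A) B (next_fun F)"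
  unfolding next_cat_def
  by (rule relabel_data.relabel_fun_dg_functor[OF next_cat_relabel_data[OF dg_functor.axioms(1)]])

lemma next_emb_dg_functor: "dg_category A \<Longrightarrow> dg_functor A (next_cat A) next_emb"
  unfolding next_cat_def next_emb_def by (rule relabel_data.embed_dg_functor[OF next_cat_relabel_data])

declare gl.simps [simp del] ak.simps [simp del]

section \<open>The categories A_k(C) and their functors to twisted complexes\<close>

context tw_category
begin

sublocale A2: cone_data C "Tw C" "Tw C" id_fun id_fun
  by (intro cone_data.intro tw_category_axioms glue_data.intro dg_functor_id T.dg_category_axioms)

lemma A2_eq [simp]: "glue (Tw C) (Tw C) (Tw C) id_fun id_fun = A2 C"
  by (simp add: A2_def)

abbreviation "AK n \<equiv> fst (ak C n)"
abbreviation "f n \<equiv> snd (ak C n)"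
abbreviation "HF n \<equiv> hfib (Tw C) (AK n) (A2 C) (f n (n + 3)) proj1"

lemma AK_0: "AK 0 = first_cat (Tw C) (A2 C)"
  and f_0: "f 0 i = first_fun (if i = 1 then proj1 else if i = 2 then proj2 else A2_f3)"
  and AK_Suc: "AK (Suc n) = next_cat (HF n)"
  and f_Suc: "f (Suc n) i = next_fun (if i \<le> n + 2 then f n i \<circ>\<circ> proj1
                      else if i = n + 3 then proj2 \<circ>\<circ> proj2 else A2_f3 \<circ>\<circ> proj2)"
  by (simp_all add: ak.simps Let_def)

lemma A2_f3_dg_functor: "dg_functor (A2 C) (Tw C) A2_f3"
  unfolding A2_f3_def using A2.cone_fun_dg_functor by simp

lemma A2_proj: "dg_functor (A2 C) (Tw C) proj1" "dg_functor (A2 C) (Tw C) proj2"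
  using A2.glue_proj1 A2.glue_proj2 by simp_all

lemma f_dg_functor: "dg_functor (AK n) (Tw C) (f n i)"
proof (induction n arbitrary: i)
  case 0
  show ?case unfolding AK_0 f_0
    by (intro first_fun_dg_functor T.dg_category_axioms) (simp add: A2_f3_dg_functor A2_proj)
next
  case (Suc n)
  interpret g: glue_data "Tw C" "AK n" "A2 C" "f n (n + 3)" proj1
    by (intro glue_data.intro Suc A2_proj)
  have "dg_functor (HF n) (Tw C) (if i \<le> n + 2 then f n i \<circ>\<circ> proj1
                      else if i = n + 3 then proj2 \<circ>\<circ> proj2 else A2_f3 \<circ>\<circ> proj2)"
    using dg_functor_comp[OF g.hfib_dg_functor[OF g.glue_proj1] Suc]
      dg_functor_comp[OF g.hfib_dg_functor[OF g.glue_proj2] A2_proj(2)]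
      dg_functor_comp[OF g.hfib_dg_functor[OF g.glue_proj2] A2_f3_dg_functor]
    by simp
  then show ?case unfolding AK_Suc f_Suc by (rule next_fun_dg_functor)
qed

lemma AK_dg_category: "dg_category (AK n)"
  using f_dg_functor by (rule dg_functor.axioms(1))

lemma HF_data: "glue_data (Tw C) (AK n) (A2 C) (f n (n + 3)) proj1"
  by (intro glue_data.intro f_dg_functor A2_proj)

text \<open>\<open>\<mu>\<close> is \<open>\<beta>' m \<alpha>\<close> for a homotopy inverse \<open>\<beta>'\<close> of \<open>\<beta>\<close>.\<close>

lemma A2_lift:
  assumes ob: "X \<in> tw_obj C" "Y \<in> tw_obj C" and xy: "(x, y, m) \<in> obj (A2 C)"
    and \<alpha>: "hiso (Tw C) X x \<alpha>" and \<beta>: "hiso (Tw C) Y y \<beta>"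
  shows "\<exists>\<mu> h. (X, Y, \<mu>) \<in> obj (A2 C) \<and> hiso (A2 C) (X, Y, \<mu>) (x, y, m) (\<alpha>, \<beta>, h)"
proof -
  note [simp del] = Tw_simps
  have ob': "X \<in> obj (Tw C)" "Y \<in> obj (Tw C)" using ob by (simp_all add: Tw_simps)
  have xy': "x \<in> obj (Tw C)" "y \<in> obj (Tw C)" and m: "m \<in> hom (Tw C) x y 0" "dif (Tw C) x y 0 m = 0"
    using xy by (simp_all add: A2_def glue_def id_fun_def)
  obtain \<beta>' \<gamma> where \<beta>': "\<beta>' \<in> hom (Tw C) y Y 0" "dif (Tw C) y Y 0 \<beta>' = 0"
    and \<gamma>: "\<gamma> \<in> hom (Tw C) y y (- 1)" "cmp (Tw C) y Y y 0 0 \<beta> \<beta>' = idt (Tw C) y + dif (Tw C) y y (- 1) \<gamma>"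
    using \<beta> by (rule hisoE)
  note \<alpha>\<beta> = hiso_hom[OF \<alpha>] hiso_hom[OF \<beta>] hiso_closed[OF \<alpha>] hiso_closed[OF \<beta>]
  define t where "t = cmp (Tw C) X x y 0 0 m \<alpha>"
  have t: "t \<in> hom (Tw C) X y 0" "dif (Tw C) X y 0 t = 0"
    unfolding t_def using ob' xy' m \<alpha>\<beta> by (simp_all add: T.leibniz')
  define \<mu> where "\<mu> = cmp (Tw C) X y Y 0 0 \<beta>' t"
  \<comment> \<open>Closedness of (\<alpha>, \<beta>, h) demands d h = \<beta> \<mu> - m \<alpha>.
    As \<beta> \<beta>' = 1 + d\<gamma> and t = m \<alpha>, the right-hand side is d\<gamma> t, so
    \<gamma> t is a solution.\<close>
  define h where "h = cmp (Tw C) X y y (- 1) 0 \<gamma> t"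
  have \<mu>: "\<mu> \<in> hom (Tw C) X Y 0" "dif (Tw C) X Y 0 \<mu> = 0"
    unfolding \<mu>_def using ob' xy' t \<beta>' by (simp_all add: T.leibniz')
  have h: "h \<in> hom (Tw C) X y (- 1)" "dif (Tw C) X y (- 1) h = cmp (Tw C) X y y 0 0 (dif (Tw C) y y (- 1) \<gamma>) t"
    unfolding h_def using ob' xy' t \<gamma> by (simp_all add: T.leibniz')
  have "cmp (Tw C) X Y y 0 0 \<beta> \<mu> = cmp (Tw C) X y y 0 0 (cmp (Tw C) y Y y 0 0 \<beta> \<beta>') t"
    unfolding \<mu>_def using ob' xy' t \<beta>'(1) \<alpha>\<beta> by (simp add: T.cmp_assoc')
  also have "\<dots> = t + dif (Tw C) X y (- 1) h"
    unfolding \<gamma>(2) h(2) using ob' xy' t \<gamma>(1) by (simp add: T.cmp_linear_simps)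
  finally have \<beta>\<mu>: "cmp (Tw C) X Y y 0 0 \<beta> \<mu> = \<dots>" .
  have X: "(X, Y, \<mu>) \<in> obj (A2 C)" using ob' \<mu> by (simp add: A2_def glue_def id_fun_def)
  have "hiso (glue (Tw C) (Tw C) (Tw C) id_fun id_fun) (X, Y, \<mu>) (x, y, m) (\<alpha>, \<beta>, h)"
  proof (rule A2.hiso_glue)
    show "(X, Y, \<mu>) \<in> obj (glue (Tw C) (Tw C) (Tw C) id_fun id_fun)"
      "(x, y, m) \<in> obj (glue (Tw C) (Tw C) (Tw C) id_fun id_fun)"
      using X xy by simp_all
    show "(\<alpha>, \<beta>, h) \<in> hom (glue (Tw C) (Tw C) (Tw C) id_fun id_fun) (X, Y, \<mu>) (x, y, m) 0"
      using \<alpha>\<beta> h by (simp add: A2.glue_hom del: A2_eq)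
    show "dif (glue (Tw C) (Tw C) (Tw C) id_fun id_fun) (X, Y, \<mu>) (x, y, m) 0 (\<alpha>, \<beta>, h) = 0"
      using \<alpha>\<beta> by (simp add: A2.glue_dif zero_prod_def \<beta>\<mu> t_def[symmetric] del: A2_eq)
  qed (fact \<alpha> \<beta>)+
  then show ?thesis using X by auto
qed

end

text \<open>Since \<open>A2 C\<close> is itself a gluing, along identities, a gluing along F1 and F2
  maps to it with \<mu> and h unchanged. Composed with \<open>A2_f3\<close> this functor becomes
  \<open>cone_fun F1 F2\<close> on the nose.\<close>

definition push ::
  "('o, 'm, 'q, 'r) dgfun \<Rightarrow> ('p, 'n, 'q, 'r) dgfun \<Rightarrow>
   ('o \<times> 'p \<times> 'r, 'm \<times> 'n \<times> 'r, 'q \<times> 'q \<times> 'r, 'r \<times> 'r \<times> 'r) dgfun" where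
  "push F1 F2 = \<lparr>fob = (\<lambda>(a, b, \<mu>). (fob F1 a, fob F2 b, \<mu>)),
     fmor = (\<lambda>(a, b, \<mu>) (c, d, \<xi>) i (f, g, h). (fmor F1 a c i f, fmor F2 b d i g, h))\<rparr>"

lemma push_simps [simp]:
  "fob (push F1 F2) (a, b, \<mu>) = (fob F1 a, fob F2 b, \<mu>)"
  "fmor (push F1 F2) (a, b, \<mu>) (c, d, \<xi>) i (f, g, h) = (fmor F1 a c i f, fmor F2 b d i g, h)"
  by (simp_all add: push_def)

lemma (in cone_data) push_dg_functor: "dg_functor G (A2 C) (push F1 F2)"
proof (rule dg_functorI)
  show "dg_category G" by (rule glue_dg_category)
  show "dg_category (A2 C)" using A2.glue_dg_category by simp
next
  fix x assume "x \<in> obj G"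
  then show "fob (push F1 F2) x \<in> obj (A2 C)"
    by (cases x) (auto simp: A2_def simp del: A2_eq Tw_simps)
next
  fix x y g z j f i assume "x \<in> obj G" "y \<in> obj G" "z \<in> obj G" "g \<in> hom G y z j" "f \<in> hom G x y i"
  then show "fmor (push F1 F2) x z (j + i) (cmp G x y z j i g f) =
      cmp (A2 C) (fob (push F1 F2) x) (fob (push F1 F2) y) (fob (push F1 F2) z) j i
       (fmor (push F1 F2) y z j g) (fmor (push F1 F2) x y i f)"
    by (cases x; cases y; cases z; cases f; cases g)
      (auto simp: A2_def F1.fmor_cmp F2.fmor_cmp simp del: A2_eq Tw_simps)
next
  fix x y f i assume "x \<in> obj G" "y \<in> obj G" "f \<in> hom G x y i"
  then show "fmor (push F1 F2) x y i f \<in> hom (A2 C) (fob (push F1 F2) x) (fob (push F1 F2) y) i"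
    by (cases x; cases y; cases f) (auto simp: A2_def simp del: A2_eq Tw_simps)
next
  fix x y f i assume "x \<in> obj G" "y \<in> obj G" "f \<in> hom G x y i"
  then show "fmor (push F1 F2) x y (i + 1) (dif G x y i f) =
      dif (A2 C) (fob (push F1 F2) x) (fob (push F1 F2) y) i (fmor (push F1 F2) x y i f)"
    by (cases x; cases y; cases f) (auto simp: A2_def F1.fmor_dif F2.fmor_dif simp del: A2_eq Tw_simps)
next
  fix x y i assume "x \<in> obj G" "y \<in> obj G"
  then show "linear_on (hom G x y i) (scl G) (scl (A2 C)) (fmor (push F1 F2) x y i)"
    by (cases x; cases y)
      (auto intro!: linear_onI simp: A2_def F1.fmor_simps F2.fmor_simps simp del: A2_eq Tw_simps)
next
  fix x assume "x \<in> obj G"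
  then show "fmor (push F1 F2) x x 0 (idt G x) = idt (A2 C) (fob (push F1 F2) x)"
    by (cases x) (auto simp: A2_def simp del: A2_eq Tw_simps)
qed

text \<open>The projections of the iterated gluing to its factors. At stage 0 there is only the
  factor with index 1, and the index is ignored.\<close>

primrec gl_proj :: "nat \<Rightarrow> nat \<Rightarrow> (('o, 'r) itob, ('m::zero, 'r::zero) itmor, 'o, 'm) dgfun" where
  "gl_proj 0 = (\<lambda>j. first_fun id_fun)"
| "gl_proj (Suc n) = (\<lambda>j. next_fun (if j = n + 2 then proj2 else gl_proj n j \<circ>\<circ> proj1))"

text \<open>The indices are offset: \<open>gl C A F (Suc n)\<close> glues \<open>n + 2\<close> pairs
  and \<open>ak C n\<close> is A_(n+2)(C), so stage n goes from the former to the latter. The last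
  gluing morphism becomes the \<open>A2 C\<close> part, and everything before it is mapped
  recursively.\<close>

primrec gl_to_ak ::
  "('p, 'n::ab_group_add, 'k) dgcat \<Rightarrow> (nat \<Rightarrow> ('o, 'm::ab_group_add, 'k) dgcat) \<Rightarrow>
   (nat \<Rightarrow> ('o, 'm, 'p, 'n) dgfun) \<Rightarrow> nat \<Rightarrow>
   (('o, 'n mat) itob, ('m, 'n mat) itmor, ('p, 'n) akob, 'n akmor) dgfun" where
  "gl_to_ak C A F 0 = first_emb \<circ>\<circ> next_fun (push (snd (gl C A F 0)) (tw_incl \<circ>\<circ> F 2))"
| "gl_to_ak C A F (Suc n) = next_emb \<circ>\<circ> next_fun (strict_pair (Tw C) (snd (ak C n) (n + 3))
      (gl_to_ak C A F n \<circ>\<circ> proj1) (push (snd (gl C A F (Suc n))) (tw_incl \<circ>\<circ> F (n + 3))))"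

section \<open>The comparison functor from the iterated gluing to A_k(C)\<close>

locale schober = tw_category C
  for C :: "('p, 'n::ab_group_add, 'k::field_char_0) dgcat" +
  fixes A :: "nat \<Rightarrow> ('o, 'm::ab_group_add, 'k) dgcat"
    and F :: "nat \<Rightarrow> ('o, 'm, 'p, 'n) dgfun"
    and k :: nat
  assumes k2: "k \<ge> 2" and F_dg_functor: "\<And>i. i \<in> {1..k} \<Longrightarrow> dg_functor (A i) (Tw C) (tw_incl \<circ>\<circ> F i)"
begin

abbreviation pr :: "nat \<Rightarrow> nat \<Rightarrow> (('o, 'n mat) itob, ('m, 'n mat) itmor, 'o, 'm) dgfun"
  where "pr \<equiv> gl_proj"
abbreviation "FT i \<equiv> tw_incl \<circ>\<circ> F i"
abbreviation "GL n \<equiv> fst (gl C A F n)"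
abbreviation "cn n \<equiv> snd (gl C A F n)"
abbreviation "GG n \<equiv> glue (Tw C) (GL n) (A (n + 2)) (cn n) (FT (n + 2))"
abbreviation "Q n \<equiv> gl_to_ak C A F n"

lemma GL_0: "GL 0 = first_cat (Tw C) (A 1)" and cn_0: "cn 0 = first_fun (FT 1)"
  and GL_Suc: "GL (Suc n) = next_cat (GG n)" and cn_Suc: "cn (Suc n) = next_fun (cone_fun (cn n) (FT (n + 2)))"
  by (simp_all add: gl.simps Let_def)

lemma cn_dg_functor: "n + 1 \<le> k \<Longrightarrow> dg_functor (GL n) (Tw C) (cn n)"
proof (induction n)
  case 0
  then show ?case unfolding GL_0 cn_0 using F_dg_functor[of 1]
    by (intro first_fun_dg_functor T.dg_category_axioms) simp
next
  case (Suc n)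
  interpret g: cone_data C "GL n" "A (n + 2)" "cn n" "FT (n + 2)"
    using Suc F_dg_functor[of "n + 2"] by (intro cone_data.intro glue_data.intro tw_category_axioms) auto
  show ?case unfolding GL_Suc cn_Suc by (rule next_fun_dg_functor[OF g.cone_fun_dg_functor])
qed

lemma gl_data: "n + 2 \<le> k \<Longrightarrow> cone_data C (GL n) (A (n + 2)) (cn n) (FT (n + 2))"
  using cn_dg_functor[of n] F_dg_functor[of "n + 2"] by (intro cone_data.intro glue_data.intro tw_category_axioms) auto

lemma gl_proj_dg_functor: "n + 1 \<le> k \<Longrightarrow> j \<in> {1..n + 1} \<Longrightarrow> dg_functor (GL n) (A j) (pr n j)"
proof (induction n)
  case 0
  then have "j = 1" by simp
  then show ?case unfolding GL_0 gl_proj.simps using F_dg_functor[of 1] 0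
    by (auto intro!: first_fun_dg_functor T.dg_category_axioms dg_functor_id dest: dg_functor.axioms(1))
next
  case (Suc n)
  interpret g: cone_data C "GL n" "A (n + 2)" "cn n" "FT (n + 2)"
    using Suc by (intro gl_data) auto
  have "dg_functor (GG n) (A j) (if j = n + 2 then proj2 else pr n j \<circ>\<circ> proj1)"
    using g.glue_proj2 dg_functor_comp[OF g.glue_proj1 Suc.IH] Suc.prems by auto
  then show ?case unfolding GL_Suc gl_proj.simps by (rule next_fun_dg_functor)
qed

lemma GG_push: "n + 2 \<le> k \<Longrightarrow> dg_functor (GG n) (A2 C) (push (cn n) (FT (n + 2)))"
  using gl_data[of n] by (rule cone_data.push_dg_functor)

text \<open>The claims need a joint induction: the equality for \<open>n + 3\<close> at one stage is
  the strict square from which \<open>strict_pair\<close> builds the functor of the next stage.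
  There the equality for the last functor follows directly, because the cone of the pushed gluing
  morphism is the iterated cone.\<close>

lemma Q_properties:
  assumes "n + 2 \<le> k"
  shows "dg_functor (GL (Suc n)) (AK n) (Q n) \<and> fun_eq_on (GL (Suc n)) (f n (n + 3) \<circ>\<circ> Q n) (cn (Suc n)) \<and>
    (\<forall>j\<in>{1..n + 2}. fun_eq_on (GL (Suc n)) (f n j \<circ>\<circ> Q n) (FT j \<circ>\<circ> pr (Suc n) j))"
  using assms
proof (induction n)
  case 0
  have "dg_functor (GL (Suc 0)) (AK 0) (Q 0)"
    unfolding GL_Suc AK_0 gl_to_ak.simps using GG_push[of 0] 0
    by (intro dg_functor_comp[OF next_fun_dg_functor first_emb_dg_functor] dg_functor.axioms(1)[OF A2_proj(1)]
        T.dg_category_axioms) (simp add: numeral_2_eq_2)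
  moreover have "fun_eq_on (GL (Suc 0)) (f 0 3 \<circ>\<circ> Q 0) (cn (Suc 0))"
    by (auto intro!: fun_eq_onI simp: GL_Suc GL_0 f_0 cn_Suc glue_def cone_fun_def A2_f3_def numeral_2_eq_2
      simp del: Tw_simps)
  moreover have "fun_eq_on (GL (Suc 0)) (f 0 j \<circ>\<circ> Q 0) (FT j \<circ>\<circ> pr (Suc 0) j)" if "j \<in> {1..2}" for j
  proof -
    have "j = 1 \<or> j = 2" using that by auto
    then show ?thesis
      by (auto intro!: fun_eq_onI simp: GL_Suc GL_0 f_0 cn_0 glue_def numeral_2_eq_2 simp del: Tw_simps)
  qed
  ultimately show ?case by simp
next
  case (Suc n)
  interpret g: cone_data C "GL (Suc n)" "A (Suc n + 2)" "cn (Suc n)" "FT (Suc n + 2)"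
    using Suc.prems by (rule gl_data)
  interpret h: glue_data "Tw C" "AK n" "A2 C" "f n (n + 3)" proj1 by (rule HF_data)
  have IH: "dg_functor (GL (Suc n)) (AK n) (Q n)" "fun_eq_on (GL (Suc n)) (f n (n + 3) \<circ>\<circ> Q n) (cn (Suc n))"
    "\<And>j. j \<in> {1..n + 2} \<Longrightarrow> fun_eq_on (GL (Suc n)) (f n j \<circ>\<circ> Q n) (FT j \<circ>\<circ> pr (Suc n) j)"
    using Suc by auto
  \<comment> \<open>Both composites are the iterated cone functor of the lower part: the left one by
    the induction hypothesis, the right one because \<open>push\<close> has it as first
    entry.\<close>
  have "fun_eq_on (GG (Suc n)) (f n (n + 3) \<circ>\<circ> (Q n \<circ>\<circ> proj1)) (proj1 \<circ>\<circ> push (cn (Suc n)) (FT (n + 3)))"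
    using IH(2) by (auto intro!: fun_eq_onI simp: fun_eq_on_def glue_def simp del: Tw_simps)
  then have "dg_functor (GG (Suc n)) (HF n) (strict_pair (Tw C) (f n (n + 3))
      (Q n \<circ>\<circ> proj1) (push (cn (Suc n)) (FT (n + 3))))"
    using dg_functor_comp[OF g.glue_proj1 IH(1)] GG_push[OF Suc.prems]
    by (intro h.strict_pair_dg_functor) (auto simp: numeral_3_eq_3)
  then have "dg_functor (GL (Suc (Suc n))) (AK (Suc n)) (Q (Suc n))"
    unfolding GL_Suc[of "Suc n"] AK_Suc gl_to_ak.simps
    by (intro dg_functor_comp[OF next_fun_dg_functor next_emb_dg_functor] h.hfib_dg_category)
  moreover have "fun_eq_on (GL (Suc (Suc n))) (f (Suc n) (Suc n + 3) \<circ>\<circ> Q (Suc n)) (cn (Suc (Suc n)))"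
    by (auto intro!: fun_eq_onI simp: GL_Suc[of "Suc n"] f_Suc cn_Suc[of "Suc n"] cone_fun_def A2_f3_def
      glue_def numeral_3_eq_3 simp del: Tw_simps)
  moreover have "fun_eq_on (GL (Suc (Suc n))) (f (Suc n) j \<circ>\<circ> Q (Suc n)) (FT j \<circ>\<circ> pr (Suc (Suc n)) j)"
    if "j \<in> {1..Suc n + 2}" for j
    using that IH(3)[of j]
    by (auto intro!: fun_eq_onI simp: GL_Suc[of "Suc n"] f_Suc fun_eq_on_def glue_def numeral_3_eq_3 le_Suc_eq
       simp del: Tw_simps gl_proj.simps(1) simp: gl_proj.simps(2)[of "Suc n"])
  ultimately show ?case by blast
qed

end

section \<open>Morphisms and objects of the global sections\<close>

text \<open>In the encoding of a morphism of \<open>A\<^sub>k(C)\<close> as a sequence, the second entries are its components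
  at the homotopy fiber products, followed by padding.\<close>

definition path_free :: "('m, 'r::zero) itmor \<Rightarrow> bool" where
  "path_free u \<longleftrightarrow> (\<forall>m. snd (u m) = 0)"

lemma path_free_simps [simp]:
  "path_free (next_mor (u, g, h)) \<longleftrightarrow> h = 0 \<and> path_free u"
  "path_free (first_mor f)"
proof -
  show "path_free (next_mor (u, g, h)) \<longleftrightarrow> h = 0 \<and> path_free u"
    unfolding path_free_def next_mor_def
    by (auto split: nat.splits)
qed (auto simp: path_free_def first_mor_def split: nat.splits)

lemma triple_eq_0 [simp]: "(a, b, c) = 0 \<longleftrightarrow> a = 0 \<and> b = 0 \<and> c = 0"
  by (simp add: zero_prod_def)

text \<open>From here on \<open>Tw C\<close> is treated as an abstract dg category; its objects and
  morphisms are no longer unfolded to matrices.\<close>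

declare Tw_simps [simp del] fob_comp_fun [simp del] fmor_comp_fun [simp del] gl_proj.simps [simp del] gl_to_ak.simps [simp del]

context tw_category
begin

lemma AK_Suc_simps:
  "hom (AK (Suc n)) (next_ob (X, (x, x', m), \<mu>)) (next_ob (Y, (y, y', m'), \<xi>)) i =
    next_mor ` (hom (AK n) X Y i \<times> hom (A2 C) (x, x', m) (y, y', m') i \<times> hom (Tw C) (fob (f n (n + 3)) X) y (i - 1))"
  "dif (AK (Suc n)) (next_ob (X, (x, x', m), \<mu>)) (next_ob (Y, (y, y', m'), \<xi>)) i (next_mor (u, (p, q, l), h)) =
    next_mor (dif (AK n) X Y i u, dif (A2 C) (x, x', m) (y, y', m') i (p, q, l),
      - dif (Tw C) (fob (f n (n + 3)) X) y (i - 1) h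
      + cmp (Tw C) (fob (f n (n + 3)) X) x y i 0 p \<mu>
      - cmp (Tw C) (fob (f n (n + 3)) X) (fob (f n (n + 3)) Y) y 0 i \<xi> (fmor (f n (n + 3)) X Y i u))"
  unfolding AK_Suc by (simp_all add: hfib_def glue_def)

lemma f_Suc_simps:
  "fob (f (Suc n) j) (next_ob (X, (x, x', m), \<mu>)) =
    (if j \<le> n + 2 then fob (f n j) X else if j = n + 3 then x' else Cone x x' m)"
  "fmor (f (Suc n) j) (next_ob (X, (x, x', m), \<mu>)) (next_ob (Y, (y, y', m'), \<xi>)) i (next_mor (u, (p, q, l), h)) =
    (if j \<le> n + 2 then fmor (f n j) X Y i u else if j = n + 3 then q
     else fmor A2_f3 (x, x', m) (y, y', m') i (p, q, l))"
  unfolding f_Suc by (simp_all add: fob_comp_fun fmor_comp_fun A2_f3_def cone_fun_def)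

lemma f_0_simps:
  "fob (f 0 j) (First (x, x', m)) = (if j = 1 then x else if j = 2 then x' else Cone x x' m)"
  "fmor (f 0 j) (First (x, x', m)) (First (y, y', m')) i (first_mor (p, q, l)) =
    (if j = 1 then p else if j = 2 then q else fmor A2_f3 (x, x', m) (y, y', m') i (p, q, l))"
  unfolding f_0 by (simp_all add: A2_f3_def cone_fun_def)

lemma A2_simps:
  "(x, y, m) \<in> obj (A2 C) \<longleftrightarrow> x \<in> obj (Tw C) \<and> y \<in> obj (Tw C) \<and> m \<in> hom (Tw C) x y 0 \<and> dif (Tw C) x y 0 m = 0"
  "hom (A2 C) (x, y, m) (x', y', m') i = hom (Tw C) x x' i \<times> hom (Tw C) y y' i \<times> hom (Tw C) x y' (i - 1)"
  by (simp_all add: A2_def glue_def id_fun_def)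

end

context schober
begin

lemma GL_SucE:
  assumes "x \<in> obj (GL (Suc n))"
  obtains w a \<mu> where "x = next_ob (w, a, \<mu>)" "(w, a, \<mu>) \<in> obj (GG n)" "w \<in> obj (GL n)" "a \<in> obj (A (n + 2))"
    "\<mu> \<in> hom (Tw C) (fob (cn n) w) (fob (FT (n + 2)) a) 0"
    "dif (Tw C) (fob (cn n) w) (fob (FT (n + 2)) a) 0 \<mu> = 0"
  using assms unfolding GL_Suc by (auto simp: glue_def)

lemma GL_0E:
  assumes "x \<in> obj (GL 0)" obtains a where "x = First a" "a \<in> obj (A 1)"
  using assms unfolding GL_0 by auto

lemma GL_Suc_hom:
  "hom (GL (Suc n)) (next_ob (w, a, \<mu>)) (next_ob (w', a', \<mu>')) i = next_mor ` (hom (GL n) w w' i \<times>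
     hom (A (n + 2)) a a' i \<times> hom (Tw C) (fob (cn n) w) (fob (FT (n + 2)) a') (i - 1))"
  unfolding GL_Suc by (simp add: glue_def)

lemma GL_0_hom: "hom (GL 0) (First a) (First a') i = first_mor ` hom (A 1) a a' i"
  unfolding GL_0 by simp

lemma gl_proj_simps:
  "fob (pr (Suc n) j) (next_ob (w, a, \<mu>)) = (if j = n + 2 then a else fob (pr n j) w)"
  "fmor (pr (Suc n) j) (next_ob (w, a, \<mu>)) (next_ob (w', a', \<mu>')) i (next_mor (u, g, h)) =
    (if j = n + 2 then g else fmor (pr n j) w w' i u)"
  "fob (pr 0 j) (First a) = a"
  "fmor (pr 0 j) (First a) (First a') i (first_mor g') = g'"
  by (simp_all add: gl_proj.simps fob_comp_fun fmor_comp_fun)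

lemma Q_simps:
  "fob (Q 0) (next_ob (w, a, \<mu>)) = First (fob (cn 0) w, fob (FT 2) a, \<mu>)"
  "fmor (Q 0) (next_ob (w, a, \<mu>)) (next_ob (w', a', \<mu>')) i (next_mor (u, g, h)) =
     first_mor (fmor (cn 0) w w' i u, fmor (FT 2) a a' i g, h)"
  "fob (Q (Suc n)) (next_ob (w, a, \<mu>)) = next_ob (fob (Q n) w, (fob (cn (Suc n)) w, fob (FT (n + 3)) a, \<mu>),
     idt (Tw C) (fob (f n (n + 3)) (fob (Q n) w)))"
  "fmor (Q (Suc n)) (next_ob (w, a, \<mu>)) (next_ob (w', a', \<mu>')) i (next_mor (u, g, h)) =
     next_mor (fmor (Q n) w w' i u, (fmor (cn (Suc n)) w w' i u, fmor (FT (n + 3)) a a' i g, h), 0)"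
  by (simp_all add: gl_to_ak.simps fob_comp_fun fmor_comp_fun)

lemma cn_0_simps: "fob (cn 0) (First a) = fob (FT 1) a"
  "fmor (cn 0) (First a) (First a') i (first_mor g) = fmor (FT 1) a a' i g"
  by (simp_all add: cn_0)

lemma Q_dg_functor: "n + 2 \<le> k \<Longrightarrow> dg_functor (GL (Suc n)) (AK n) (Q n)"
  using Q_properties by blast

lemma Q_top:
  assumes "n + 2 \<le> k"
  shows "x \<in> obj (GL (Suc n)) \<Longrightarrow> fob (f n (n + 3)) (fob (Q n) x) = fob (cn (Suc n)) x"
    "x \<in> obj (GL (Suc n)) \<Longrightarrow> y \<in> obj (GL (Suc n)) \<Longrightarrow> u \<in> hom (GL (Suc n)) x y i \<Longrightarrow>
     fmor (f n (n + 3)) (fob (Q n) x) (fob (Q n) y) i (fmor (Q n) x y i u) = fmor (cn (Suc n)) x y i u"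
  using Q_properties[OF assms] by (auto simp: fun_eq_on_def fob_comp_fun fmor_comp_fun)

lemma Q_side:
  assumes "n + 2 \<le> k" "j \<in> {1..n + 2}"
  shows "x \<in> obj (GL (Suc n)) \<Longrightarrow> fob (f n j) (fob (Q n) x) = fob (FT j) (fob (pr (Suc n) j) x)"
    "x \<in> obj (GL (Suc n)) \<Longrightarrow> y \<in> obj (GL (Suc n)) \<Longrightarrow> u \<in> hom (GL (Suc n)) x y i \<Longrightarrow>
     fmor (f n j) (fob (Q n) x) (fob (Q n) y) i (fmor (Q n) x y i u) =
       fmor (FT j) (fob (pr (Suc n) j) x) (fob (pr (Suc n) j) y) i (fmor (pr (Suc n) j) x y i u)"
proof -
  have "fun_eq_on (GL (Suc n)) (f n j \<circ>\<circ> Q n) (FT j \<circ>\<circ> pr (Suc n) j)"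
    using Q_properties[OF assms(1)] assms(2) by blast
  then show "x \<in> obj (GL (Suc n)) \<Longrightarrow> fob (f n j) (fob (Q n) x) = fob (FT j) (fob (pr (Suc n) j) x)"
    "x \<in> obj (GL (Suc n)) \<Longrightarrow> y \<in> obj (GL (Suc n)) \<Longrightarrow> u \<in> hom (GL (Suc n)) x y i \<Longrightarrow>
     fmor (f n j) (fob (Q n) x) (fob (Q n) y) i (fmor (Q n) x y i u) =
       fmor (FT j) (fob (pr (Suc n) j) x) (fob (pr (Suc n) j) y) i (fmor (pr (Suc n) j) x y i u)"
    by (auto simp: fun_eq_on_def fob_comp_fun fmor_comp_fun)
qed

lemma fob_FT: "j \<in> {1..k} \<Longrightarrow> a \<in> obj (A j) \<Longrightarrow> fob (FT j) a \<in> obj (Tw C)"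
  using F_dg_functor by (rule dg_functor.fob_obj)

lemma fob_cn: "n + 1 \<le> k \<Longrightarrow> x \<in> obj (GL n) \<Longrightarrow> fob (cn n) x \<in> obj (Tw C)"
  using cn_dg_functor by (rule dg_functor.fob_obj)

section \<open>Morphism complexes: injectivity and image of the comparison\<close>

lemma Q_path_free:
  assumes "n + 2 \<le> k" "x \<in> obj (GL (Suc n))" "y \<in> obj (GL (Suc n))" "u \<in> hom (GL (Suc n)) x y i"
  shows "path_free (fmor (Q n) x y i u)"
  using assms
proof (induction n arbitrary: x y u)
  case 0
  show ?case
    using 0(2-4) by (elim GL_SucE) (auto simp: Q_simps GL_Suc_hom)
next
  case (Suc n)
  show ?case
    using Suc.prems(2-4) Suc.IH Suc.prems(1) by (elim GL_SucE[of _ "Suc n"]) (auto simp: Q_simps GL_Suc_hom[of "Suc n"])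
qed

text \<open>The gluing entries h are stored unchanged in the \<open>A2 C\<close> parts, so vanishing
  under \<open>Q n\<close> kills them. The components in \<open>A j\<close> appear there only
  through F_j and have to be tested by the projections.\<close>

lemma Q_inj:
  assumes "n + 2 \<le> k" "x \<in> obj (GL (Suc n))" "y \<in> obj (GL (Suc n))" "u \<in> hom (GL (Suc n)) x y i"
    and "fmor (Q n) x y i u = 0" "\<And>j. j \<in> {1..n + 2} \<Longrightarrow> fmor (pr (Suc n) j) x y i u = 0"
  shows "u = 0"
  using assms
proof (induction n arbitrary: x y u)
  case 0
  obtain w a \<mu> where x: "x = next_ob (w, a, \<mu>)" "w \<in> obj (GL 0)" using 0(2) by (rule GL_SucE)
  obtain w' a' \<mu>' where y: "y = next_ob (w', a', \<mu>')" "w' \<in> obj (GL 0)" using 0(3) by (rule GL_SucE)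
  obtain b b' where w: "w = First b" "w' = First b'" using x(2) y(2) by (metis GL_0E)
  obtain g1 g2 h where u: "u = next_mor (first_mor g1, g2, h)"
    using 0(4) unfolding x(1) y(1) w by (auto simp: GL_Suc_hom GL_0_hom)
  have g: "g1 = 0" "g2 = 0"
    using 0(6)[of 1] 0(6)[of 2] unfolding x(1) y(1) w u by (simp_all add: gl_proj_simps)
  have "fmor (Q 0) x y i u = 0" by (rule 0(5))
  then have "h = 0" unfolding x(1) y(1) w u Q_simps first_next_eq_0 triple_eq_0 by blast
  then show ?case unfolding u g first_next_eq_0 triple_eq_0 by simp
next
  case (Suc n)
  obtain w a \<mu> where x: "x = next_ob (w, a, \<mu>)" "w \<in> obj (GL (Suc n))" using Suc.prems(2) by (rule GL_SucE)
  obtain w' a' \<mu>' where y: "y = next_ob (w', a', \<mu>')" "w' \<in> obj (GL (Suc n))" using Suc.prems(3) by (rule GL_SucE)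
  obtain u0 g h where u: "u = next_mor (u0, g, h)" and u0: "u0 \<in> hom (GL (Suc n)) w w' i"
    using Suc.prems(4) unfolding x(1) y(1) by (auto simp: GL_Suc_hom)
  have 0: "fmor (Q n) w w' i u0 = 0" "h = 0"
    using Suc.prems(5) unfolding x(1) y(1) u Q_simps first_next_eq_0 triple_eq_0 by blast+
  have "g = 0" using Suc.prems(6)[of "n + 3"] unfolding x(1) y(1) u by (simp add: gl_proj_simps)
  moreover have "u0 = 0"
  proof (rule Suc.IH[OF _ x(2) y(2) u0 0(1)])
    fix j assume "j \<in> {1..n + 2}"
    then show "fmor (pr (Suc n) j) w w' i u0 = 0"
      using Suc.prems(6)[of j] unfolding x(1) y(1) u by (simp add: gl_proj_simps)
  qed (use Suc.prems in simp)
  ultimately show ?case unfolding u first_next_eq_0 triple_eq_0 using 0(2) by blast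
qed

text \<open>Since the structure morphisms of the objects in the image are identities, the path components
  of a morphism can be prescribed freely, modulo boundaries.\<close>

lemma path_components_exact:
  assumes "n + 2 \<le> k" "x \<in> obj (GL (Suc n))" "y \<in> obj (GL (Suc n))"
    and "z \<in> hom (AK n) (fob (Q n) x) (fob (Q n) y) i"
    and "\<And>j. j \<in> {1..n + 2} \<Longrightarrow>
      \<nu> j \<in> hom (Tw C) (fob (f n j) (fob (Q n) x)) (fob (f n j) (fob (Q n) y)) (i - 1)"
  shows "\<exists>t\<in>hom (AK n) (fob (Q n) x) (fob (Q n) y) (i - 1).
    (\<forall>j\<in>{1..n + 2}. fmor (f n j) (fob (Q n) x) (fob (Q n) y) (i - 1) t = \<nu> j) \<and>
    path_free (z - dif (AK n) (fob (Q n) x) (fob (Q n) y) (i - 1) t)"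
  using assms
proof (induction n arbitrary: x y z)
  case 0
  obtain w a \<mu> where x: "x = next_ob (w, a, \<mu>)" "w \<in> obj (GL 0)" "a \<in> obj (A 2)"
    using 0(2) by (rule GL_SucE[where n = 0, unfolded add_0]) blast
  obtain w' a' \<mu>' where y: "y = next_ob (w', a', \<mu>')" "w' \<in> obj (GL 0)" "a' \<in> obj (A 2)"
    using 0(3) by (rule GL_SucE[where n = 0, unfolded add_0]) blast
  obtain z' where z: "z = first_mor z'"
    using 0(4) unfolding x(1) y(1) AK_0 Q_simps by auto
  have \<nu>: "\<nu> 1 \<in> hom (Tw C) (fob (cn 0) w) (fob (cn 0) w') (i - 1)"
    "\<nu> 2 \<in> hom (Tw C) (fob (FT 2) a) (fob (FT 2) a') (i - 1)"
    using 0(5)[of 1] 0(5)[of 2] unfolding x(1) y(1) Q_simps f_0_simps by simp_all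
  have ob: "fob (cn 0) w \<in> obj (Tw C)" "fob (FT 2) a' \<in> obj (Tw C)"
    using fob_cn[of 0 w] fob_FT[of 2 a'] x y 0(1) by simp_all
  \<comment> \<open>\<open>A2 C\<close> has no path entries, so nothing has to be corrected and the
    two prescribed components are completed by zero.\<close>
  have "(\<nu> 1, \<nu> 2, 0) \<in> hom (A2 C) (fob (cn 0) w, fob (FT 2) a, \<mu>) (fob (cn 0) w', fob (FT 2) a', \<mu>') (i - 1)"
    using \<nu> ob by (simp add: A2_simps)
  then show ?case
    unfolding x(1) y(1) Q_simps AK_0 f_0_simps z
    by (intro bexI[of _ "first_mor (\<nu> 1, \<nu> 2, 0)"]) (auto simp: f_0_simps first_mor_diff le_Suc_eq numeral_2_eq_2)
next
  case (Suc n)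
  have n3: "n + 3 \<in> {1..k}" "n + 2 \<le> k" using Suc.prems(1) by auto
  have n3': "Suc n + 2 = n + 3" by simp
  interpret Q: dg_functor "GL (Suc n)" "AK n" "Q n" using n3 by (intro Q_dg_functor)
  interpret f: dg_functor "AK n" "Tw C" "f n (n + 3)" by (rule f_dg_functor)
  obtain w a \<mu> where x: "x = next_ob (w, a, \<mu>)" "w \<in> obj (GL (Suc n))" "a \<in> obj (A (n + 3))"
    using Suc.prems(2) unfolding n3'[symmetric] by (rule GL_SucE)
  obtain w' a' \<mu>' where y: "y = next_ob (w', a', \<mu>')" "w' \<in> obj (GL (Suc n))" "a' \<in> obj (A (n + 3))"
    using Suc.prems(3) unfolding n3'[symmetric] by (rule GL_SucE)
  note top = Q_top(1)[OF n3(2) x(2)] Q_top(1)[OF n3(2) y(2)]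
  obtain z0 p q h l where z: "z = next_mor (z0, (p, q, h), l)"
    and z0: "z0 \<in> hom (AK n) (fob (Q n) w) (fob (Q n) w') i"
    and l: "l \<in> hom (Tw C) (fob (cn (Suc n)) w) (fob (cn (Suc n)) w') (i - 1)"
    using Suc.prems(4) unfolding x(1) y(1) Q_simps AK_Suc_simps by (auto simp: top)
  have "\<exists>t\<in>hom (AK n) (fob (Q n) w) (fob (Q n) w') (i - 1).
    (\<forall>j\<in>{1..n + 2}. fmor (f n j) (fob (Q n) w) (fob (Q n) w') (i - 1) t = \<nu> j) \<and>
    path_free (z0 - dif (AK n) (fob (Q n) w) (fob (Q n) w') (i - 1) t)"
  proof (rule Suc.IH[OF n3(2) x(2) y(2) z0])
    fix j assume "j \<in> {1..n + 2}"
    then show "\<nu> j \<in> hom (Tw C) (fob (f n j) (fob (Q n) w)) (fob (f n j) (fob (Q n) w')) (i - 1)"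
      using Suc.prems(5)[of j] unfolding x(1) y(1) Q_simps f_Suc_simps by simp
  qed
  then obtain t0 where t0: "t0 \<in> hom (AK n) (fob (Q n) w) (fob (Q n) w') (i - 1)"
    "\<And>j. j \<in> {1..n + 2} \<Longrightarrow> fmor (f n j) (fob (Q n) w) (fob (Q n) w') (i - 1) t0 = \<nu> j"
    "path_free (z0 - dif (AK n) (fob (Q n) w) (fob (Q n) w') (i - 1) t0)" by blast
  have \<nu>: "\<nu> (n + 3) \<in> hom (Tw C) (fob (FT (n + 3)) a) (fob (FT (n + 3)) a') (i - 1)"
    using Suc.prems(5)[of "n + 3"] unfolding x(1) y(1) Q_simps f_Suc_simps by simp
  have ob: "fob (cn (Suc n)) w \<in> obj (Tw C)" "fob (cn (Suc n)) w' \<in> obj (Tw C)" "fob (FT (n + 3)) a' \<in> obj (Tw C)"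
    using fob_cn[of "Suc n"] fob_FT[OF n3(1)] x y n3 by simp_all
  define r where "r = fmor (f n (n + 3)) (fob (Q n) w) (fob (Q n) w') (i - 1) t0"
  have r: "r \<in> hom (Tw C) (fob (cn (Suc n)) w) (fob (cn (Suc n)) w') (i - 1)"
    using f.fmor_hom[of "fob (Q n) w" "fob (Q n) w'" t0 "i - 1"] x(2) y(2) t0 by (simp add: r_def top)
  \<comment> \<open>With identities as structure morphisms and zero path entry, the path entry of d
    t is the first \<open>A2 C\<close> component minus r, the image of the lower part
    \<open>t0\<close>. Choosing \<open>l + r\<close> for that component makes the entry equal to
    \<open>l\<close>, which cancels that of z.\<close>
  define t where "t = next_mor (t0, (l + r, \<nu> (n + 3), 0), 0)"
  have "t \<in> hom (AK (Suc n)) (fob (Q (Suc n)) x) (fob (Q (Suc n)) y) (i - 1)"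
    unfolding x(1) y(1) Q_simps AK_Suc_simps t_def using t0 l r \<nu> ob by (simp add: A2_simps top)
  moreover have "fmor (f (Suc n) j) (fob (Q (Suc n)) x) (fob (Q (Suc n)) y) (i - 1) t = \<nu> j"
    if "j \<in> {1..Suc n + 2}" for j
  proof (cases "j \<le> n + 2")
    case True
    then show ?thesis using t0(2)[of j] that unfolding x(1) y(1) Q_simps f_Suc_simps t_def by simp
  next
    case False
    then have "j = n + 3" using that by simp
    then show ?thesis unfolding x(1) y(1) Q_simps f_Suc_simps t_def by simp
  qed
  moreover have "path_free (z - dif (AK (Suc n)) (fob (Q (Suc n)) x) (fob (Q (Suc n)) y) (i - 1) t)"
    unfolding x(1) y(1) Q_simps AK_Suc_simps t_def z next_mor_diff using t0(3) l r ob
    by (simp add: top r_def[symmetric])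
  ultimately show ?case by blast
qed

text \<open>A path-free z may have a first \<open>A2 C\<close> component unrelated to its lower
  part, and then does not come from the gluing. Path-freeness of d z is what ties the two together;
  the remaining components have the preimages \<open>g j\<close> by assumption.\<close>

lemma path_free_in_image:
  assumes "n + 2 \<le> k" "x \<in> obj (GL (Suc n))" "y \<in> obj (GL (Suc n))"
    and "z \<in> hom (AK n) (fob (Q n) x) (fob (Q n) y) i"
    and "path_free z" "path_free (dif (AK n) (fob (Q n) x) (fob (Q n) y) i z)"
    and "\<And>j. j \<in> {1..n + 2} \<Longrightarrow> g j \<in> hom (A j) (fob (pr (Suc n) j) x) (fob (pr (Suc n) j) y) i"
    and "\<And>j. j \<in> {1..n + 2} \<Longrightarrow> fmor (f n j) (fob (Q n) x) (fob (Q n) y) i z =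
      fmor (FT j) (fob (pr (Suc n) j) x) (fob (pr (Suc n) j) y) i (g j)"
  shows "\<exists>u\<in>hom (GL (Suc n)) x y i. fmor (Q n) x y i u = z \<and>
    (\<forall>j\<in>{1..n + 2}. fmor (pr (Suc n) j) x y i u = g j)"
  using assms
proof (induction n arbitrary: x y z)
  case 0
  obtain w a \<mu> where x: "x = next_ob (w, a, \<mu>)" "w \<in> obj (GL 0)" using 0(2) by (rule GL_SucE)
  obtain w' a' \<mu>' where y: "y = next_ob (w', a', \<mu>')" "w' \<in> obj (GL 0)" using 0(3) by (rule GL_SucE)
  obtain b b' where w: "w = First b" "w' = First b'" using x(2) y(2) by (metis GL_0E)
  obtain p q h where z: "z = first_mor (p, q, h)" and h: "h \<in> hom (Tw C) (fob (FT 1) b) (fob (FT 2) a') (i - 1)"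
    using 0(4) unfolding x(1) y(1) w AK_0 Q_simps cn_0_simps by (auto simp: A2_simps)
  have pq: "p = fmor (FT 1) b b' i (g 1)" "q = fmor (FT 2) a a' i (g 2)"
    using 0(8)[of 1] 0(8)[of 2] unfolding x(1) y(1) w z Q_simps f_0_simps cn_0_simps by (simp_all add: gl_proj_simps)
  have g: "g 1 \<in> hom (A 1) b b' i" "g 2 \<in> hom (A 2) a a' i"
    using 0(7)[of 1] 0(7)[of 2] unfolding x(1) y(1) w by (simp_all add: gl_proj_simps)
  show ?case
    unfolding x(1) y(1) w z pq
    by (intro bexI[of _ "next_mor (first_mor (g 1), g 2, h)"])
      (use g h in \<open>auto simp: GL_Suc_hom GL_0_hom Q_simps cn_0_simps gl_proj_simps le_Suc_eq numeral_2_eq_2\<close>)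
next
  case (Suc n)
  have n3: "n + 3 \<in> {1..k}" "n + 2 \<le> k" using Suc.prems(1) by auto
  have n3': "Suc n + 2 = n + 3" by simp
  interpret Q: dg_functor "GL (Suc n)" "AK n" "Q n" using n3 by (intro Q_dg_functor)
  interpret f: dg_functor "AK n" "Tw C" "f n (n + 3)" by (rule f_dg_functor)
  obtain w a \<mu> where x: "x = next_ob (w, a, \<mu>)" "w \<in> obj (GL (Suc n))" "a \<in> obj (A (n + 3))"
    using Suc.prems(2) unfolding n3'[symmetric] by (rule GL_SucE)
  obtain w' a' \<mu>' where y: "y = next_ob (w', a', \<mu>')" "w' \<in> obj (GL (Suc n))" "a' \<in> obj (A (n + 3))"
    using Suc.prems(3) unfolding n3'[symmetric] by (rule GL_SucE)
  note top = Q_top(1)[OF n3(2) x(2)] Q_top(1)[OF n3(2) y(2)]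
  have ob: "fob (cn (Suc n)) w \<in> obj (Tw C)" "fob (cn (Suc n)) w' \<in> obj (Tw C)"
    using fob_cn[of "Suc n"] x y n3 by simp_all
  obtain z0 p q h l where z: "z = next_mor (z0, (p, q, h), l)"
    and z0: "z0 \<in> hom (AK n) (fob (Q n) w) (fob (Q n) w') i"
    and p: "p \<in> hom (Tw C) (fob (cn (Suc n)) w) (fob (cn (Suc n)) w') i"
    and h: "h \<in> hom (Tw C) (fob (cn (Suc n)) w) (fob (FT (n + 3)) a') (i - 1)"
    using Suc.prems(4) unfolding x(1) y(1) Q_simps AK_Suc_simps by (auto simp: top A2_simps)
  have l: "l = 0" "path_free z0" using Suc.prems(5) by (simp_all add: z)
  define r where "r = fmor (f n (n + 3)) (fob (Q n) w) (fob (Q n) w') i z0"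
  have r: "r \<in> hom (Tw C) (fob (cn (Suc n)) w) (fob (cn (Suc n)) w') i"
    using f.fmor_hom[of "fob (Q n) w" "fob (Q n) w'" z0 i] x(2) y(2) z0 by (simp add: r_def top)
  \<comment> \<open>As \<open>l\<close> is zero and the structure morphisms are identities, the path
    entry of d z is p - r, so it vanishes only for p = r.\<close>
  have "path_free (dif (AK n) (fob (Q n) w) (fob (Q n) w') i z0)" and pr: "p = r"
    using Suc.prems(6) unfolding x(1) y(1) Q_simps z AK_Suc_simps using ob p r
    by (simp_all add: top l r_def[symmetric])
  then have "\<exists>u\<in>hom (GL (Suc n)) w w' i. fmor (Q n) w w' i u = z0 \<and>
    (\<forall>j\<in>{1..n + 2}. fmor (pr (Suc n) j) w w' i u = g j)"
  proof (intro Suc.IH[OF n3(2) x(2) y(2) z0 l(2)])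
    fix j assume j: "j \<in> {1..n + 2}"
    then show "g j \<in> hom (A j) (fob (pr (Suc n) j) w) (fob (pr (Suc n) j) w') i"
      using Suc.prems(7)[of j] unfolding x(1) y(1) by (simp add: gl_proj_simps)
    show "fmor (f n j) (fob (Q n) w) (fob (Q n) w') i z0 =
      fmor (FT j) (fob (pr (Suc n) j) w) (fob (pr (Suc n) j) w') i (g j)"
      using Suc.prems(8)[of j] j unfolding x(1) y(1) z Q_simps f_Suc_simps by (simp add: gl_proj_simps)
  qed
  then obtain u where u: "u \<in> hom (GL (Suc n)) w w' i" "fmor (Q n) w w' i u = z0"
    "\<And>j. j \<in> {1..n + 2} \<Longrightarrow> fmor (pr (Suc n) j) w w' i u = g j" by blast
  have q: "q = fmor (FT (n + 3)) a a' i (g (n + 3))"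
    using Suc.prems(8)[of "n + 3"] unfolding x(1) y(1) z Q_simps f_Suc_simps by (simp add: gl_proj_simps)
  have g: "g (n + 3) \<in> hom (A (n + 3)) a a' i"
    using Suc.prems(7)[of "n + 3"] unfolding x(1) y(1) by (simp add: gl_proj_simps)
  have p: "p = fmor (cn (Suc n)) w w' i u"
    unfolding pr r_def u(2)[symmetric] by (rule Q_top(2)[OF n3(2) x(2) y(2) u(1)])
  have "next_mor (u, g (n + 3), h) \<in> hom (GL (Suc (Suc n))) x y i"
    unfolding x(1) y(1) GL_Suc_hom n3' using u(1) g h by simp
  moreover have "fmor (Q (Suc n)) x y i (next_mor (u, g (n + 3), h)) = z"
    unfolding x(1) y(1) Q_simps z by (simp add: u p q l)
  moreover have "fmor (pr (Suc (Suc n)) j) x y i (next_mor (u, g (n + 3), h)) = g j" if "j \<in> {1..Suc n + 2}" for j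
    unfolding x(1) y(1) gl_proj_simps n3' using that u(3)[of j] by auto
  ultimately show ?case by blast
qed

text \<open>Induction along the chain of fiber products: the equivalence found for the lower part,
  followed by the given structure morphism, identifies its cone with the source of the next piece,
  and \<open>A2_lift\<close> then produces the next \<mu>. The components at the f_j are kept equal
  to \<open>\<nu> j\<close> throughout, as the outermost fiber product requires.\<close>

lemma object_lift:
  assumes "n + 2 \<le> k" "X \<in> obj (AK n)" "\<And>j. j \<in> {1..n + 2} \<Longrightarrow> a j \<in> obj (A j)"
    and "\<And>j. j \<in> {1..n + 2} \<Longrightarrow> hiso (Tw C) (fob (FT j) (a j)) (fob (f n j) X) (\<nu> j)"
  shows "\<exists>w\<in>obj (GL (Suc n)). (\<forall>j\<in>{1..n + 2}. fob (pr (Suc n) j) w = a j) \<and>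
    (\<exists>\<Phi>. hiso (AK n) (fob (Q n) w) X \<Phi> \<and> (\<forall>j\<in>{1..n + 2}. fmor (f n j) (fob (Q n) w) X 0 \<Phi> = \<nu> j))"
  using assms
proof (induction n arbitrary: X)
  case 0
  obtain x x' m where X: "X = First (x, x', m)" and xm: "(x, x', m) \<in> obj (A2 C)"
    using 0(2) unfolding AK_0 by auto
  have ob: "fob (FT 1) (a 1) \<in> tw_obj C" "fob (FT 2) (a 2) \<in> tw_obj C"
    using fob_FT[of 1 "a 1"] fob_FT[of 2 "a 2"] 0(1,3) by (simp_all add: Tw_simps)
  have \<nu>: "hiso (Tw C) (fob (FT 1) (a 1)) x (\<nu> 1)" "hiso (Tw C) (fob (FT 2) (a 2)) x' (\<nu> 2)"
    using 0(4)[of 1] 0(4)[of 2] unfolding X f_0_simps by simp_all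
  obtain \<mu> h where \<mu>: "(fob (FT 1) (a 1), fob (FT 2) (a 2), \<mu>) \<in> obj (A2 C)"
    and h: "hiso (A2 C) (fob (FT 1) (a 1), fob (FT 2) (a 2), \<mu>) (x, x', m) (\<nu> 1, \<nu> 2, h)"
    using A2_lift[OF ob xm \<nu>] by blast
  define w where "w = next_ob (First (a 1), a 2, \<mu>)"
  have w: "w \<in> obj (GL (Suc 0))"
    unfolding w_def GL_Suc next_cat_simps mem_next_ob
    using \<mu> 0(3)[of 1] 0(3)[of 2] by (simp add: glue_def GL_0 cn_0_simps A2_simps numeral_2_eq_2)
  have proj: "fob (pr (Suc 0) j) w = a j" if "j \<in> {1..0 + 2}" for j
  proof -
    have "j = 1 \<or> j = 2" using that by auto
    then show ?thesis unfolding w_def by (auto simp: gl_proj_simps numeral_2_eq_2)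
  qed
  have Qw: "fob (Q 0) w = First (fob (FT 1) (a 1), fob (FT 2) (a 2), \<mu>)"
    unfolding w_def Q_simps cn_0_simps ..
  interpret e: dg_functor "A2 C" "AK 0" first_emb
    unfolding AK_0 by (intro first_emb_dg_functor T.dg_category_axioms dg_functor.axioms(1)[OF A2_proj(1)])
  have "hiso (AK 0) (fob (Q 0) w) X (first_mor (\<nu> 1, \<nu> 2, h))"
    using e.hiso_fmor[OF \<mu> xm h] unfolding Qw X emb_simps .
  moreover have "fmor (f 0 j) (fob (Q 0) w) X 0 (first_mor (\<nu> 1, \<nu> 2, h)) = \<nu> j" if "j \<in> {1..0 + 2}" for j
  proof -
    have "j = 1 \<or> j = 2" using that by auto
    then show ?thesis unfolding Qw X f_0_simps by auto
  qed
  ultimately show ?case using w proj by blast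
next
  case (Suc n)
  have n3: "n + 3 \<in> {1..k}" "n + 2 \<le> k" using Suc.prems(1) by auto
  interpret f: dg_functor "AK n" "Tw C" "f n (n + 3)" by (rule f_dg_functor)
  interpret h: glue_data "Tw C" "AK n" "A2 C" "f n (n + 3)" proj1 by (rule HF_data)
  interpret Q: dg_functor "GL (Suc n)" "AK n" "Q n" using n3 by (intro Q_dg_functor)
  interpret Q': dg_functor "GL (Suc (Suc n))" "AK (Suc n)" "Q (Suc n)" using Suc.prems(1) by (rule Q_dg_functor)
  obtain Z where Z: "X = next_ob Z" "Z \<in> obj (HF n)"
    using Suc.prems(2) unfolding AK_Suc next_cat_simps by blast
  obtain X0 x x' m l where Z_eq: "Z = (X0, (x, x', m), l)" by (metis surj_pair)
  note X = Z(1)[unfolded Z_eq] and XH = Z(2)[unfolded Z_eq]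
  have XG: "(X0, (x, x', m), l) \<in> obj h.G" using XH h.hfib_obj by blast
  then have X0: "X0 \<in> obj (AK n)" and xm: "(x, x', m) \<in> obj (A2 C)"
    and l: "l \<in> hom (Tw C) (fob (f n (n + 3)) X0) x 0" "dif (Tw C) (fob (f n (n + 3)) X0) x 0 l = 0"
    by auto
  have x_ob: "x \<in> obj (Tw C)" using xm by (simp add: A2_simps)
  have "hiso (Tw C) (fob (f n (n + 3)) X0) x l"
    using h.hfib_iso[OF XH] T.iso_in_H0_iff[OF f.fob_obj[OF X0] x_ob l] by (simp add: T.cls_def)
  have "\<exists>w\<in>obj (GL (Suc n)). (\<forall>j\<in>{1..n + 2}. fob (pr (Suc n) j) w = a j) \<and>
    (\<exists>\<Phi>. hiso (AK n) (fob (Q n) w) X0 \<Phi> \<and> (\<forall>j\<in>{1..n + 2}. fmor (f n j) (fob (Q n) w) X0 0 \<Phi> = \<nu> j))"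
  proof (rule Suc.IH[OF n3(2) X0])
    fix j assume j: "j \<in> {1..n + 2}"
    then show "a j \<in> obj (A j)" using Suc.prems(3) by simp
    show "hiso (Tw C) (fob (FT j) (a j)) (fob (f n j) X0) (\<nu> j)"
      using Suc.prems(4)[of j] j unfolding X f_Suc_simps by simp
  qed
  then obtain w \<Phi> where w: "w \<in> obj (GL (Suc n))" "\<And>j. j \<in> {1..n + 2} \<Longrightarrow> fob (pr (Suc n) j) w = a j"
    and \<Phi>: "hiso (AK n) (fob (Q n) w) X0 \<Phi>" "\<And>j. j \<in> {1..n + 2} \<Longrightarrow> fmor (f n j) (fob (Q n) w) X0 0 \<Phi> = \<nu> j"
    by blast
  note top = Q_top(1)[OF n3(2) w(1)]
  define c where "c = fmor (f n (n + 3)) (fob (Q n) w) X0 0 \<Phi>"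
  have c: "hiso (Tw C) (fob (cn (Suc n)) w) (fob (f n (n + 3)) X0) c"
    using f.hiso_fmor[OF Q.fob_obj[OF w(1)] X0 \<Phi>(1)] by (simp add: c_def top)
  have cw: "fob (cn (Suc n)) w \<in> obj (Tw C)" using fob_cn[of "Suc n" w] w n3 by simp
  have an: "a (n + 3) \<in> obj (A (n + 3))" using Suc.prems(3)[of "n + 3"] by simp
  have Fa: "fob (FT (n + 3)) (a (n + 3)) \<in> obj (Tw C)" using an n3 by (intro fob_FT)
  \<comment> \<open>The image of the gluing has an identity as structure morphism, so with zero path
    entry closedness of the lifted morphism reads \<alpha> = l c. This leaves no choice for
    \<alpha>.\<close>
  define \<alpha> where "\<alpha> = cmp (Tw C) (fob (cn (Suc n)) w) (fob (f n (n + 3)) X0) x 0 0 l c"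
  have \<alpha>: "hiso (Tw C) (fob (cn (Suc n)) w) x \<alpha>"
    unfolding \<alpha>_def by (rule T.hiso_comp[OF cw f.fob_obj[OF X0] x_ob c]) fact
  have \<nu>: "hiso (Tw C) (fob (FT (n + 3)) (a (n + 3))) x' (\<nu> (n + 3))"
    using Suc.prems(4)[of "n + 3"] unfolding X f_Suc_simps by simp
  obtain \<mu> r where \<mu>: "(fob (cn (Suc n)) w, fob (FT (n + 3)) (a (n + 3)), \<mu>) \<in> obj (A2 C)"
    and r: "hiso (A2 C) (fob (cn (Suc n)) w, fob (FT (n + 3)) (a (n + 3)), \<mu>) (x, x', m) (\<alpha>, \<nu> (n + 3), r)"
    using A2_lift[OF cw[unfolded Tw_simps] Fa[unfolded Tw_simps] xm \<alpha> \<nu>] by blast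
  define w' where "w' = next_ob (w, a (n + 3), \<mu>)"
  have n3': "Suc n + 2 = n + 3" by simp
  have w': "w' \<in> obj (GL (Suc (Suc n)))"
    unfolding w'_def GL_Suc[of "Suc n"] next_cat_simps mem_next_ob n3'
    using \<mu> w an by (simp add: glue_def A2_simps)
  let ?Qw = "(fob (Q n) w, (fob (cn (Suc n)) w, fob (FT (n + 3)) (a (n + 3)), \<mu>), idt (Tw C) (fob (cn (Suc n)) w))"
  have Qw: "fob (Q (Suc n)) w' = next_ob ?Qw"
    unfolding w'_def Q_simps top ..
  have QH: "?Qw \<in> obj (HF n)"
    using Q'.fob_obj[OF w'] unfolding Qw unfolding AK_Suc next_cat_simps mem_next_ob .
  then have QG: "?Qw \<in> obj h.G" using h.hfib_obj by blast
  note c_hom = hiso_hom[OF \<alpha>] hiso_hom[OF c] hiso_hom[OF r] hiso_closed[OF r] hiso_hom[OF \<Phi>(1)] hiso_closed[OF \<Phi>(1)]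
  have "hiso h.G ?Qw (X0, (x, x', m), l) (\<Phi>, (\<alpha>, \<nu> (n + 3), r), 0)"
  proof (rule h.hiso_glue[OF QG XG _ _ \<Phi>(1) r])
    show "(\<Phi>, (\<alpha>, \<nu> (n + 3), r), 0) \<in> hom h.G ?Qw (X0, (x, x', m), l) 0"
      using c_hom x_ob cw by (simp add: top)
    show "dif h.G ?Qw (X0, (x, x', m), l) 0 (\<Phi>, (\<alpha>, \<nu> (n + 3), r), 0) = 0"
      using c_hom x_ob cw by (simp add: top c_def[symmetric] \<alpha>_def[symmetric])
  qed
  \<comment> \<open>The fiber product is a full subcategory of the gluing, so inverse and homotopies
    remain available.\<close>
  then have "hiso (HF n) ?Qw (X0, (x, x', m), l) (\<Phi>, (\<alpha>, \<nu> (n + 3), r), 0)"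
    by (simp add: hiso_def del: h.glue_hom h.glue_dif h.glue_cmp h.glue_idt)
  then have "hiso (AK (Suc n)) (fob (Q (Suc n)) w') X (next_mor (\<Phi>, (\<alpha>, \<nu> (n + 3), r), 0))"
    using dg_functor.hiso_fmor[OF next_emb_dg_functor[OF h.hfib_dg_category] QH XH]
    unfolding Qw X emb_simps unfolding AK_Suc by blast
  moreover have "fmor (f (Suc n) j) (fob (Q (Suc n)) w') X 0 (next_mor (\<Phi>, (\<alpha>, \<nu> (n + 3), r), 0)) = \<nu> j"
    if "j \<in> {1..Suc n + 2}" for j
    using that \<Phi>(2)[of j] unfolding Qw X f_Suc_simps by (auto simp: le_Suc_eq numeral_3_eq_3)
  moreover have "fob (pr (Suc (Suc n)) j) w' = a j" if "j \<in> {1..Suc n + 2}" for j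
    using that w(2)[of j] unfolding w'_def gl_proj_simps by (auto simp: le_Suc_eq numeral_3_eq_3)
  ultimately show ?case using w' by blast
qed

section \<open>Comparison with the global sections\<close>

definition gl_to_sections where
  "gl_to_sections I n = strict_pair (prod_cat I (\<lambda>_. Tw C)) (prod_fun I (\<lambda>i. FT i))
     (tuple_fun I (pr (Suc n))) (Q n)"

lemma gluing_equivalence:
  assumes k: "k = n + 2" and Ik: "I = {1..k}"
  shows "quasi_equivalence (GL (Suc n))
    (hfib (prod_cat I (\<lambda>_. Tw C)) (prod_cat I A) (AK n) (prod_fun I (\<lambda>i. FT i)) (tuple_fun I (f n)))
    (gl_to_sections I n)"
proof -
  let ?F1 = "prod_fun I (\<lambda>i. FT i)" and ?F2 = "tuple_fun I (f n)" and ?P = "tuple_fun I (pr (Suc n))"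
  let ?Q = "gl_to_sections I n"
  have nk: "n + 2 \<le> k" using k by simp
  have I: "I = {1..n + 2}" unfolding Ik k ..
  have F_I: "dg_functor (A i) (Tw C) (FT i)" if "i \<in> I" for i using F_dg_functor that unfolding Ik .
  interpret PA: prod_data I A
    using I dg_functor.axioms(1)[OF F_I] by (intro prod_data.intro) auto
  interpret PT: prod_data I "\<lambda>_. Tw C"
    using I by (intro prod_data.intro T.dg_category_axioms) auto
  interpret s: glue_data "prod_cat I (\<lambda>_. Tw C)" "prod_cat I A" "AK n" ?F1 ?F2
    by (intro glue_data.intro PA.prod_fun_dg_functor PT.prod_data_axioms PT.tuple_dg_functor AK_dg_category
      f_dg_functor F_I)
  interpret Q: dg_functor "GL (Suc n)" "AK n" "Q n" using nk by (rule Q_dg_functor)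
  interpret P: dg_functor "GL (Suc n)" "prod_cat I A" ?P
    using I k by (intro PA.tuple_dg_functor Q.dom.dg_category_axioms gl_proj_dg_functor) auto
  have F1_simps: "fob ?F1 x = (\<lambda>i\<in>I. fob (FT i) (x i))" "fmor ?F1 x y m u = (\<lambda>i. if i \<in> I then fmor (FT i) (x i) (y i) m (u i) else 0)" for x y m u
    by (simp_all add: prod_fun_def)
  have eq_ob: "fob ?F2 (fob (Q n) x) = fob ?F1 (fob ?P x)" if "x \<in> obj (GL (Suc n))" for x
    using Q_side(1)[OF nk _ that] that unfolding I[symmetric] by (auto simp: F1_simps fun_eq_iff restrict_def)
  have eq: "fun_eq_on (GL (Suc n)) (?F1 \<circ>\<circ> ?P) (?F2 \<circ>\<circ> Q n)"
    using Q_side(2)[OF nk] eq_ob unfolding I[symmetric]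
    by (auto intro!: fun_eq_onI simp: F1_simps fob_comp_fun fmor_comp_fun fun_eq_iff)
  interpret S: dg_functor "GL (Suc n)" s.H ?Q
    unfolding gl_to_sections_def by (rule s.strict_pair_dg_functor[OF P.dg_functor_axioms Q.dg_functor_axioms eq])
  show ?thesis
    unfolding quasi_equivalence_def
  proof (intro conjI ballI)
    show "dg_functor (GL (Suc n)) s.H ?Q" by (rule S.dg_functor_axioms)
  next
    fix x y assume xy: "x \<in> obj (GL (Suc n))" "y \<in> obj (GL (Suc n))"
    note ob = eq_ob[OF xy(1)] eq_ob[OF xy(2)]
    show "quasi_iso (hom (GL (Suc n)) x y) (dif (GL (Suc n)) x y)
        (hom s.H (fob ?Q x) (fob ?Q y)) (dif s.H (fob ?Q x) (fob ?Q y)) (fmor ?Q x y)"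
    proof (rule S.quasi_iso_fmor[OF xy])
      fix i u assume u: "u \<in> hom (GL (Suc n)) x y i" and 0: "fmor ?Q x y i u = 0"
      have 1: "fmor ?P x y i u = 0" "fmor (Q n) x y i u = 0"
        using 0 unfolding gl_to_sections_def strict_pair_simps triple_eq_0 by blast+
      show "u = 0"
      proof (rule Q_inj[OF nk xy u 1(2)])
        fix j assume "j \<in> {1..n + 2}"
        then show "fmor (pr (Suc n) j) x y i u = 0"
          using fun_cong[OF 1(1), of j] unfolding I[symmetric] by simp
      qed
    next
      fix i z assume z: "z \<in> hom s.H (fob ?Q x) (fob ?Q y) i"
        and dz: "dif s.H (fob ?Q x) (fob ?Q y) i z \<in> fmor ?Q x y (i + 1) ` hom (GL (Suc n)) x y (i + 1)"
      let ?x = "fob ?P x" and ?y = "fob ?P y" and ?X = "fob (Q n) x" and ?Y = "fob (Q n) y"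
      have Qx: "fob ?Q x = (?x, ?X, idt PT.P (fob ?F1 ?x))" and Qy: "fob ?Q y = (?y, ?Y, idt PT.P (fob ?F1 ?y))"
        by (simp_all add: gl_to_sections_def)
      have xo: "?x \<in> obj PA.P" "?y \<in> obj PA.P" "?X \<in> obj (AK n)" "?Y \<in> obj (AK n)"
        using xy by (auto intro: P.fob_obj Q.fob_obj simp del: PA.prod_simps PA.tuple_simps)
      obtain g zk \<nu> where z_eq: "z = (g, zk, \<nu>)" by (cases z) auto
      have g: "g \<in> hom PA.P ?x ?y i" and zk: "zk \<in> hom (AK n) ?X ?Y i"
        and \<nu>: "\<nu> \<in> hom PT.P (fob ?F1 ?x) (fob ?F1 ?y) (i - 1)"
        using z unfolding z_eq Qx Qy s.hfib_simps s.glue_hom ob by blast+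
      obtain t where t: "t \<in> hom (AK n) ?X ?Y (i - 1)" "\<And>j. j \<in> {1..n + 2} \<Longrightarrow> fmor (f n j) ?X ?Y (i - 1) t = \<nu> j"
        "path_free (zk - dif (AK n) ?X ?Y (i - 1) t)"
        using path_components_exact[OF nk xy zk, of \<nu>] \<nu> Q_side(1)[OF nk _ xy(1)] Q_side(1)[OF nk _ xy(2)]
        unfolding I[symmetric] by (auto simp: F1_simps)
      have F2t: "fmor ?F2 ?X ?Y (i - 1) t = \<nu>"
        using t(2) \<nu> unfolding I[symmetric] by (auto simp: fun_eq_iff)
      have F2t_hom: "fmor ?F2 ?X ?Y m v \<in> hom PT.P (fob ?F1 ?x) (fob ?F1 ?y) m" if "v \<in> hom (AK n) ?X ?Y m" for v m
        using s.F2.fmor_hom[OF xo(3,4) that] unfolding ob .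
      have F1g: "fmor ?F1 ?x ?y m v \<in> hom PT.P (fob ?F1 ?x) (fob ?F1 ?y) m" if "v \<in> hom PA.P ?x ?y m" for v m
        using s.F1.fmor_hom[OF xo(1,2) that] .
      have F1o: "fob ?F1 ?x \<in> obj PT.P" "fob ?F1 ?y \<in> obj PT.P"
        using s.F1.fob_obj[OF xo(1)] s.F1.fob_obj[OF xo(2)] .
      \<comment> \<open>Both objects come from \<open>strict_pair\<close>, so composing with their
        structure morphisms does nothing and the path entry compares the two images
        directly.\<close>
      have dif_H: "dif s.H (fob ?Q x) (fob ?Q y) m (u, v, r) = (dif PA.P ?x ?y m u, dif (AK n) ?X ?Y m v,
          - dif PT.P (fob ?F1 ?x) (fob ?F1 ?y) (m - 1) r + fmor ?F2 ?X ?Y m v - fmor ?F1 ?x ?y m u)"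
        if "u \<in> hom PA.P ?x ?y m" "v \<in> hom (AK n) ?X ?Y m" for u v r m
        unfolding Qx Qy s.hfib_simps s.glue_dif ob
          PT.prod_dg_category[THEN dg_category.idt_right, OF F1o F2t_hom[OF that(2)]]
          PT.prod_dg_category[THEN dg_category.idt_left, OF F1o F1g[OF that(1)]] ..
      \<comment> \<open>By the choice of t, the boundary of u has \<nu> as path entry over the
        product; subtracting it removes \<nu> together with all path entries inside
        \<open>AK n\<close>.\<close>
      define u where "u = (0 :: nat \<Rightarrow> 'm, t, 0 :: nat \<Rightarrow> 'n mat)"
      have u: "u \<in> hom s.H (fob ?Q x) (fob ?Q y) (i - 1)"
        unfolding u_def Qx Qy s.hfib_simps s.glue_hom ob
        using t(1) s.F1.dom.hom_0[OF xo(1,2)] s.F1.cod.hom_0[OF F1o] by blast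
      have du: "dif s.H (fob ?Q x) (fob ?Q y) (i - 1) u = (0, dif (AK n) ?X ?Y (i - 1) t, \<nu>)"
        unfolding u_def dif_H[OF s.F1.dom.hom_0[OF xo(1,2)] t(1)] F2t
          s.F1.dom.dif_0[OF xo(1,2)] s.F1.cod.dif_0[OF F1o] s.F1.fmor_0[OF xo(1,2)] by simp
      define z' where "z' = zk - dif (AK n) ?X ?Y (i - 1) t"
      have z': "z' \<in> hom (AK n) ?X ?Y i" "path_free z'"
        unfolding z'_def using zk t xo by simp_all
      have z_du: "z - dif s.H (fob ?Q x) (fob ?Q y) (i - 1) u = (g, z', 0)"
        unfolding du z_eq z'_def by simp
      \<comment> \<open>Subtracting a boundary leaves the differential in the image of the functor.
        Its middle entry is therefore path-free and its path entry zero, which are the two remaining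
        premises of \<open>path_free_in_image\<close>.\<close>
      have "dif s.H (fob ?Q x) (fob ?Q y) i (g, z', 0) = dif s.H (fob ?Q x) (fob ?Q y) i z"
        unfolding z_du[symmetric] using S.fob_obj xy z u
        by (simp add: S.cod.dif_linear_simps del: s.hfib_simps)
      then obtain v' where v': "v' \<in> hom (GL (Suc n)) x y (i + 1)"
        "dif s.H (fob ?Q x) (fob ?Q y) i (g, z', 0) = (fmor ?P x y (i + 1) v', fmor (Q n) x y (i + 1) v', 0)"
        using dz unfolding gl_to_sections_def strict_pair_simps by auto
      have dz': "dif (AK n) ?X ?Y i z' = fmor (Q n) x y (i + 1) v'" and F_eq: "fmor ?F2 ?X ?Y i z' = fmor ?F1 ?x ?y i g"
        using v'(2) unfolding dif_H[OF g z'(1)] s.F1.cod.dif_0[OF F1o] by simp_all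
      have "\<exists>v\<in>hom (GL (Suc n)) x y i. fmor (Q n) x y i v = z' \<and> (\<forall>j\<in>{1..n + 2}. fmor (pr (Suc n) j) x y i v = g j)"
      proof (rule path_free_in_image[OF nk xy z'])
        show "path_free (dif (AK n) ?X ?Y i z')"
          unfolding dz' by (rule Q_path_free[OF nk xy v'(1)])
        fix j assume j: "j \<in> {1..n + 2}"
        then show "g j \<in> hom (A j) (fob (pr (Suc n) j) x) (fob (pr (Suc n) j) y) i"
          using g unfolding I[symmetric] by auto
        show "fmor (f n j) ?X ?Y i z' = fmor (FT j) (fob (pr (Suc n) j) x) (fob (pr (Suc n) j) y) i (g j)"
          using fun_cong[OF F_eq, of j] j unfolding I[symmetric] by (simp add: F1_simps)
      qed
      then obtain v where v: "v \<in> hom (GL (Suc n)) x y i" "fmor (Q n) x y i v = z'"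
        "\<And>j. j \<in> I \<Longrightarrow> fmor (pr (Suc n) j) x y i v = g j" unfolding I by blast
      have "fmor ?P x y i v = g" using v(3) g by (auto simp: fun_eq_iff)
      then have "fmor ?Q x y i v = (g, z', 0)"
        unfolding gl_to_sections_def strict_pair_simps v(2) by simp
      then have "z = fmor ?Q x y i v + dif s.H (fob ?Q x) (fob ?Q y) (i - 1) u"
        using z_du by (metis diff_add_cancel)
      then show "\<exists>w\<in>hom (GL (Suc n)) x y i. \<exists>u\<in>hom s.H (fob ?Q x) (fob ?Q y) (i - 1).
          z = fmor ?Q x y i w + dif s.H (fob ?Q x) (fob ?Q y) (i - 1) u"
        using v(1) u by blast
    qed
  next
    fix Y assume Y: "Y \<in> obj s.H"
    obtain a X \<nu> where Y_eq: "Y = (a, X, \<nu>)" by (cases Y) auto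
    have YG: "(a, X, \<nu>) \<in> obj s.G" using Y s.hfib_obj unfolding Y_eq by blast
    then have a: "a \<in> obj PA.P" and X: "X \<in> obj (AK n)"
      and \<nu>: "\<nu> \<in> hom PT.P (fob ?F1 a) (fob ?F2 X) 0" "dif PT.P (fob ?F1 a) (fob ?F2 X) 0 \<nu> = 0"
      unfolding s.glue_obj by blast+
    have Fo: "fob ?F1 a \<in> obj PT.P" "fob ?F2 X \<in> obj PT.P"
      using s.F1.fob_obj[OF a] s.F2.fob_obj[OF X] .
    have h\<nu>: "hiso PT.P (fob ?F1 a) (fob ?F2 X) \<nu>"
      using s.hfib_iso[OF Y[unfolded Y_eq]] s.F1.cod.iso_in_H0_iff[OF Fo \<nu>] unfolding s.F1.cod.cls_def by blast
    have "\<exists>w\<in>obj (GL (Suc n)). (\<forall>j\<in>{1..n + 2}. fob (pr (Suc n) j) w = a j) \<and>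
      (\<exists>\<Phi>. hiso (AK n) (fob (Q n) w) X \<Phi> \<and> (\<forall>j\<in>{1..n + 2}. fmor (f n j) (fob (Q n) w) X 0 \<Phi> = \<nu> j))"
    proof (rule object_lift[OF nk X])
      fix j assume j: "j \<in> {1..n + 2}"
      then show "a j \<in> obj (A j)" using a unfolding I[symmetric] by auto
      \<comment> \<open>Applying a coordinate functor to a homotopy equivalence of the product gives
        one in each factor.\<close>
      show "hiso (Tw C) (fob (FT j) (a j)) (fob (f n j) X) (\<nu> j)"
        using dg_functor.hiso_fmor[OF PT.coord_dg_functor Fo h\<nu>, of j] j unfolding I[symmetric]
        by (simp add: F1_simps)
    qed
    then obtain w \<Phi> where w: "w \<in> obj (GL (Suc n))" "\<And>j. j \<in> I \<Longrightarrow> fob (pr (Suc n) j) w = a j"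
      and \<Phi>: "hiso (AK n) (fob (Q n) w) X \<Phi>" "\<And>j. j \<in> I \<Longrightarrow> fmor (f n j) (fob (Q n) w) X 0 \<Phi> = \<nu> j"
      unfolding I by blast
    \<comment> \<open>Equality is also needed at indices outside \<open>I\<close>, where both
      functions are \<open>undefined\<close>.\<close>
    have Pw: "fob ?P w = a"
    proof
      fix j
      have aP: "a \<in> Pi\<^sub>E I (\<lambda>i. obj (A i))" using a unfolding PA.prod_simps .
      show "fob ?P w j = a j"
        using w(2)[of j] PiE_arb[OF aP, of j] by (cases "j \<in> I") (simp_all add: tuple_fun_def)
    qed
    have F2w: "fob ?F2 (fob (Q n) w) = fob ?F1 a" using eq_ob[OF w(1)] unfolding Pw .
    have Qw: "fob ?Q w = (a, fob (Q n) w, idt PT.P (fob ?F1 a))"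
      unfolding gl_to_sections_def strict_pair_simps Pw ..
    have QH: "(a, fob (Q n) w, idt PT.P (fob ?F1 a)) \<in> obj s.H" using S.fob_obj[OF w(1)] unfolding Qw .
    then have QG: "(a, fob (Q n) w, idt PT.P (fob ?F1 a)) \<in> obj s.G" using s.hfib_obj by blast
    have F2\<Phi>: "fmor ?F2 (fob (Q n) w) X 0 \<Phi> = \<nu>"
      using \<Phi>(2) \<nu>(1) by (auto simp: fun_eq_iff)
    have 0: "0 \<in> hom PT.P (fob ?F1 a) (fob ?F2 X) (0 - 1)" using s.F1.cod.hom_0[OF Fo] .
    \<comment> \<open>The lift has exactly the components \<open>a j\<close>, so the identity serves
      as first entry. Closedness with zero path entry then amounts to \<Phi> having image \<nu>, an
      equality on the nose.\<close>
    have "hiso s.G (a, fob (Q n) w, idt PT.P (fob ?F1 a)) (a, X, \<nu>) (idt PA.P a, \<Phi>, 0)"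
    proof (rule s.hiso_glue[OF QG YG _ _ s.F1.dom.hiso_idt[OF a] \<Phi>(1)])
      show "(idt PA.P a, \<Phi>, 0) \<in> hom s.G (a, fob (Q n) w, idt PT.P (fob ?F1 a)) (a, X, \<nu>) 0"
        unfolding s.glue_hom using s.F1.dom.idt_hom[OF a] hiso_hom[OF \<Phi>(1)] 0 by blast
      show "dif s.G (a, fob (Q n) w, idt PT.P (fob ?F1 a)) (a, X, \<nu>) 0 (idt PA.P a, \<Phi>, 0) = 0"
        unfolding s.glue_dif F2w F2\<Phi> s.F1.fmor_idt[OF a] s.F1.dom.dif_idt[OF a] hiso_closed[OF \<Phi>(1)]
          s.F1.cod.idt_right[OF Fo \<nu>(1)] s.F1.cod.dif_0[OF Fo] triple_eq_0 by simp
    qed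
    then have h: "hiso s.H (fob ?Q w) Y (idt PA.P a, \<Phi>, 0)"
      unfolding Qw Y_eq hiso_def s.hfib_simps .
    then have "iso_in (H0 s.H) (fob ?Q w) Y (S.cod.cls (fob ?Q w) Y 0 (idt PA.P a, \<Phi>, 0))"
      using S.cod.iso_in_H0_iff[OF S.fob_obj[OF w(1)] Y hiso_hom[OF h] hiso_closed[OF h]] by blast
    then show "\<exists>x\<in>obj (GL (Suc n)). \<exists>u. iso_in (H0 s.H) (fob ?Q x) Y u"
      using w(1) by blast
  qed
qed

end

theorem theorem3p10:
  fixes C :: "('p, 'n::ab_group_add, 'k::field_char_0) dgcat"
    and A :: "nat \<Rightarrow> ('o, 'm::ab_group_add, 'k) dgcat"
    and F :: "nat \<Rightarrow> ('o, 'm, 'p, 'n) dgfun"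
    and k :: nat
  assumes "k \<ge> 2"
    and "pretriangulated C"
    and "\<And>i. i \<in> {1..k} \<Longrightarrow> pretriangulated (A i)"
    and "\<And>i. i \<in> {1..k} \<Longrightarrow> spherical (A i) C (F i)"
  shows "\<exists>Q. quasi_equivalence (iterated_gluing C A F k) (global_sections C A F k) Q \<and>
    fun_eq_on (iterated_gluing C A F k) (s_infinity C k \<circ>\<circ> Q) (iterated_cone C A F k)"
proof -
  have incl: "dg_functor C (Tw C) tw_incl"
    using assms(2) by (simp add: pretriangulated_def quasi_equivalence_def)
  interpret schober C A F k
  proof (intro schober.intro tw_category.intro schober_axioms.intro)
    show "dg_category C" "dg_category (Tw C)" using incl by (auto dest: dg_functor.axioms)
    show "2 \<le> k" by fact
    fix i assume "i \<in> {1..k}"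
    then show "dg_functor (A i) (Tw C) (tw_incl \<circ>\<circ> F i)"
      using assms(4) incl by (intro dg_functor_comp[where B = C]) (simp_all add: spherical_def)
  qed
  define n where "n = k - 2"
  have k: "k = n + 2" using assms(1) by (simp add: n_def)
  have Gl: "iterated_gluing C A F k = GL (Suc n)" and cone: "iterated_cone C A F k = cn (Suc n)"
    by (simp_all add: iterated_gluing_def iterated_cone_def k)
  have Ak: "Ak C k = AK n" and Ak_f: "Ak_f C k = f n"
    by (simp_all add: Ak_def Ak_f_def k fun_eq_iff)
  have "quasi_equivalence (GL (Suc n)) (global_sections C A F k) (gl_to_sections {1..k} n)"
    using gluing_equivalence[OF k refl] by (simp add: global_sections_def Ak Ak_f)
  \<comment> \<open>Since \<open>k + 1 = n + 3\<close> and the second projection of the strict pair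
    is \<open>Q n\<close>, this is the strict equality for the last functor of A_k(C).\<close>
  moreover have "fun_eq_on (GL (Suc n)) (s_infinity C k \<circ>\<circ> gl_to_sections {1..k} n) (cn (Suc n))"
  proof (rule fun_eq_onI)
    have k3: "k + 1 = n + 3" and nk: "n + 2 \<le> k" using k by simp_all
    note simps = s_infinity_def fob_comp_fun fmor_comp_fun Ak_f k3 gl_to_sections_def strict_pair_simps
      fob_proj2 fmor_proj2
    fix x assume x: "x \<in> obj (GL (Suc n))"
    show "fob (s_infinity C k \<circ>\<circ> gl_to_sections {1..k} n) x = fob (cn (Suc n)) x"
      unfolding simps by (rule Q_top(1)[OF nk x])
    fix y i u assume "y \<in> obj (GL (Suc n))" "u \<in> hom (GL (Suc n)) x y i"
    then show "fmor (s_infinity C k \<circ>\<circ> gl_to_sections {1..k} n) x y i u = fmor (cn (Suc n)) x y i u"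
      unfolding simps by (rule Q_top(2)[OF nk x])
  qed
  ultimately show ?thesis unfolding Gl cone by blast
qed

end
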